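(* Let $\mathbf T=(T_1,\dots,T_d)$ be a completely hyperexpansive operator $d$-tuple on a complex Hilbert space $\mathcal H$. Then $$D(T_i,T_j):=I-T_i^*T_i-T_j^*T_j+T_i^*T_j^*T_iT_j=0\quad\text{for all }1\le i\ne j\le d$$ if and only if for each $h\in\mathcal H$ the Lévy measure $\nu_{(\mathbf T,h)}$ for $(\mathbf T,h)$ decomposes as $$\nu_{(\mathbf T,h)}=\sum_{i=1}^d\delta_1\times\cdots\times\underbrace{\nu_{(T_i,h)}}_{i\text{-th}}\times\cdots\times\delta_1,$$ where $\nu_{(T_i,h)}$ denotes the Lévy measure for $(T_i,h)$ and, in the $i$-th summand, the $i$-th factor is $\nu_{(T_i,h)}$ while all other factors are the Dirac measure $\delta_1$ at $1$ on $[0,1]$.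
   Context: $\mathbb Z_+$ is the set of nonnegative integers, $\mathbb R_+=[0,\infty)$, $d$ is a positive integer. For $\alpha,\beta\in\mathbb Z_+^d$: $|\beta|=\sum_i\beta_i$, $\binom\alpha\beta=\prod_i\binom{\alpha_i}{\beta_i}$, and $\beta\le\alpha$ means $\beta_i\le\alpha_i$ for all $i$. A commuting $d$-tuple $\mathbf T=(T_1,\dots,T_d)$ consists of bounded linear operators on a complex Hilbert space $\mathcal H$ with $T_iT_j=T_jT_i$ for all $i,j$; $\mathbf T^\beta=T_1^{\beta_1}\cdots T_d^{\beta_d}$. It is completely hyperexpansive if $\sum_{0\le\beta\le\alpha}(-1)^{|\beta|}\binom\alpha\beta\mathbf T^{*\beta}\mathbf T^\beta\le0$ for all $\alpha\in\mathbb Z_+^d\setminus\{0\}$. A function $\phi:\mathbb Z_+^d\to\mathbb R$ is completely alternating if $(\nabla^\alpha\phi)(\beta)\le0$ for all $\beta\in\mathbb Z_+^d$, $\alpha\in\mathbb Z_+^d\setminus\{0\}$, where $\nabla^\alpha=\nabla_1^{\alpha_1}\cdots\nabla_d^{\alpha_d}$, $\nabla_i\phi(\alpha)=\phi(\alpha)-\phi(\alpha+\varepsilon(i))$ and $\varepsilon(i)$ is the $i$-th standard unit tuple. It is known that $\mathbf T$ is completely hyperexpansive if and only if for each $h\in\mathcal H$ the function $\alpha\mapsto\|\mathbf T^\alpha h\|^2$ is completely alternating, and that consequently there exist a unique additive map $b_{(\mathbf T,h)}:\mathbb Z_+^d\to\mathbb R_+$ and a unique positive Radon measure $\nu_{(\mathbf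 T,h)}$ on $[0,1]^d\setminus\{\mathbf 1\}$, $\mathbf 1=(1,\dots,1)$, with $$\|\mathbf T^\alpha h\|^2=\|h\|^2+b_{(\mathbf T,h)}(\alpha)+\int_{[0,1]^d\setminus\{\mathbf 1\}}(1-x^\alpha)\,d\nu_{(\mathbf T,h)}(x),\quad\alpha\in\mathbb Z_+^d\setminus\{0\}.$$ The measure $\nu_{(\mathbf T,h)}$ is called the Lévy measure for $(\mathbf T,h)$. Each $T_i$ is itself completely hyperexpansive, and $\nu_{(T_i,h)}$ is the Lévy measure for $(T_i,h)$ (the case $d=1$), a positive Radon measure on $[0,1)$. The $i$-th product measure lives on $[0,1]\times\cdots\times[0,1)\times\cdots\times[0,1]$ (with $[0,1)$ in the $i$-th place) and is regarded as a measure on $[0,1]^d\setminus\{\mathbf 1\}$ by extending it by zero. *)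

theory Defs
  imports "HOL-Probability.Probability"
begin

section \<open>Complex Hilbert spaces\<close>

text \<open>
  The complex inner product is linear in the first and conjugate linear in the second argument.
  The underlying real Hilbert space structure (in particular the norm and its completeness) is
  that of the library classes, the real inner product being the real part of the complex one.
\<close>

class chilbert_space = real_inner + complete_space +
  fixes scaleC :: "complex \<Rightarrow> 'a \<Rightarrow> 'a" (infixr \<open>*\<^sub>C\<close> 75)
    and cinner :: "'a \<Rightarrow> 'a \<Rightarrow> complex"
  assumes scaleC_add_right: "c *\<^sub>C (x + y) = c *\<^sub>C x + c *\<^sub>C y"
    and scaleC_add_left: "(b + c) *\<^sub>C x = b *\<^sub>C x + c *\<^sub>C x"
    and scaleC_scaleC: "b *\<^sub>C c *\<^sub>C x = (b * c) *\<^sub>C x"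
    and scaleC_of_real: "complex_of_real r *\<^sub>C x = r *\<^sub>R x"
    and cinner_commute: "cinner x y = cnj (cinner y x)"
    and cinner_add_left: "cinner (x + y) z = cinner x z + cinner y z"
    and cinner_scaleC_left: "cinner (c *\<^sub>C x) y = c * cinner x y"
    and Re_cinner: "Re (cinner x y) = x \<bullet> y"

instantiation complex :: chilbert_space
begin

definition "scaleC_complex (c::complex) (x::complex) = c * x"
definition "cinner_complex (x::complex) (y::complex) = x * cnj y"

instance
  by standard
    (auto simp: scaleC_complex_def cinner_complex_def algebra_simps scaleR_conv_of_real
      inner_complex_def)

end

definition bounded_clinear :: "('h::chilbert_space \<Rightarrow> 'h) \<Rightarrow> bool" where
  "bounded_clinear A \<longleftrightarrow> bounded_linear A \<and> (\<forall>c x. A (c *\<^sub>C x) = c *\<^sub>C A x)"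

definition cadjoint :: "('h::chilbert_space \<Rightarrow> 'h) \<Rightarrow> 'h \<Rightarrow> 'h" where
  "cadjoint A = (THE B. \<forall>x y. cinner (A x) y = cinner x (B y))"

definition nonpositive_operator :: "('h::chilbert_space \<Rightarrow> 'h) \<Rightarrow> bool" where
  "nonpositive_operator A \<longleftrightarrow> (\<forall>h. cinner (A h) h \<in> \<real> \<and> Re (cinner (A h) h) \<le> 0)"

section \<open>Operator tuples\<close>

text \<open>
  A \<open>d\<close>-tuple is a family indexed by a finite linearly ordered type \<open>'d\<close> with \<open>d\<close> elements, and
  a multi-index is a function \<open>'d \<Rightarrow> nat\<close>; \<open>\<beta> \<le> \<alpha>\<close> is then the pointwise order. The linear
  order only serves to fix the order of the factors \<open>T\<^sub>1\<^bsup>\<beta>\<^sub>1\<^esup> \<dots> T\<^sub>d\<^bsup>\<beta>\<^sub>d\<^esup>\<close>.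
\<close>

definition commuting_tuple :: "('d \<Rightarrow> 'h::chilbert_space \<Rightarrow> 'h) \<Rightarrow> bool" where
  "commuting_tuple T \<longleftrightarrow> (\<forall>i. bounded_clinear (T i)) \<and> (\<forall>i j. T i \<circ> T j = T j \<circ> T i)"

definition tuple_power ::
    "('d::{finite,linorder} \<Rightarrow> 'h \<Rightarrow> 'h) \<Rightarrow> ('d \<Rightarrow> nat) \<Rightarrow> 'h \<Rightarrow> 'h" where
  "tuple_power T \<beta> = foldr (\<lambda>i A. (T i ^^ \<beta> i) \<circ> A) (sorted_list_of_set UNIV) id"

definition completely_hyperexpansive ::
    "('d::{finite,linorder} \<Rightarrow> 'h::chilbert_space \<Rightarrow> 'h) \<Rightarrow> bool" where
  "completely_hyperexpansive T \<longleftrightarrow> commuting_tuple T \<and>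
     (\<forall>\<alpha>. \<alpha> \<noteq> (\<lambda>_. 0) \<longrightarrow> nonpositive_operator (\<lambda>h.
        \<Sum>\<beta>\<in>{..\<alpha>}. ((-1) ^ (\<Sum>i\<in>UNIV. \<beta> i) * real (\<Prod>i\<in>UNIV. \<alpha> i choose \<beta> i)) *\<^sub>R
          tuple_power (\<lambda>i. cadjoint (T i)) \<beta> (tuple_power T \<beta> h)))"

definition pair_defect :: "('h::chilbert_space \<Rightarrow> 'h) \<Rightarrow> ('h \<Rightarrow> 'h) \<Rightarrow> 'h \<Rightarrow> 'h" where
  "pair_defect A B = (\<lambda>h. h - cadjoint A (A h) - cadjoint B (B h)
     + cadjoint A (cadjoint B (A (B h))))"

section \<open>Levy measures\<close>

definition punctured_cube :: "('d \<Rightarrow> real) set" where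
  "punctured_cube = {x. \<forall>i. x i \<in> {0..1}} - {\<lambda>_. 1}"

definition radon_measure_on :: "'a::topological_space set \<Rightarrow> 'a measure \<Rightarrow> bool" where
  "radon_measure_on S M \<longleftrightarrow> sets M = sets (restrict_space borel S) \<and>
     (\<forall>K. compact K \<and> K \<subseteq> S \<longrightarrow> emeasure M K < \<infinity>) \<and>
     (\<forall>B\<in>sets M. emeasure M B = (SUP K\<in>{K. compact K \<and> K \<subseteq> B}. emeasure M K))"

text \<open>
  Integrability is required explicitly because the Bochner integral of a non-integrable function
  is \<open>0\<close> by convention.
\<close>

definition is_levy_measure ::
    "('d::{finite,linorder} \<Rightarrow> 'h::chilbert_space \<Rightarrow> 'h) \<Rightarrow> 'h \<Rightarrow> ('d \<Rightarrow> real) measure \<Rightarrow> bool"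
  where
  "is_levy_measure T h \<nu> \<longleftrightarrow> radon_measure_on punctured_cube \<nu> \<and>
     (\<exists>b :: ('d \<Rightarrow> nat) \<Rightarrow> real.
        (\<forall>\<alpha>. b \<alpha> \<ge> 0) \<and> (\<forall>\<alpha> \<beta>. b (\<lambda>i. \<alpha> i + \<beta> i) = b \<alpha> + b \<beta>) \<and>
        (\<forall>\<alpha>. \<alpha> \<noteq> (\<lambda>_. 0) \<longrightarrow>
           integrable \<nu> (\<lambda>x. 1 - (\<Prod>i\<in>UNIV. x i ^ \<alpha> i)) \<and>
           (norm (tuple_power T \<alpha> h))\<^sup>2 =
             (norm h)\<^sup>2 + b \<alpha> + (LINT x|\<nu>. 1 - (\<Prod>i\<in>UNIV. x i ^ \<alpha> i))))"

definition levy_measure ::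
    "('d::{finite,linorder} \<Rightarrow> 'h::chilbert_space \<Rightarrow> 'h) \<Rightarrow> 'h \<Rightarrow> ('d \<Rightarrow> real) measure" where
  "levy_measure T h = (THE \<nu>. is_levy_measure T h \<nu>)"

text \<open>
  The case \<open>d = 1\<close>, transported from \<open>[0,1]\<^sup>1 - {\<one>}\<close> (functions on a one-element type) to
  \<open>[0,1)\<close>.
\<close>

definition levy_measure1 :: "('h::chilbert_space \<Rightarrow> 'h) \<Rightarrow> 'h \<Rightarrow> real measure" where
  "levy_measure1 A h =
     distr (levy_measure (\<lambda>_::unit. A) h) (restrict_space borel {0..<1}) (\<lambda>x. x ())"

definition levy_factor_product ::
    "('d::{finite,linorder} \<Rightarrow> 'h::chilbert_space \<Rightarrow> 'h) \<Rightarrow> 'h \<Rightarrow> 'd \<Rightarrow> ('d \<Rightarrow> real) measure"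
  where
  "levy_factor_product T h i = (\<Pi>\<^sub>M j\<in>UNIV.
     if j = i then levy_measure1 (T i) h else return (restrict_space borel {0..1}) 1)"

text \<open>Extension by zero is the image measure under the inclusion of the underlying spaces.\<close>

definition zero_extension :: "'a measure \<Rightarrow> 'a measure \<Rightarrow> 'a measure" where
  "zero_extension N M = distr M N (\<lambda>x. x)"

definition sum_of_measures :: "'a measure \<Rightarrow> 'i set \<Rightarrow> ('i \<Rightarrow> 'a measure) \<Rightarrow> 'a measure" where
  "sum_of_measures N I M =
     measure_of (space N) (sets N) (\<lambda>A. \<Sum>i\<in>I. emeasure (M i) A)"

end

theory Submission
  imports Defs
begin

text \<open>
  Put \<open>\<phi>(\<alpha>) = \<parallel>T\<^sup>\<alpha> h\<parallel>\<^sup>2\<close>. The mixed second difference of \<open>\<phi>\<close> in the directions \<open>i\<close> and \<open>j\<close> at \<open>\<alpha>\<close> is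
  the quadratic form of \<open>D(T\<^sub>i, T\<^sub>j)\<close> at \<open>T\<^sup>\<alpha> h\<close>, and the Levy-Khinchin formula turns it into
  \<open>- \<integral> x\<^sup>\<alpha> (1 - x\<^sub>i) (1 - x\<^sub>j) d\<nu>\<close>. This integral vanishes when \<open>\<nu>\<close> is carried by the coordinate
  edges through \<open>\<one>\<close>. Conversely, if all mixed differences vanish, then \<open>\<phi>\<close> is a sum of functions of
  one variable, the one-variable representations add up, and uniqueness identifies \<open>\<nu>\<close>.

  The Levy measure is a definite description, so its existence and uniqueness are needed. Both reduce to the
  Hausdorff moment problem on \<open>[0,1]\<^sup>d\<close>. It is solved by Bernstein measures, which are lifted to the real
  line along a space-filling curve, where Helly's selection theorem supplies a weak limit.
\<close>

section \<open>Hilbert space operators\<close>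

text \<open>A Levy measure may have infinite mass near the corner (1,...,1), while the moment
  problem concerns finite measures. The remedy is a weight that vanishes on the cube at the corner
  only: \<open>corner_distance\<close>, the sum of all 1 - x_i. Uniqueness multiplies by its square
  and not by the weight itself, since first differences of \<phi> contain the unknown additive part
  b and second differences do not. Existence has to divide by the weight, which is possible off the
  corner only; the mass that the measures of the first differences carry at the corner is therefore
  no part of \<nu> and becomes b. The one-variable measures come from \<nu> itself, as images under
  the coordinates, so the decomposition identifies \<nu> with the sum of its own projections to the
  edges. The operators matter at the two ends only: the hyperexpansivity inequality, evaluated at
  T^\<gamma> h, makes \<phi> completely alternating, and polarization recovers D(T_i, T_j) from its
  quadratic form. The adjoint is a definite description too; its existence rests on the Riesz
  representation theorem.\<close>

text \<open>The hyperplane f = 1 has a point z of least norm; minimality makes z orthogonal to the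
  kernel of f, and z divided by its squared norm represents f.\<close>

theorem riesz_representation:
  fixes f :: "'a::{real_inner,complete_space} \<Rightarrow> real"
  assumes "bounded_linear f"
  obtains z where "\<And>x. f x = x \<bullet> z"
proof (cases "\<forall>x. f x = 0")
  case True
  then show thesis using that[of 0] by simp
next
  case False
  interpret f: bounded_linear f by fact
  define S where "S = {x. f x = 1}"
  obtain v where v: "f v \<noteq> 0" using False by auto
  have "v /\<^sub>R f v \<in> S" using v by (simp add: S_def f.scaleR)
  then have ne: "S \<noteq> {}" by auto
  define D where "D = (INF x\<in>S. (norm x)\<^sup>2)"
  have bdd: "bdd_below ((\<lambda>x. (norm x)\<^sup>2) ` S)" by (rule bdd_belowI[of _ 0]) auto
  have lower: "D \<le> (norm x)\<^sup>2" if "f x = 1" for x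
    unfolding D_def using that bdd by (intro cINF_lower) (auto simp: S_def)
  have "\<exists>x\<in>S. (norm x)\<^sup>2 < D + 1 / Suc n" for n
    using cInf_lessD[of "(\<lambda>x. (norm x)\<^sup>2) ` S" "D + 1 / Suc n"] ne by (auto simp: D_def)
  then obtain X where X: "\<And>n. f (X n) = 1" "\<And>n. (norm (X n))\<^sup>2 < D + 1 / Suc n"
    unfolding S_def by (auto simp: Bex_def) metis
  \<comment> \<open>Parallelogram law: the midpoint of two points of the hyperplane stays in it, so
    two nearly minimal norms force the points together.\<close>
  have par: "(norm (x - y))\<^sup>2 = 2 * (norm x)\<^sup>2 + 2 * (norm y)\<^sup>2 - 4 * (norm ((1/2) *\<^sub>R (x + y)))\<^sup>2" for x y :: 'a
    by (simp add: power2_norm_eq_inner inner_diff inner_add inner_commute algebra_simps)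
  have dist: "(norm (X m - X n))\<^sup>2 < 2 / Suc m + 2 / Suc n" for m n
  proof -
    have "f ((1/2) *\<^sub>R (X m + X n)) = 1" by (simp add: f.scaleR f.add X)
    from lower[OF this] show ?thesis using X(2)[of m] X(2)[of n] par[of "X m" "X n"] by simp
  qed
  have "Cauchy X"
  proof (rule metric_CauchyI)
    fix e :: real assume "e > 0"
    then obtain N where N: "1 / Suc N < e\<^sup>2 / 4"
      using nat_approx_posE[of "e\<^sup>2 / 4"] by auto
    have "dist (X m) (X n) < e" if "m \<ge> N" "n \<ge> N" for m n
    proof -
      have a: "1 / Suc k \<le> 1 / Suc N" if "k \<ge> N" for k
        using that by (simp add: frac_le)
      have "(norm (X m - X n))\<^sup>2 < e\<^sup>2"
        using dist[of m n] a[OF that(1)] a[OF that(2)] N by simp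
      then show ?thesis using \<open>e > 0\<close> by (simp add: dist_norm power2_less_imp_less)
    qed
    then show "\<exists>M. \<forall>m\<ge>M. \<forall>n\<ge>M. dist (X m) (X n) < e" by blast
  qed
  then obtain z where z: "X \<longlonglongrightarrow> z" using Cauchy_convergent_iff convergent_def by blast
  have "(\<lambda>n. f (X n)) \<longlonglongrightarrow> f z" by (rule f.tendsto[OF z])
  then have fz: "f z = 1" using X(1) by (simp add: LIMSEQ_const_iff)
  have "(norm z)\<^sup>2 \<le> D"
  proof (rule LIMSEQ_le)
    show "(\<lambda>n. (norm (X n))\<^sup>2) \<longlonglongrightarrow> (norm z)\<^sup>2" by (intro tendsto_intros z)
    show "(\<lambda>n. D + 1 / Suc n) \<longlonglongrightarrow> D"
      using tendsto_add[OF tendsto_const lim_1_over_n[THEN LIMSEQ_Suc]] by simp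
    show "\<exists>N. \<forall>n\<ge>N. (norm (X n))\<^sup>2 \<le> D + 1 / Suc n" using X(2) less_imp_le by blast
  qed
  then have zmin: "(norm z)\<^sup>2 \<le> (norm x)\<^sup>2" if "f x = 1" for x
    using lower[OF that] by linarith
  have orth: "v \<bullet> z = 0" if "f v = 0" for v
  proof (cases "v = 0")
    case False
    \<comment> \<open>This t minimizes the squared norm of z + t v; there it drops by
      \<open>(v \<bullet> z)\<^sup>2 / (v \<bullet> v)\<close>, which minimality of z forbids unless
      it is 0.\<close>
    define t where "t = - (v \<bullet> z) / (v \<bullet> v)"
    have "f (z + t *\<^sub>R v) = 1" using fz that by (simp add: f.add f.scaleR)
    moreover have "(norm (z + t *\<^sub>R v))\<^sup>2 = (norm z)\<^sup>2 + (2 * t * (v \<bullet> z) + t\<^sup>2 * (v \<bullet> v))"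
      by (simp add: power2_norm_eq_inner inner_add inner_commute algebra_simps power2_eq_square[of t])
    ultimately have "0 \<le> 2 * t * (v \<bullet> z) + t\<^sup>2 * (v \<bullet> v)"
      using zmin by fastforce
    also have "\<dots> = - ((v \<bullet> z)\<^sup>2 / (v \<bullet> v))"
      using False by (simp add: t_def field_simps power2_eq_square)
    finally have "(v \<bullet> z)\<^sup>2 / (v \<bullet> v) \<le> 0" by simp
    moreover have "v \<bullet> v > 0" using False by simp
    ultimately show ?thesis by (metis divide_le_0_iff leD zero_le_power2 order_antisym power_eq_0_iff)
  qed simp
  have zn: "z \<bullet> z > 0" using fz by (auto simp: f.zero)
  show thesis
  proof (rule that[of "z /\<^sub>R (z \<bullet> z)"])
    fix x
    have "(x - f x *\<^sub>R z) \<bullet> z = 0" by (rule orth) (simp add: f.diff f.scaleR fz)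
    then show "f x = x \<bullet> (z /\<^sub>R (z \<bullet> z))"
      using zn by (simp add: inner_diff field_simps)
  qed
qed

text \<open>Multiplying the first argument by -i moves the imaginary part of \<open>cinner\<close>
  into the real part, so an identity of complex inner products is two identities of real
  ones.\<close>

lemma cinner_eq_iff_inner:
  fixes x y u v :: "'h::chilbert_space"
  shows "cinner x y = cinner u v \<longleftrightarrow>
    x \<bullet> y = u \<bullet> v \<and> ((- \<i>) *\<^sub>C x) \<bullet> y = ((- \<i>) *\<^sub>C u) \<bullet> v"
  by (auto simp: complex_eq_iff Re_cinner[symmetric] cinner_scaleC_left)

text \<open>Unfolds the definite description in \<open>cadjoint\<close>: Riesz, applied to
  \<open>\<lambda>v. A v \<bullet> w\<close>, gives a real adjoint, and complex homogeneity of A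
  upgrades it to a complex one.\<close>

lemma cadjoint_inner:
  fixes A :: "'h::chilbert_space \<Rightarrow> 'h"
  assumes "bounded_clinear A"
  shows "cadjoint A x \<bullet> y = x \<bullet> A y"
proof -
  interpret A: bounded_linear A using assms by (simp add: bounded_clinear_def)
  have scal: "A (c *\<^sub>C v) = c *\<^sub>C A v" for c v using assms by (simp add: bounded_clinear_def)
  have "\<exists>z. \<forall>v. A v \<bullet> w = v \<bullet> z" for w
  proof -
    have "bounded_linear (\<lambda>v. A v \<bullet> w)"
      by (intro bounded_linear_inner_left_comp A.bounded_linear_axioms)
    then show ?thesis using riesz_representation[of "\<lambda>v. A v \<bullet> w"] by metis
  qed
  then obtain B where B: "\<And>v w. A v \<bullet> w = v \<bullet> B w" by metis
  have "cadjoint A = B" unfolding cadjoint_def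
  proof (rule the_equality)
    show "\<forall>x y. cinner (A x) y = cinner x (B y)"
      by (simp add: cinner_eq_iff_inner B[symmetric] scal)
  next
    fix B' assume "\<forall>x y. cinner (A x) y = cinner x (B' y)"
    then have eq: "x \<bullet> B' y = x \<bullet> B y" for x y by (metis B Re_cinner)
    show "B' = B"
    proof
      fix y
      have "(B' y - B y) \<bullet> (B' y - B y) = 0" using eq by (simp add: inner_diff_right)
      then show "B' y = B y" by simp
    qed
  qed
  then show ?thesis using B by (simp add: inner_commute)
qed

text \<open>Commutativity turns the last term into the form
  \<open>A (B x) \<bullet> A (B y)\<close>, so the defect has a symmetric real form and polarization
  recovers it from the diagonal.\<close>

lemma pair_defect_eq_0_iff:
  fixes A B :: "'h::chilbert_space \<Rightarrow> 'h"
  assumes A: "bounded_clinear A" and B: "bounded_clinear B" and comm: "A \<circ> B = B \<circ> A"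
  shows "pair_defect A B = (\<lambda>_. 0) \<longleftrightarrow>
    (\<forall>h. (norm (A (B h)))\<^sup>2 - (norm (A h))\<^sup>2 - (norm (B h))\<^sup>2 + (norm h)\<^sup>2 = 0)"
proof -
  interpret A: bounded_linear A using A by (simp add: bounded_clinear_def)
  interpret B: bounded_linear B using B by (simp add: bounded_clinear_def)
  have AB: "A (B x) = B (A x)" for x using comm by (metis comp_apply)
  define q where "q x y = x \<bullet> y - A x \<bullet> A y - B x \<bullet> B y + A (B x) \<bullet> A (B y)" for x y
  have D: "pair_defect A B x \<bullet> y = q x y" for x y
    by (simp add: pair_defect_def q_def inner_diff inner_add cadjoint_inner[OF A] cadjoint_inner[OF B] AB)
  have qq: "q h h = (norm (A (B h)))\<^sup>2 - (norm (A h))\<^sup>2 - (norm (B h))\<^sup>2 + (norm h)\<^sup>2" for h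
    by (simp add: q_def power2_norm_eq_inner)
  have "q (x + y) (x + y) = q x x + q y y + 2 * q x y" for x y
    by (simp add: q_def A.add B.add inner_add inner_commute)
  then have pol: "q x y = 0" if "\<forall>h. q h h = 0" for x y using that by simp
  show ?thesis unfolding qq[symmetric]
  proof
    assume "\<forall>h. q h h = 0"
    then have "pair_defect A B x \<bullet> pair_defect A B x = 0" for x using pol D by simp
    then show "pair_defect A B = (\<lambda>_. 0)" by (auto simp: fun_eq_iff)
  next
    assume "pair_defect A B = (\<lambda>_. 0)"
    then show "\<forall>h. q h h = 0" using D by (metis inner_zero_left)
  qed
qed

section \<open>Powers of commuting tuples and their adjoints\<close>

lemma funpow_comp_commute:
  assumes "f \<circ> g = g \<circ> f"
  shows "(f ^^ m) \<circ> g = g \<circ> (f ^^ m)"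
proof (induction m)
  case (Suc m)
  have "f (g x) = g (f x)" "(f ^^ m) (g x) = g ((f ^^ m) x)" for x
    using assms Suc by (metis comp_apply)+
  then show ?case by (simp add: fun_eq_iff)
qed simp

lemma foldr_compow_commute:
  assumes "\<And>i. i \<in> set xs \<Longrightarrow> T i \<circ> S = S \<circ> T i"
  shows "foldr (\<lambda>i A. (T i ^^ \<beta> i) \<circ> A) xs id \<circ> S = S \<circ> foldr (\<lambda>i A. (T i ^^ \<beta> i) \<circ> A) xs id"
  using assms
proof (induction xs)
  case (Cons i xs)
  have "(T i ^^ \<beta> i) \<circ> S = S \<circ> (T i ^^ \<beta> i)"
    by (rule funpow_comp_commute) (rule Cons.prems, simp)
  moreover have "foldr (\<lambda>i A. (T i ^^ \<beta> i) \<circ> A) xs id \<circ> S = S \<circ> foldr (\<lambda>i A. (T i ^^ \<beta> i) \<circ> A) xs id"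
    by (rule Cons.IH) (rule Cons.prems, simp)
  ultimately show ?case unfolding foldr.simps o_apply by (metis comp_assoc)
qed simp

lemma foldr_compow_add:
  assumes "\<And>i j. T i \<circ> T j = T j \<circ> T i"
  shows "foldr (\<lambda>i A. (T i ^^ (\<alpha> i + \<beta> i)) \<circ> A) xs id =
    foldr (\<lambda>i A. (T i ^^ \<alpha> i) \<circ> A) xs id \<circ> foldr (\<lambda>i A. (T i ^^ \<beta> i) \<circ> A) xs id"
proof (induction xs)
  case (Cons i xs)
  have "foldr (\<lambda>i A. (T i ^^ \<alpha> i) \<circ> A) xs id \<circ> (T i ^^ \<beta> i) = (T i ^^ \<beta> i) \<circ> foldr (\<lambda>i A. (T i ^^ \<alpha> i) \<circ> A) xs id"
    by (rule foldr_compow_commute) (metis assms funpow_comp_commute)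
  with Cons show ?case unfolding foldr.simps o_apply funpow_add by (metis comp_assoc)
qed simp

lemma tuple_power_add:
  assumes "\<And>i j. T i \<circ> T j = T j \<circ> T i"
  shows "tuple_power T (\<lambda>i. \<alpha> i + \<beta> i) h = tuple_power T \<alpha> (tuple_power T \<beta> h)"
  unfolding tuple_power_def foldr_compow_add[OF assms] by simp

lemma tuple_power_0 [simp]: "tuple_power T (\<lambda>_. 0) h = h"
proof -
  have "foldr (\<lambda>i A. (T i ^^ 0) \<circ> A) xs id = id" for xs by (induction xs) auto
  then show ?thesis by (simp add: tuple_power_def)
qed

lemma foldr_compow_single:
  "distinct xs \<Longrightarrow> foldr (\<lambda>j A. (T j ^^ (if j = i then n else 0)) \<circ> A) xs id =
    (if i \<in> set xs then T i ^^ n else id)"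
  by (induction xs) auto

lemma tuple_power_single: "tuple_power T (\<lambda>j. if j = i then n else 0) = T i ^^ n"
  unfolding tuple_power_def by (subst foldr_compow_single) auto

lemma tuple_power_unit: "tuple_power (\<lambda>_::unit. A) \<alpha> = A ^^ \<alpha> ()"
  using tuple_power_single[of "\<lambda>_::unit. A" "()" "\<alpha> ()"] by (simp add: old.unit.exhaust)

text \<open>Taking adjoints reverses the order of the factors, whereas \<open>tuple_power\<close>
  keeps the order for the adjoints too; commutativity of T undoes the reversal.\<close>

lemma tuple_power_cadjoint_inner:
  fixes T :: "'d::{finite,linorder} \<Rightarrow> 'h::chilbert_space \<Rightarrow> 'h"
  assumes T: "commuting_tuple T"
  shows "tuple_power (\<lambda>i. cadjoint (T i)) \<beta> x \<bullet> y = x \<bullet> tuple_power T \<beta> y"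
proof -
  have b: "bounded_clinear (T i)" and c: "T i \<circ> T j = T j \<circ> T i" for i j
    using T by (auto simp: commuting_tuple_def)
  have pow: "(cadjoint (T i) ^^ n) x \<bullet> y = x \<bullet> (T i ^^ n) y" for i n x y
  proof (induction n arbitrary: y)
    case (Suc n)
    have "(cadjoint (T i) ^^ Suc n) x \<bullet> y = (cadjoint (T i) ^^ n) x \<bullet> T i y"
      by (simp add: cadjoint_inner[OF b])
    then show ?case by (simp only: Suc funpow_Suc_right comp_apply)
  qed simp
  have "foldr (\<lambda>i A. (cadjoint (T i) ^^ \<beta> i) \<circ> A) xs id x \<bullet> y =
    x \<bullet> foldr (\<lambda>i A. (T i ^^ \<beta> i) \<circ> A) xs id y" for xs
  proof (induction xs arbitrary: y)
    case (Cons i xs)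
    have "foldr (\<lambda>i A. (T i ^^ \<beta> i) \<circ> A) xs id \<circ> (T i ^^ \<beta> i) =
        (T i ^^ \<beta> i) \<circ> foldr (\<lambda>i A. (T i ^^ \<beta> i) \<circ> A) xs id"
      by (rule foldr_compow_commute) (metis c funpow_comp_commute)
    from fun_cong[OF this, of y] Cons.IH[of "(T i ^^ \<beta> i) y"]
    have "(cadjoint (T i) ^^ \<beta> i) (foldr (\<lambda>i A. (cadjoint (T i) ^^ \<beta> i) \<circ> A) xs id x) \<bullet> y =
      x \<bullet> (T i ^^ \<beta> i) (foldr (\<lambda>i A. (T i ^^ \<beta> i) \<circ> A) xs id y)"
      unfolding pow by (metis comp_apply)
    then show ?case unfolding foldr.simps by (metis comp_apply)
  qed simp
  then show ?thesis by (simp add: tuple_power_def)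
qed

section \<open>Iterated differences and Bernstein weights\<close>

text \<open>The sign is distributed over the factors, so that the coefficient is a pure product over
  coordinates and Pascal's rule can act on a single one.\<close>

definition signed_binomial :: "('d::finite \<Rightarrow> nat) \<Rightarrow> ('d \<Rightarrow> nat) \<Rightarrow> real" where
  "signed_binomial \<alpha> \<beta> = (\<Prod>i\<in>UNIV. (-1) ^ \<beta> i * real (\<alpha> i choose \<beta> i))"

text \<open>The closed binomial form of the iterated difference at \<gamma>; it matches the operator
  sum of complete hyperexpansivity term by term. \<open>nabla_add_unit\<close> recovers the single
  steps.\<close>

definition nabla :: "('d::finite \<Rightarrow> nat) \<Rightarrow> (('d \<Rightarrow> nat) \<Rightarrow> real) \<Rightarrow> ('d \<Rightarrow> nat) \<Rightarrow> real" where
  "nabla \<alpha> f \<gamma> = (\<Sum>\<beta>\<in>{..\<alpha>}. signed_binomial \<alpha> \<beta> * f (\<lambda>i. \<beta> i + \<gamma> i))"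

definition unit_index :: "'d \<Rightarrow> 'd \<Rightarrow> nat" where
  "unit_index i = (\<lambda>j. if j = i then 1 else 0)"

lemma signed_binomial_eq_0: "\<not> \<beta> \<le> \<alpha> \<Longrightarrow> signed_binomial \<alpha> \<beta> = 0"
  by (auto simp: signed_binomial_def le_fun_def not_le intro!: prod_zero)

lemma atMost_fun_eq_PiE: "{..\<alpha>} = PiE (UNIV :: 'd::finite set) (\<lambda>i. {..\<alpha> i :: nat})"
  by (auto simp: le_fun_def PiE_def Pi_def)

lemma finite_atMost_fun [simp]: "finite {..\<alpha> :: 'd::finite \<Rightarrow> nat}"
  unfolding atMost_fun_eq_PiE by (intro finite_PiE) auto

lemma nabla_eq_larger_box:
  assumes "\<alpha> \<le> \<mu>"
  shows "nabla \<alpha> f \<gamma> = (\<Sum>\<beta>\<in>{..\<mu>}. signed_binomial \<alpha> \<beta> * f (\<lambda>i. \<beta> i + \<gamma> i))"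
  unfolding nabla_def
  by (rule sum.mono_neutral_left) (use assms in \<open>auto simp: signed_binomial_eq_0\<close>)

text \<open>Pascal's rule in coordinate j; the minus sign comes from the power of -1. The case
  \<open>\<beta> j = 0\<close> is separate because natural subtraction would not shift.\<close>

lemma signed_binomial_add_unit:
  "signed_binomial (\<lambda>i. \<alpha> i + unit_index j i) \<beta> =
    signed_binomial \<alpha> \<beta> - (if \<beta> j = 0 then 0 else signed_binomial \<alpha> (\<lambda>i. \<beta> i - unit_index j i))"
proof -
  have split: "(\<Prod>i\<in>UNIV. g i) = g j * (\<Prod>i\<in>UNIV - {j}. g i)" for g :: "'a \<Rightarrow> real"
    by (rule prod.remove) auto
  have rest: "(\<Prod>i\<in>UNIV - {j}. (-1) ^ (\<beta> i - unit_index j i) * real (\<alpha> i choose (\<beta> i - unit_index j i))) =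
      (\<Prod>i\<in>UNIV - {j}. (-1) ^ \<beta> i * real (\<alpha> i choose \<beta> i))"
    "(\<Prod>i\<in>UNIV - {j}. (-1) ^ \<beta> i * real ((\<alpha> i + unit_index j i) choose \<beta> i)) =
      (\<Prod>i\<in>UNIV - {j}. (-1) ^ \<beta> i * real (\<alpha> i choose \<beta> i))"
    by (intro prod.cong; simp add: unit_index_def)+
  show ?thesis
    unfolding signed_binomial_def split rest
    by (cases "\<beta> j") (auto simp: unit_index_def algebra_simps)
qed

text \<open>After Pascal's rule, shifting \<beta> down by one in coordinate j turns the second half
  of the sum into the same difference at the moved base point.\<close>

lemma nabla_add_unit:
  "nabla (\<lambda>i. \<alpha> i + unit_index j i) f \<gamma> = nabla \<alpha> f \<gamma> - nabla \<alpha> f (\<lambda>i. \<gamma> i + unit_index j i)"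
proof -
  define \<mu> where "\<mu> = (\<lambda>i. \<alpha> i + unit_index j i)"
  have "nabla \<mu> f \<gamma> = (\<Sum>\<beta>\<in>{..\<mu>}. signed_binomial \<alpha> \<beta> * f (\<lambda>i. \<beta> i + \<gamma> i)) -
     (\<Sum>\<beta>\<in>{..\<mu>}. (if \<beta> j = 0 then 0 else signed_binomial \<alpha> (\<lambda>i. \<beta> i - unit_index j i)) * f (\<lambda>i. \<beta> i + \<gamma> i))"
    by (simp add: nabla_def \<mu>_def signed_binomial_add_unit left_diff_distrib sum_subtractf)
  also have "(\<Sum>\<beta>\<in>{..\<mu>}. signed_binomial \<alpha> \<beta> * f (\<lambda>i. \<beta> i + \<gamma> i)) = nabla \<alpha> f \<gamma>"
    by (rule nabla_eq_larger_box[symmetric]) (auto simp: \<mu>_def le_fun_def)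
  also have "(\<Sum>\<beta>\<in>{..\<mu>}. (if \<beta> j = 0 then 0 else signed_binomial \<alpha> (\<lambda>i. \<beta> i - unit_index j i)) * f (\<lambda>i. \<beta> i + \<gamma> i)) =
      (\<Sum>\<beta>\<in>{\<beta>\<in>{..\<mu>}. \<beta> j \<noteq> 0}. signed_binomial \<alpha> (\<lambda>i. \<beta> i - unit_index j i) * f (\<lambda>i. \<beta> i + \<gamma> i))"
    by (rule sum.mono_neutral_cong_right) auto
  also have "\<dots> = nabla \<alpha> f (\<lambda>i. \<gamma> i + unit_index j i)"
    unfolding nabla_def
  proof (rule sum.reindex_bij_witness[of _ "\<lambda>\<beta> i. \<beta> i + unit_index j i" "\<lambda>\<beta> i. \<beta> i - unit_index j i"])
    fix \<beta> assume b: "\<beta> \<in> {\<beta> \<in> {..\<mu>}. \<beta> j \<noteq> 0}"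
    then have le: "unit_index j i \<le> \<beta> i" for i by (auto simp: unit_index_def)
    then show "(\<lambda>i. \<beta> i - unit_index j i + unit_index j i) = \<beta>" by auto
    show "(\<lambda>i. \<beta> i - unit_index j i) \<in> {..\<alpha>}"
      using b by (auto simp: le_fun_def \<mu>_def) (metis le_diff_conv)
    have "(\<lambda>i. \<beta> i - unit_index j i + (\<gamma> i + unit_index j i)) = (\<lambda>i. \<beta> i + \<gamma> i)"
    proof
      fix i show "\<beta> i - unit_index j i + (\<gamma> i + unit_index j i) = \<beta> i + \<gamma> i" using le[of i] by linarith
    qed
    then show "signed_binomial \<alpha> (\<lambda>i. \<beta> i - unit_index j i) * f (\<lambda>i. \<beta> i - unit_index j i + (\<gamma> i + unit_index j i)) =
         signed_binomial \<alpha> (\<lambda>i. \<beta> i - unit_index j i) * f (\<lambda>i. \<beta> i + \<gamma> i)" by simp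
  qed (auto simp: le_fun_def \<mu>_def unit_index_def)
  finally show ?thesis by (simp add: \<mu>_def)
qed

lemma nabla_0 [simp]: "nabla (\<lambda>_. 0) f \<gamma> = f \<gamma>"
proof -
  have "{..(\<lambda>_. 0) :: 'a \<Rightarrow> nat} = {\<lambda>_. 0}" by (auto simp: le_fun_def)
  then show ?thesis by (simp add: nabla_def signed_binomial_def)
qed

text \<open>A forward difference is minus one step of \<open>nabla\<close>. This sign flip turns a
  completely alternating function into completely monotone ones, to which the moment problem
  applies.\<close>

lemma nabla_forward_difference:
  "nabla \<alpha> (\<lambda>\<beta>. f (\<lambda>i. \<beta> i + unit_index j i) - f \<beta>) \<gamma> = - nabla (\<lambda>i. \<alpha> i + unit_index j i) f \<gamma>"
  by (simp add: nabla_add_unit) (simp add: nabla_def right_diff_distrib sum_subtractf add_ac)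

lemma nabla_sum: "nabla \<alpha> (\<lambda>\<beta>. \<Sum>j\<in>J. f j \<beta>) \<gamma> = (\<Sum>j\<in>J. nabla \<alpha> (f j) \<gamma>)"
  unfolding nabla_def sum_distrib_left by (rule sum.swap)

text \<open>The mass that the \<open>n\<close>-th Bernstein measure of \<open>f\<close> puts on the grid point \<open>\<kappa>/n\<close>.\<close>
definition bernstein_weight :: "nat \<Rightarrow> (('d::finite \<Rightarrow> nat) \<Rightarrow> real) \<Rightarrow> ('d \<Rightarrow> nat) \<Rightarrow> real" where
  "bernstein_weight n f \<kappa> = (\<Prod>i\<in>UNIV. real (n choose \<kappa> i)) * nabla (\<lambda>i. n - \<kappa> i) f \<kappa>"

section \<open>Binomial inversion and exactness of Bernstein weights\<close>

text \<open>The binomial matrix is inverted by its signed version. One use of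
  \<open>choose_mult\<close> pulls out the dependence on n, a second one leaves an alternating row
  of Pascal's triangle.\<close>

lemma alternating_binomial_delta:
  fixes a d n :: nat
  assumes "a \<le> n" "d \<le> n"
  shows "(\<Sum>k\<le>n. real (n choose k) * (real (k choose a) / real (n choose a)) *
      (if k \<le> d then (-1) ^ (d - k) * real ((n - k) choose (d - k)) else 0)) = (if d = a then 1 else 0)"
proof -
  have pos: "real (n choose a) > 0" using assms by (simp add: zero_less_binomial)
  have "(\<Sum>k\<le>n. real (n choose k) * (real (k choose a) / real (n choose a)) *
      (if k \<le> d then (-1) ^ (d - k) * real ((n - k) choose (d - k)) else 0)) =
    (\<Sum>k\<le>d. real (n choose d) / real (n choose a) * ((-1) ^ (d - k) * real (d choose k) * real (k choose a)))"
  proof (rule sum.mono_neutral_cong_right)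
    fix k assume "k \<in> {..d}"
    then have "real (n choose d) * real (d choose k) = real (n choose k) * real ((n - k) choose (d - k))"
      using choose_mult[of k d n] assms by (metis atMost_iff of_nat_mult)
    then show "real (n choose k) * (real (k choose a) / real (n choose a)) *
      (if k \<le> d then (-1) ^ (d - k) * real ((n - k) choose (d - k)) else 0) =
      real (n choose d) / real (n choose a) * ((-1) ^ (d - k) * real (d choose k) * real (k choose a))"
      using \<open>k \<in> {..d}\<close> pos by (auto simp: field_simps)
  qed (use assms in auto)
  also have "\<dots> = real (n choose d) / real (n choose a) *
      (\<Sum>k\<le>d. (-1) ^ (d - k) * real (d choose k) * real (k choose a))"
    by (simp add: sum_distrib_left)
  also have "(\<Sum>k\<le>d. (-1) ^ (d - k) * real (d choose k) * real (k choose a)) = (if d = a then 1 else 0)"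
  proof (cases "a \<le> d")
    case False
    then show ?thesis by (auto intro!: sum.neutral simp: binomial_eq_0)
  next
    case True
    have "(\<Sum>k\<le>d. (-1) ^ (d - k) * real (d choose k) * real (k choose a)) =
        (\<Sum>k\<in>{a..d}. (-1) ^ (d - k) * real (d choose k) * real (k choose a))"
      by (rule sum.mono_neutral_right) (auto simp: binomial_eq_0)
    also have "\<dots> = (\<Sum>j\<le>d - a. real (d choose a) * ((-1) ^ j * real ((d - a) choose j)))"
    proof (rule sum.reindex_bij_witness[of _ "\<lambda>j. d - j" "\<lambda>k. d - k"])
      fix k assume k: "k \<in> {a..d}"
      have "real (d choose k) * real (k choose a) = real (d choose a) * real ((d - a) choose (k - a))"
        using choose_mult[of a k d] k by (metis atLeastAtMost_iff of_nat_mult)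
      moreover have "(d - a) choose (k - a) = (d - a) choose (d - k)"
        using k binomial_symmetric[of "k - a" "d - a"] by auto
      ultimately show "real (d choose a) * ((-1) ^ (d - k) * real (d - a choose (d - k))) =
          (-1) ^ (d - k) * real (d choose k) * real (k choose a)"
        by (simp add: mult.assoc mult.left_commute)
    qed (use True in auto)
    also have "\<dots> = real (d choose a) * (\<Sum>j\<le>d - a. (-1) ^ j * real ((d - a) choose j))"
      by (simp add: sum_distrib_left)
    also have "\<dots> = (if d = a then 1 else 0)"
      using choose_alternating_sum[of "d - a", where 'a=real] True by auto
    finally show ?thesis .
  qed
  finally show ?thesis using pos by auto
qed

lemma prod_delta_fun: "(\<Prod>i\<in>(UNIV::'d::finite set). if f i = g i then 1 else 0 :: real) = (if f = g then 1 else 0)"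
  by (auto simp: fun_eq_iff intro!: prod_zero prod.neutral)

text \<open>Substituting \<delta> = \<beta> + \<kappa> collects the values of f over a box
  independent of \<kappa>, with coefficients that are products over coordinates; sums can then be
  exchanged and factored.\<close>

lemma bernstein_weight_expand:
  fixes \<kappa> :: "'d::finite \<Rightarrow> nat"
  assumes "\<kappa> \<le> (\<lambda>_. n)"
  shows "bernstein_weight n f \<kappa> = (\<Sum>\<delta>\<in>{..\<lambda>_. n}. f \<delta> * (\<Prod>i\<in>UNIV. real (n choose \<kappa> i) *
      (if \<kappa> i \<le> \<delta> i then (-1) ^ (\<delta> i - \<kappa> i) * real ((n - \<kappa> i) choose (\<delta> i - \<kappa> i)) else 0)))"
proof -
  have kn: "\<kappa> i \<le> n" for i using assms by (auto simp: le_fun_def)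
  have "nabla (\<lambda>i. n - \<kappa> i) f \<kappa> =
    (\<Sum>\<delta>\<in>{\<delta>\<in>{..\<lambda>_. n}. \<kappa> \<le> \<delta>}. signed_binomial (\<lambda>i. n - \<kappa> i) (\<lambda>i. \<delta> i - \<kappa> i) * f \<delta>)"
    unfolding nabla_def
    by (rule sum.reindex_bij_witness[of _ "\<lambda>\<delta> i. \<delta> i - \<kappa> i" "\<lambda>\<beta> i. \<beta> i + \<kappa> i"])
       (auto simp: le_fun_def kn le_diff_conv2 diff_le_mono)
  also have "\<dots> = (\<Sum>\<delta>\<in>{..\<lambda>_. n}. f \<delta> * (\<Prod>i\<in>UNIV.
      (if \<kappa> i \<le> \<delta> i then (-1) ^ (\<delta> i - \<kappa> i) * real ((n - \<kappa> i) choose (\<delta> i - \<kappa> i)) else 0)))"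
  proof (rule sum.mono_neutral_cong_left)
    show "\<forall>\<delta>\<in>{..\<lambda>_. n} - {\<delta> \<in> {..\<lambda>_. n}. \<kappa> \<le> \<delta>}. f \<delta> * (\<Prod>i\<in>UNIV.
      (if \<kappa> i \<le> \<delta> i then (-1) ^ (\<delta> i - \<kappa> i) * real ((n - \<kappa> i) choose (\<delta> i - \<kappa> i)) else 0)) = 0"
      by (auto simp: le_fun_def not_le intro!: prod_zero split: if_splits)
  qed (auto simp: signed_binomial_def le_fun_def)
  finally show ?thesis
    by (simp add: bernstein_weight_def sum_distrib_left prod.distrib mult_ac)
qed

text \<open>Exact for binomial ratios in place of powers of \<kappa>/n, because the signed kernel
  inverts binomial coefficients. The exponent 0 yields the total mass
  \<open>f (\<lambda>_. 0)\<close>.\<close>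

lemma bernstein_reproduces_moment:
  fixes \<alpha> :: "'d::finite \<Rightarrow> nat"
  assumes "\<alpha> \<le> (\<lambda>_. n)"
  shows "(\<Sum>\<kappa>\<in>{..\<lambda>_. n}. bernstein_weight n f \<kappa> *
      (\<Prod>i\<in>UNIV. real (\<kappa> i choose \<alpha> i) / real (n choose \<alpha> i))) = f \<alpha>"
proof -
  define c where "c \<delta> i k = real (n choose k) * (real (k choose \<alpha> i) / real (n choose \<alpha> i)) *
      (if k \<le> \<delta> i then (-1) ^ (\<delta> i - k) * real ((n - k) choose (\<delta> i - k)) else 0)" for \<delta> :: "'d \<Rightarrow> nat" and i k
  have "(\<Sum>\<kappa>\<in>{..\<lambda>_. n}. bernstein_weight n f \<kappa> *
      (\<Prod>i\<in>UNIV. real (\<kappa> i choose \<alpha> i) / real (n choose \<alpha> i))) =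
    (\<Sum>\<kappa>\<in>{..\<lambda>_. n}. \<Sum>\<delta>\<in>{..\<lambda>_. n}. f \<delta> * (\<Prod>i\<in>UNIV. c \<delta> i (\<kappa> i)))"
    by (rule sum.cong[OF refl])
      (simp add: bernstein_weight_expand sum_distrib_right sum_distrib_left c_def prod.distrib prod_dividef mult_ac)
  also have "\<dots> = (\<Sum>\<delta>\<in>{..\<lambda>_. n}. f \<delta> * (\<Sum>\<kappa>\<in>{..\<lambda>_. n}. \<Prod>i\<in>UNIV. c \<delta> i (\<kappa> i)))"
    by (subst sum.swap) (simp add: sum_distrib_left)
  also have "\<dots> = (\<Sum>\<delta>\<in>{..\<lambda>_. n}. f \<delta> * (if \<delta> = \<alpha> then 1 else 0))"
  proof (rule sum.cong[OF refl])
    fix \<delta> :: "'d \<Rightarrow> nat" assume "\<delta> \<in> {..\<lambda>_. n}"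
    then have "(\<Sum>k\<le>n. c \<delta> i k) = (if \<delta> i = \<alpha> i then 1 else 0)" for i
      unfolding c_def using assms by (intro alternating_binomial_delta) (auto simp: le_fun_def)
    then show "f \<delta> * (\<Sum>\<kappa>\<in>{..\<lambda>_. n}. \<Prod>i\<in>UNIV. c \<delta> i (\<kappa> i)) = f \<delta> * (if \<delta> = \<alpha> then 1 else 0)"
      unfolding atMost_fun_eq_PiE by (simp add: prod_sum_PiE[symmetric] prod_delta_fun)
  qed
  also have "\<dots> = f \<alpha>" using assms by (simp add: if_distrib[of "(*) _"] cong: if_cong)
  finally show ?thesis .
qed

text \<open>The ratio is a product of a factors (k - l)/(n - l) in [0,1], each within a/n of k/n.
  Such a product moves at most by the sum of the changes of its factors, whence
  \<open>a\<^sup>2 / n\<close>.\<close>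

lemma binomial_ratio_approx:
  fixes a k n :: nat
  assumes "a \<le> n" "k \<le> n" "0 < n"
  shows "\<bar>real (k choose a) / real (n choose a) - (real k / real n) ^ a\<bar> \<le> (real a)\<^sup>2 / real n"
    and "0 \<le> real (k choose a) / real (n choose a)" "real (k choose a) / real (n choose a) \<le> 1"
proof -
  have eq: "real (k choose a) / real (n choose a) = (\<Prod>l<a. real (k - l) / real (n - l))"
  proof (cases "a \<le> k")
    case True
    then have "real (k choose a) / real (n choose a) =
      (\<Prod>l<a. real (k - l) / real (a - l)) / (\<Prod>l<a. real (n - l) / real (a - l))"
      using assms binomial_altdef_of_nat[of a k, where 'a=real] binomial_altdef_of_nat[of a n, where 'a=real]
      by (simp add: atLeast0LessThan)
    also have "\<dots> = (\<Prod>l<a. real (k - l) / real (n - l))"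
      unfolding prod_dividef[symmetric] by (rule prod.cong) auto
    finally show ?thesis .
  next
    case False
    \<comment> \<open>Truncated subtraction gives the factor at l = k the value 0, in accordance
      with the vanishing binomial coefficient.\<close>
    then have "(\<Prod>l<a. real (k - l) / real (n - l)) = 0" by (intro prod_zero) auto
    with False show ?thesis by (simp add: binomial_eq_0)
  qed
  have b: "real (k - l) / real (n - l) \<le> 1" for l
    using assms by (auto simp: divide_le_eq_1 diff_le_mono)
  show "0 \<le> real (k choose a) / real (n choose a)" by simp
  show "real (k choose a) / real (n choose a) \<le> 1"
    unfolding eq by (rule prod_le_1) (use b in auto)
  have "\<bar>(\<Prod>l<a. real (k - l) / real (n - l)) - (\<Prod>l<a. real k / real n)\<bar> \<le>
      (\<Sum>l<a. \<bar>real (k - l) / real (n - l) - real k / real n\<bar>)"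
    using norm_prod_diff[of "{..<a}" "\<lambda>l. real (k - l) / real (n - l)" "\<lambda>l. real k / real n"] b assms
    by simp
  also have "\<dots> \<le> (\<Sum>l<a. real a / real n)"
  proof (rule sum_mono)
    fix l assume l: "l \<in> {..<a}"
    show "\<bar>real (k - l) / real (n - l) - real k / real n\<bar> \<le> real a / real n"
    proof (cases "l \<le> k")
      case True
      have ln: "real l < real n" using l assms by simp
      have "real (k - l) / real (n - l) - real k / real n = - (real l / real n * ((real n - real k) / (real n - real l)))"
        using True l assms ln by (simp add: of_nat_diff field_simps)
      moreover have "0 \<le> (real n - real k) / (real n - real l)" "(real n - real k) / (real n - real l) \<le> 1"
        using ln assms True by auto
      ultimately have "\<bar>real (k - l) / real (n - l) - real k / real n\<bar> \<le> real l / real n"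
        using mult_left_mono[of "(real n - real k) / (real n - real l)" 1 "real l / real n"] assms ln
        by (simp add: abs_mult)
      also have "\<dots> \<le> real a / real n" using l by (intro divide_right_mono) auto
      finally show ?thesis .
    next
      case False
      then show ?thesis using l by (simp add: divide_right_mono)
    qed
  qed
  also have "\<dots> = (real a)\<^sup>2 / real n" by (simp add: power2_eq_square)
  finally show "\<bar>real (k choose a) / real (n choose a) - (real k / real n) ^ a\<bar> \<le> (real a)\<^sup>2 / real n"
    by (simp add: eq)
qed

text \<open>The weights are nonnegative with sum \<open>f (\<lambda>_. 0)\<close>, so replacing
  ratios by powers costs at most that mass times the sum of the coordinatewise errors.\<close>

lemma bernstein_approximates_moment:
  fixes \<alpha> :: "'d::finite \<Rightarrow> nat"
  assumes pos: "\<And>\<beta> \<gamma>. 0 \<le> nabla \<beta> f \<gamma>" and n: "\<alpha> \<le> (\<lambda>_. n)" "0 < n"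
  shows "\<bar>(\<Sum>\<kappa>\<in>{..\<lambda>_. n}. bernstein_weight n f \<kappa> * (\<Prod>i\<in>UNIV. (real (\<kappa> i) / real n) ^ \<alpha> i)) - f \<alpha>\<bar>
    \<le> f (\<lambda>_. 0) * (\<Sum>i\<in>UNIV. (real (\<alpha> i))\<^sup>2) / real n"
proof -
  have w: "0 \<le> bernstein_weight n f \<kappa>" for \<kappa>
    unfolding bernstein_weight_def by (intro mult_nonneg_nonneg prod_nonneg pos) auto
  have tot: "(\<Sum>\<kappa>\<in>{..\<lambda>_. n}. bernstein_weight n f \<kappa>) = f (\<lambda>_. 0)"
    using bernstein_reproduces_moment[of "\<lambda>_. 0" n f] by (simp add: le_fun_def)
  have "\<bar>(\<Sum>\<kappa>\<in>{..\<lambda>_. n}. bernstein_weight n f \<kappa> * (\<Prod>i\<in>UNIV. (real (\<kappa> i) / real n) ^ \<alpha> i)) - f \<alpha>\<bar> =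
    \<bar>\<Sum>\<kappa>\<in>{..\<lambda>_. n}. bernstein_weight n f \<kappa> * ((\<Prod>i\<in>UNIV. (real (\<kappa> i) / real n) ^ \<alpha> i) -
      (\<Prod>i\<in>UNIV. real (\<kappa> i choose \<alpha> i) / real (n choose \<alpha> i)))\<bar>"
    unfolding bernstein_reproduces_moment[OF n(1), of f, symmetric]
    by (simp only: sum_subtractf[symmetric] right_diff_distrib)
  also have "\<dots> \<le> (\<Sum>\<kappa>\<in>{..\<lambda>_. n}. bernstein_weight n f \<kappa> * ((\<Sum>i\<in>UNIV. (real (\<alpha> i))\<^sup>2) / real n))"
  proof (rule order_trans[OF sum_abs sum_mono])
    fix \<kappa> :: "'d \<Rightarrow> nat" assume "\<kappa> \<in> {..\<lambda>_. n}"
    then have k: "\<kappa> i \<le> n" for i by (auto simp: le_fun_def)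
    have a: "\<alpha> i \<le> n" for i using n by (auto simp: le_fun_def)
    have "\<bar>(\<Prod>i\<in>UNIV. (real (\<kappa> i) / real n) ^ \<alpha> i) - (\<Prod>i\<in>UNIV. real (\<kappa> i choose \<alpha> i) / real (n choose \<alpha> i))\<bar>
      \<le> (\<Sum>i\<in>UNIV. \<bar>(real (\<kappa> i) / real n) ^ \<alpha> i - real (\<kappa> i choose \<alpha> i) / real (n choose \<alpha> i)\<bar>)"
      using norm_prod_diff[of UNIV "\<lambda>i. (real (\<kappa> i) / real n) ^ \<alpha> i"
          "\<lambda>i. real (\<kappa> i choose \<alpha> i) / real (n choose \<alpha> i)"] binomial_ratio_approx(2,3)[OF a k n(2)] n(2) k
      by (simp add: power_le_one)
    also have "\<dots> \<le> (\<Sum>i\<in>UNIV. (real (\<alpha> i))\<^sup>2 / real n)"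
      using binomial_ratio_approx(1)[OF a k n(2)] by (intro sum_mono) (simp add: abs_minus_commute)
    finally show "\<bar>bernstein_weight n f \<kappa> * ((\<Prod>i\<in>UNIV. (real (\<kappa> i) / real n) ^ \<alpha> i) -
      (\<Prod>i\<in>UNIV. real (\<kappa> i choose \<alpha> i) / real (n choose \<alpha> i)))\<bar> \<le>
      bernstein_weight n f \<kappa> * ((\<Sum>i\<in>UNIV. (real (\<alpha> i))\<^sup>2) / real n)"
      unfolding abs_mult abs_of_nonneg[OF w] by (intro mult_left_mono w) (simp add: sum_divide_distrib)
  qed
  also have "\<dots> = f (\<lambda>_. 0) * (\<Sum>i\<in>UNIV. (real (\<alpha> i))\<^sup>2) / real n"
    unfolding sum_distrib_right[symmetric] tot by simp
  finally show ?thesis .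
qed

section \<open>The Hausdorff moment problem on the cube\<close>

definition cube :: "('d \<Rightarrow> real) set" where
  "cube = {x. \<forall>i. x i \<in> {0..1}}"

text \<open>
  Schoenberg's space-filling curve: \<open>digit_wave\<close> is \<open>2\<close>-periodic, vanishes on \<open>[0,1/3]\<close> and
  equals \<open>1\<close> on \<open>[2/3,1]\<close>, so that \<open>digit_wave (3\<^sup>n t)\<close> reads off the \<open>n\<close>-th ternary digit of a
  point \<open>t\<close> of the Cantor set. The digits of \<open>t\<close> are distributed among the coordinates by
  \<open>to_nat\<close>.
\<close>

definition digit_wave :: "real \<Rightarrow> real" where
  "digit_wave t = max 0 (min 1 (1 / 2 - cos (pi * t)))"

definition cube_curve :: "real \<Rightarrow> 'd::countable \<Rightarrow> real" where
  "cube_curve t i = (\<Sum>k. digit_wave (3 ^ to_nat (i, k) * t) / 2 ^ Suc k)"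

lemma digit_wave_bounds: "0 \<le> digit_wave t" "digit_wave t \<le> 1"
  by (auto simp: digit_wave_def)

text \<open>The even integer 2 m collects the digits before the one that is read and u those after
  it; the former disappear by periodicity, the latter stay inside the plateau of the wave.\<close>

lemma digit_wave_digit:
  fixes a m :: nat
  assumes a: "a \<le> 1" and u: "0 \<le> u" "u \<le> 1 / 3" and t: "t = 2 * real m + 2 * real a / 3 + u"
  shows "digit_wave t = real a"
proof -
  define v where "v = 2 * real a / 3 + u"
  have "cos (pi * t) = cos (pi * v + real m * (2 * pi))"
    by (simp add: t v_def algebra_simps)
  also have "\<dots> = cos (pi * v)"
    using cos.plus_of_nat[of "pi * v" m] by simp
  finally have c: "cos (pi * t) = cos (pi * v)" .
  consider "a = 0" | "a = 1" using a by linarith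
  then show ?thesis
  proof cases
    case 1
    \<comment> \<open>Since cos (pi / 3) = 1/2, the arguments 1/3 and 2/3 are where
      \<open>1 / 2 - cos (pi * t)\<close> reaches the clamping values 0 and 1.\<close>
    have "cos (pi / 3) \<le> cos (pi * v)"
      by (rule cos_monotone_0_pi_le) (use u 1 in \<open>auto simp: v_def field_simps\<close>)
    then show ?thesis using 1 by (simp add: digit_wave_def c cos_60)
  next
    case 2
    have "cos (pi * v) \<le> cos (pi - pi / 3)"
    proof (rule cos_monotone_0_pi_le)
      have "pi * (2 / 3) \<le> pi * v" by (rule mult_left_mono) (use u 2 in \<open>auto simp: v_def\<close>)
      then show "pi - pi / 3 \<le> pi * v" by simp
      have "pi * v \<le> pi * 1" by (rule mult_left_mono) (use u 2 in \<open>auto simp: v_def\<close>)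
      then show "pi * v \<le> pi" by simp
    qed simp
    also have "\<dots> = - (1 / 2)" by (simp only: cos_pi_minus cos_60)
    finally show ?thesis using 2 by (simp add: digit_wave_def c)
  qed
qed

text \<open>The bit a n becomes the ternary digit 2 a n. As only even digits occur, multiplying by
  3^n turns the earlier ones into an even integer, and the later ones add at most 1/3.\<close>

lemma ternary_digit_extraction:
  fixes a :: "nat \<Rightarrow> nat"
  assumes a: "\<And>n. a n \<le> 1"
  obtains t where "0 \<le> t" "t \<le> 1" "\<And>n. digit_wave (3 ^ n * t) = real (a n)"
proof -
  define c where "c n = 2 * real (a n) / 3 ^ Suc n" for n
  have geo: "(\<lambda>k. 2 / 3 ^ Suc (k + n)) sums (1 / 3 ^ n :: real)" for n
    using sums_mult[OF geometric_sums[of "1/3 :: real"], of "2 / 3 ^ Suc n"]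
    by (simp add: power_add power_one_over field_simps)
  have sm: "summable (\<lambda>k. c (k + n))" for n
  proof (rule summable_comparison_test'[OF sums_summable[OF geo[of n]], of 0])
    fix k show "norm (c (k + n)) \<le> 2 / 3 ^ Suc (k + n)"
      using a[of "k + n"] by (simp add: c_def divide_right_mono)
  qed
  define t where "t = (\<Sum>n. c n)"
  have tail: "0 \<le> (\<Sum>k. c (k + n))" "(\<Sum>k. c (k + n)) \<le> 1 / 3 ^ n" for n
  proof -
    show "0 \<le> (\<Sum>k. c (k + n))" by (rule suminf_nonneg[OF sm]) (simp add: c_def)
    have "(\<Sum>k. c (k + n)) \<le> (\<Sum>k. 2 / 3 ^ Suc (k + n))"
    proof (rule suminf_le[OF _ sm sums_summable[OF geo]])
      fix k show "c (k + n) \<le> 2 / 3 ^ Suc (k + n)"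
        using a[of "k + n"] by (simp add: c_def divide_right_mono)
    qed
    also have "\<dots> = 1 / 3 ^ n"
      using geo by (rule sums_unique[symmetric])
    finally show "(\<Sum>k. c (k + n)) \<le> 1 / 3 ^ n" .
  qed
  have "digit_wave (3 ^ n * t) = real (a n)" for n
  proof -
    define u where "u = 3 ^ n * (\<Sum>k. c (k + Suc n))"
    have "t = (\<Sum>k. c (k + Suc n)) + (\<Sum>k<Suc n. c k)"
      unfolding t_def using sm[of 0] by (intro suminf_split_initial_segment) simp
    then have t: "3 ^ n * t = u + 3 ^ n * (\<Sum>k<n. c k) + 3 ^ n * c n"
      by (simp add: u_def algebra_simps)
    have "0 \<le> u" using tail(1)[of "Suc n"] by (simp add: u_def)
    moreover have "u \<le> 3 ^ n * (1 / 3 ^ Suc n)"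
      unfolding u_def by (rule mult_left_mono[OF tail(2)]) simp
    ultimately have u: "0 \<le> u" "u \<le> 1 / 3" by auto
    have "3 ^ n * (\<Sum>k<n. c k) = (\<Sum>k<n. 2 * real (a k * 3 ^ (n - Suc k)))"
      unfolding sum_distrib_left
    proof (rule sum.cong[OF refl])
      fix k assume "k \<in> {..<n}"
      then have "(3::real) ^ n = 3 ^ (n - Suc k) * 3 ^ Suc k" by (subst power_add[symmetric]) simp
      then show "3 ^ n * c k = 2 * real (a k * 3 ^ (n - Suc k))" by (simp add: c_def)
    qed
    then have "3 ^ n * (\<Sum>k<n. c k) = 2 * real (\<Sum>k<n. a k * 3 ^ (n - Suc k))"
      by (simp add: sum_distrib_left)
    with t have "3 ^ n * t = 2 * real (\<Sum>k<n. a k * 3 ^ (n - Suc k)) + 2 * real (a n) / 3 + u"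
      by (simp add: c_def)
    from digit_wave_digit[OF a u this] show ?thesis .
  qed
  moreover have "0 \<le> t" "t \<le> 1" using tail[of 0] by (simp_all add: t_def)
  ultimately show thesis by (intro that)
qed

lemma binary_expansion:
  fixes y :: real
  assumes "0 \<le> y" "y \<le> 1"
  obtains a :: "nat \<Rightarrow> nat" where "\<And>n. a n \<le> 1" "(\<lambda>k. real (a k) / 2 ^ Suc k) sums y"
proof (cases "y = 1")
  case True
  \<comment> \<open>The floor digits of 1 all vanish behind its integer part, so the endpoint takes
    the expansion 0.111... instead.\<close>
  have "(\<lambda>k. real 1 / 2 ^ Suc k) sums y" using power_half_series True by (simp add: power_one_over)
  then show thesis by (rule that[rotated]) simp
next
  case False
  define b where "b n = nat \<lfloor>2 ^ n * y\<rfloor>" for n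
  define a where "a n = b (Suc n) - 2 * b n" for n
  have b: "real (b n) \<le> 2 ^ n * y" "2 ^ n * y < real (b n) + 1" for n
    using assms by (auto simp: b_def)
  have dig: "2 * b n \<le> b (Suc n)" "b (Suc n) \<le> 2 * b n + 1" for n
  proof -
    have "2 * real (b n) < real (b (Suc n)) + 1" "real (b (Suc n)) < 2 * real (b n) + 2"
      using b[of n] b[of "Suc n"] by auto
    then show "2 * b n \<le> b (Suc n)" "b (Suc n) \<le> 2 * b n + 1" by linarith+
  qed
  have part: "(\<Sum>k<n. real (a k) / 2 ^ Suc k) = real (b n) / 2 ^ n" for n
  proof (induction n)
    case 0
    have "b 0 = 0" using b(1)[of 0] assms False by simp
    then show ?case by simp
  next
    case (Suc n)
    have "real (a n) = real (b (Suc n)) - 2 * real (b n)" using dig(1)[of n] by (simp add: a_def)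
    then show ?case unfolding sum.lessThan_Suc Suc by (simp add: field_simps)
  qed
  have "(\<lambda>n. real (b n) / 2 ^ n) \<longlonglongrightarrow> y"
  proof (rule tendsto_sandwich[of "\<lambda>n. y - (1/2) ^ n" _ _ "\<lambda>n. y"])
    show "\<forall>\<^sub>F n in sequentially. y - (1 / 2) ^ n \<le> real (b n) / 2 ^ n"
    proof (intro always_eventually allI)
      fix n
      have "y < (real (b n) + 1) / 2 ^ n" using b(2)[of n] by (simp add: field_simps)
      then show "y - (1 / 2) ^ n \<le> real (b n) / 2 ^ n"
        by (simp add: add_divide_distrib power_one_over)
    qed
    show "\<forall>\<^sub>F n in sequentially. real (b n) / 2 ^ n \<le> y"
      using b(1) by (intro always_eventually allI) (simp add: field_simps)
    show "(\<lambda>n. y - (1 / 2) ^ n) \<longlonglongrightarrow> y"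
      using tendsto_diff[OF tendsto_const LIMSEQ_power_zero[of "1/2 :: real"], of y] by simp
  qed simp
  then have "(\<lambda>k. real (a k) / 2 ^ Suc k) sums y" unfolding sums_def part .
  moreover have "a n \<le> 1" for n using dig[of n] by (simp add: a_def)
  ultimately show thesis using that by blast
qed

text \<open>Interleaves the binary expansions of all coordinates into one bit sequence. This
  provides real parameters for the grid points that carry the Bernstein measures.\<close>

lemma cube_curve_surj:
  fixes y :: "'d::countable \<Rightarrow> real"
  assumes "y \<in> cube"
  obtains t where "0 \<le> t" "t \<le> 1" "cube_curve t = y"
proof -
  have "\<exists>a :: nat \<Rightarrow> nat. (\<forall>n. a n \<le> 1) \<and> (\<lambda>k. real (a k) / 2 ^ Suc k) sums y i" for i
    using binary_expansion[of "y i"] assms by (auto simp: cube_def) metis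
  then obtain a :: "'d \<Rightarrow> nat \<Rightarrow> nat" where a: "\<And>i n. a i n \<le> 1"
    "\<And>i. (\<lambda>k. real (a i k) / 2 ^ Suc k) sums y i" by metis
  have "case_prod a (from_nat n) \<le> 1" for n using a(1) by (simp add: split_beta)
  from ternary_digit_extraction[of "\<lambda>n. case_prod a (from_nat n)", OF this]
  obtain t where t: "0 \<le> t" "t \<le> 1" "\<And>n. digit_wave (3 ^ n * t) = real (case_prod a (from_nat n))"
    by blast
  have "cube_curve t i = y i" for i
    unfolding cube_curve_def t(3) using sums_unique[OF a(2)[of i]] by simp
  then have "cube_curve t = y" by (rule ext)
  then show thesis using that t by blast
qed

lemma summable_half_powers: "summable (\<lambda>k. 1 / 2 ^ Suc k :: real)"
  using sums_summable[OF power_half_series] by (simp add: power_one_over)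

lemma summable_digit_wave: "summable (\<lambda>k. digit_wave (s k) / 2 ^ Suc k)"
  by (rule summable_comparison_test'[OF summable_half_powers, of 0])
    (simp add: digit_wave_bounds divide_right_mono)

lemma cube_curve_in_cube: "cube_curve t \<in> cube"
proof -
  have "0 \<le> cube_curve t i" for i
    unfolding cube_curve_def by (rule suminf_nonneg[OF summable_digit_wave]) (simp add: digit_wave_bounds)
  moreover have "cube_curve t i \<le> (\<Sum>k. 1 / 2 ^ Suc k)" for i
    unfolding cube_curve_def
    by (rule suminf_le[OF _ summable_digit_wave summable_half_powers])
      (simp add: digit_wave_bounds divide_right_mono)
  moreover have "(\<Sum>k. 1 / 2 ^ Suc k :: real) = 1"
    using sums_unique[OF power_half_series] by (simp add: power_one_over)
  ultimately show ?thesis unfolding cube_def by auto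
qed

text \<open>The partial sums converge uniformly. Continuity makes monomials along the curve
  admissible test functions for weak convergence.\<close>

lemma continuous_cube_curve: "continuous_on UNIV (\<lambda>t. cube_curve t i)"
proof -
  have "uniform_limit UNIV (\<lambda>n t. \<Sum>k<n. digit_wave (3 ^ to_nat (i, k) * t) / 2 ^ Suc k)
      (\<lambda>t. cube_curve t i) sequentially"
    unfolding cube_curve_def
    by (rule Weierstrass_m_test[OF _ summable_half_powers]) (simp add: digit_wave_bounds divide_right_mono)
  then show ?thesis
  proof (rule uniform_limit_theorem[rotated])
    show "\<forall>\<^sub>F n in sequentially. continuous_on UNIV (\<lambda>t. \<Sum>k<n. digit_wave (3 ^ to_nat (i, k) * t) / 2 ^ Suc k)"
      unfolding digit_wave_def by (intro always_eventually allI continuous_intros) auto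
  qed simp
qed

section \<open>Monomials on the cube and solution of the moment problem\<close>

definition monom_fun :: "('d::finite \<Rightarrow> nat) \<Rightarrow> ('d \<Rightarrow> real) \<Rightarrow> real" where
  "monom_fun \<alpha> x = (\<Prod>i\<in>UNIV. x i ^ \<alpha> i)"

lemma monom_fun_cube:
  assumes "x \<in> cube"
  shows "0 \<le> monom_fun \<alpha> x" "monom_fun \<alpha> x \<le> 1"
proof -
  have "0 \<le> x i ^ \<alpha> i" "x i ^ \<alpha> i \<le> 1" for i using assms by (auto simp: cube_def power_le_one)
  then show "0 \<le> monom_fun \<alpha> x" "monom_fun \<alpha> x \<le> 1"
    unfolding monom_fun_def by (auto intro!: prod_nonneg prod_le_1)
qed

lemma continuous_on_coordinate: "continuous_on S (\<lambda>x :: 'd \<Rightarrow> real. x i)"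
  by (metis continuous_on_product_coordinates continuous_on_subset subset_UNIV)

lemma measurable_coordinate [measurable]: "(\<lambda>x :: 'd::countable \<Rightarrow> real. x i) \<in> borel_measurable borel"
  by (rule borel_measurable_continuous_onI) (rule continuous_on_coordinate)

lemma measurable_monom_fun [measurable]: "monom_fun \<alpha> \<in> borel_measurable borel"
  unfolding monom_fun_def by measurable

lemma cube_borel: "(cube :: ('d::finite \<Rightarrow> real) set) \<in> sets borel"
proof -
  have "{x \<in> space borel. \<forall>i::'d. (x i :: real) \<in> {0..1}} \<in> sets borel" by measurable
  then show ?thesis by (simp add: cube_def)
qed

text \<open>For a countable index set the Borel sets of the function space form the product
  sigma-algebra, so the coordinates decide measurability.\<close>

lemma measurable_borel_fun:
  fixes g :: "'a \<Rightarrow> 'd::countable \<Rightarrow> real"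
  assumes "\<And>i. (\<lambda>t. g t i) \<in> borel_measurable M"
  shows "g \<in> borel_measurable M"
proof -
  have "g \<in> measurable M (Pi\<^sub>M UNIV (\<lambda>i. borel))"
    using measurable_PiM_single'[of UNIV "\<lambda>i t. g t i" M "\<lambda>_. borel"] assms by simp
  then show ?thesis by (simp add: measurable_cong_sets[OF refl sets_PiM_equal_borel])
qed

text \<open>
  The Bernstein measures are supported on finitely many
  points and are transported to the real line along the space-filling curve, so that Helly's
  selection theorem applies.
\<close>
lemma hausdorff_moment_prob:
  fixes f :: "('d::finite \<Rightarrow> nat) \<Rightarrow> real"
  assumes pos: "\<And>\<beta> \<gamma>. 0 \<le> nabla \<beta> f \<gamma>" and one: "f (\<lambda>_. 0) = 1"
  obtains \<mu> where "prob_space \<mu>" "sets \<mu> = sets borel" "AE x in \<mu>. x \<in> cube"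
    "\<And>\<alpha>. integral\<^sup>L \<mu> (monom_fun \<alpha>) = f \<alpha>"
proof -
  have w: "0 \<le> bernstein_weight n f \<kappa>" for n \<kappa>
    unfolding bernstein_weight_def by (intro mult_nonneg_nonneg prod_nonneg pos) auto
  have tot: "(\<Sum>\<kappa>\<in>{..\<lambda>_. n}. bernstein_weight n f \<kappa>) = 1" for n
    using bernstein_reproduces_moment[of "\<lambda>_. 0" n f] one by (simp add: le_fun_def)
  define p where "p n \<kappa> = (if \<kappa> \<le> (\<lambda>_. n) then bernstein_weight n f \<kappa> else 0)" for n \<kappa>
  define P where "P n = embed_pmf (p n)" for n
  have pmf_P: "pmf (P n) = p n" for n
    unfolding P_def
  proof (rule pmf_embed_pmf[unfolded fun_eq_iff[symmetric], THEN ext])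
    show "0 \<le> p n \<kappa>" for \<kappa> by (simp add: p_def w)
    have "(\<integral>\<^sup>+ \<kappa>. ennreal (p n \<kappa>) \<partial>count_space UNIV) = (\<Sum>\<kappa>\<in>{..\<lambda>_. n}. ennreal (p n \<kappa>))"
      by (rule nn_integral_count_space') (auto simp: p_def)
    also have "\<dots> = 1"
      using tot[of n] by (subst sum_ennreal) (auto simp: p_def w)
    finally show "(\<integral>\<^sup>+ \<kappa>. ennreal (p n \<kappa>) \<partial>count_space UNIV) = 1" .
  qed
  \<comment> \<open>The \<open>min\<close> places every \<kappa> in the cube, so one choice function
    covers all multi-indices; on the box carrying \<open>P n\<close> it changes nothing, and for n =
    0 division gives 0.\<close>
  have "\<exists>t. 0 \<le> t \<and> t \<le> 1 \<and> cube_curve t = (\<lambda>i. real (min n (\<kappa> i)) / real n)" for n and \<kappa> :: "'d \<Rightarrow> nat"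
    by (rule cube_curve_surj[of "\<lambda>i. real (min n (\<kappa> i)) / real n"]) (auto simp: cube_def divide_le_eq_1)
  then obtain t where t01: "\<And>n \<kappa>. 0 \<le> t n \<kappa>" "\<And>n \<kappa>. t n \<kappa> \<le> 1" and t: "\<And>n (\<kappa> :: 'd \<Rightarrow> nat). cube_curve (t n \<kappa>) = (\<lambda>i. real (min n (\<kappa> i)) / real n)" by metis
  define M where "M n = distr (measure_pmf (P n)) borel (t n)" for n
  have rd: "real_distribution (M n)" for n
    unfolding M_def by (rule prob_space.real_distribution_distr[OF measure_pmf.prob_space_axioms]) simp
  have cont: "isCont (\<lambda>s. monom_fun \<alpha> (cube_curve s)) s" for \<alpha> :: "'d \<Rightarrow> nat" and s
    unfolding monom_fun_def
    by (rule continuous_on_interior[of UNIV]) (auto intro!: continuous_intros continuous_cube_curve)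
  have bnd: "norm (monom_fun \<alpha> (cube_curve s)) \<le> 1" for \<alpha> :: "'d \<Rightarrow> nat" and s
    using monom_fun_cube[OF cube_curve_in_cube[of s], of \<alpha>] by simp
  have supp: "set_pmf (P n) \<subseteq> {..\<lambda>_. n}" for n by (auto simp: set_pmf_eq pmf_P p_def)
  have int: "integral\<^sup>L (M n) (\<lambda>s. monom_fun \<alpha> (cube_curve s)) =
      (\<Sum>\<kappa>\<in>{..\<lambda>_. n}. bernstein_weight n f \<kappa> * (\<Prod>i\<in>UNIV. (real (\<kappa> i) / real n) ^ \<alpha> i))" for n \<alpha>
  proof -
    have "integral\<^sup>L (M n) (\<lambda>s. monom_fun \<alpha> (cube_curve s)) =
        (\<integral>\<kappa>. monom_fun \<alpha> (cube_curve (t n \<kappa>)) \<partial>measure_pmf (P n))"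
      unfolding M_def using cont
      by (intro integral_distr) (auto intro!: borel_measurable_continuous_onI continuous_at_imp_continuous_on)
    also have "\<dots> = (\<Sum>\<kappa>\<in>{..\<lambda>_. n}. pmf (P n) \<kappa> *\<^sub>R monom_fun \<alpha> (cube_curve (t n \<kappa>)))"
      by (rule integral_measure_pmf) (use supp in auto)
    also have "\<dots> = (\<Sum>\<kappa>\<in>{..\<lambda>_. n}. bernstein_weight n f \<kappa> * (\<Prod>i\<in>UNIV. (real (\<kappa> i) / real n) ^ \<alpha> i))"
      by (rule sum.cong[OF refl]) (simp add: pmf_P p_def t monom_fun_def le_fun_def min_absorb2)
    finally show ?thesis .
  qed
  have "tight M"
    unfolding tight_def
  proof (intro conjI allI impI rd)
    fix \<epsilon> :: real assume "\<epsilon> > 0"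
    \<comment> \<open>Tightness is phrased with half-open intervals; the left end -1 leaves room for
      the parameter 0.\<close>
    have "t n \<kappa> \<in> {-1<..1}" for n \<kappa> using t01[of n \<kappa>] by simp
    then have "t n -` {-1<..1} = UNIV" for n by auto
    then have "measure (M n) {-1<..1} = 1" for n
      unfolding M_def by (subst measure_distr) simp_all
    then show "\<exists>a b. a < b \<and> (\<forall>n. 1 - \<epsilon> < measure (M n) {a<..b})"
      using \<open>\<epsilon> > 0\<close> by (intro exI[of _ "-1"] exI[of _ 1]) simp
  qed
  from tight_imp_convergent_subsubsequence[OF this, of id]
  obtain r L where r: "strict_mono r" and L: "real_distribution L" and "weak_conv_m (M \<circ> id \<circ> r) L"
    by (auto simp: strict_mono_def)
  then have wc: "weak_conv_m (\<lambda>n. M (r n)) L" by (simp add: comp_def)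
  interpret L: real_distribution L by fact
  have moments: "integral\<^sup>L L (\<lambda>s. monom_fun \<alpha> (cube_curve s)) = f \<alpha>" for \<alpha>
  proof -
    define C where "C = (\<Sum>i\<in>UNIV. (real (\<alpha> i))\<^sup>2)"
    have "(\<lambda>n. integral\<^sup>L (M (r n)) (\<lambda>s. monom_fun \<alpha> (cube_curve s)) - f \<alpha>) \<longlonglongrightarrow> 0"
    proof (rule Lim_null_comparison)
      \<comment> \<open>An index above the sum of \<alpha> bounds every exponent and is positive, as
        the Bernstein estimate demands.\<close>
      have ev: "\<forall>\<^sub>F n in sequentially. (\<Sum>i\<in>UNIV. \<alpha> i) < n" by (rule eventually_gt_at_top)
      show "\<forall>\<^sub>F n in sequentially. norm (integral\<^sup>L (M (r n)) (\<lambda>s. monom_fun \<alpha> (cube_curve s)) - f \<alpha>)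
          \<le> C / real (r n)"
        using ev
      proof eventually_elim
        case (elim n)
        then have lt: "(\<Sum>i\<in>UNIV. \<alpha> i) < r n" using seq_suble[OF r, of n] by linarith
        have "\<alpha> i \<le> (\<Sum>i\<in>UNIV. \<alpha> i)" for i by (rule member_le_sum) auto
        then have "\<alpha> i \<le> r n" for i using lt by (meson le_trans less_imp_le)
        then have "\<alpha> \<le> (\<lambda>_. r n)" by (simp add: le_fun_def)
        from bernstein_approximates_moment[of f, OF pos this] lt show ?case
          by (simp add: int one C_def)
      qed
      have "(\<lambda>n. C / real n) \<longlonglongrightarrow> 0" by (rule lim_const_over_n)
      from LIMSEQ_subseq_LIMSEQ[OF this r] show "(\<lambda>n. C / real (r n)) \<longlonglongrightarrow> 0" by (simp add: comp_def)
    qed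
    then have "(\<lambda>n. integral\<^sup>L (M (r n)) (\<lambda>s. monom_fun \<alpha> (cube_curve s))) \<longlonglongrightarrow> f \<alpha>"
      by (simp add: LIM_zero_iff)
    moreover have "(\<lambda>n. integral\<^sup>L (M (r n)) (\<lambda>s. monom_fun \<alpha> (cube_curve s))) \<longlonglongrightarrow>
        integral\<^sup>L L (\<lambda>s. monom_fun \<alpha> (cube_curve s))"
      by (rule weak_conv_imp_integral_bdd_continuous_conv[OF rd L wc cont bnd])
    ultimately show ?thesis using LIMSEQ_unique by blast
  qed
  have meas [measurable]: "(cube_curve :: real \<Rightarrow> 'd \<Rightarrow> real) \<in> measurable L borel"
    using borel_measurable_continuous_onI[OF continuous_cube_curve]
    by (intro measurable_borel_fun) (simp add: measurable_cong_sets[OF L.events_eq_borel refl])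
  show thesis
  \<comment> \<open>The curve sends the whole line into the cube, so the image of L is carried by
    the cube.\<close>
  proof (rule that[of "distr L borel cube_curve"])
    show "prob_space (distr L borel (cube_curve :: real \<Rightarrow> 'd \<Rightarrow> real))" by (rule L.prob_space_distr[OF meas])
    show "AE x in distr L borel cube_curve. x \<in> (cube :: ('d \<Rightarrow> real) set)"
      by (subst AE_distr_iff[OF meas]) (use cube_borel cube_curve_in_cube in auto)
    show "integral\<^sup>L (distr L borel cube_curve) (monom_fun \<alpha>) = f \<alpha>" for \<alpha>
      by (subst integral_distr[OF meas measurable_monom_fun]) (rule moments)
  qed simp
qed

text \<open>Divides by the total mass \<open>f (\<lambda>_. 0)\<close>. If this is 0, all Bernstein
  weights and the bound on the approximation error vanish, hence f = 0 and the null measure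
  serves.\<close>

lemma hausdorff_moment:
  fixes f :: "('d::finite \<Rightarrow> nat) \<Rightarrow> real"
  assumes pos: "\<And>\<beta> \<gamma>. 0 \<le> nabla \<beta> f \<gamma>"
  obtains \<mu> where "finite_measure \<mu>" "sets \<mu> = sets borel" "AE x in \<mu>. x \<in> cube"
    "\<And>\<alpha>. integral\<^sup>L \<mu> (monom_fun \<alpha>) = f \<alpha>"
proof (cases "f (\<lambda>_. 0) = 0")
  case True
  have "f \<alpha> = 0" for \<alpha>
  proof -
    have "\<alpha> \<le> (\<lambda>_. Suc (\<Sum>i\<in>UNIV. \<alpha> i))"
      by (auto simp: le_fun_def intro!: le_SucI member_le_sum)
    from bernstein_approximates_moment[of f, OF pos this]
      bernstein_reproduces_moment[OF this, of f]
    have "\<bar>(\<Sum>\<kappa>\<in>{..\<lambda>_. Suc (sum \<alpha> UNIV)}. bernstein_weight (Suc (sum \<alpha> UNIV)) f \<kappa> *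
        (\<Prod>i\<in>UNIV. (real (\<kappa> i) / real (Suc (sum \<alpha> UNIV))) ^ \<alpha> i)) - f \<alpha>\<bar> \<le> 0"
      using True by simp
    moreover have "bernstein_weight n f \<kappa> = 0" if "\<kappa> \<le> (\<lambda>_. n)" for n and \<kappa> :: "'d \<Rightarrow> nat"
    proof -
      have "(\<Sum>\<kappa>\<in>{..\<lambda>_. n}. bernstein_weight n f \<kappa>) = 0"
        using bernstein_reproduces_moment[of "\<lambda>_. 0" n f] True by (simp add: le_fun_def)
      moreover have "0 \<le> bernstein_weight n f \<kappa>" for \<kappa>
        unfolding bernstein_weight_def by (intro mult_nonneg_nonneg prod_nonneg pos) auto
      ultimately show ?thesis using that by (subst (asm) sum_nonneg_eq_0_iff) auto
    qed
    ultimately show ?thesis by (simp add: sum.neutral)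
  qed
  moreover have ae: "AE x in null_measure borel. P x" for P :: "('d \<Rightarrow> real) \<Rightarrow> bool"
    by (rule AE_I[of _ _ UNIV]) auto
  moreover have "integral\<^sup>L (null_measure borel) g = 0" for g :: "('d \<Rightarrow> real) \<Rightarrow> real"
    by (rule integral_eq_zero_AE[OF ae])
  ultimately show thesis
    by (intro that[of "null_measure borel"]) (auto intro: finite_measureI)
next
  case False
  define c where "c = f (\<lambda>_. 0)"
  have c: "c > 0" using False pos[of "\<lambda>_. 0" "\<lambda>_. 0"] by (simp add: c_def)
  have sc: "nabla \<beta> (\<lambda>\<alpha>. f \<alpha> / c) \<gamma> = nabla \<beta> f \<gamma> / c" for \<beta> \<gamma>
    by (simp add: nabla_def sum_divide_distrib)
  obtain \<mu> where \<mu>: "prob_space \<mu>" "sets \<mu> = sets borel" "AE x in \<mu>. x \<in> cube"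
      "\<And>\<alpha>. integral\<^sup>L \<mu> (monom_fun \<alpha>) = f \<alpha> / c"
  proof (rule hausdorff_moment_prob[of "\<lambda>\<alpha>. f \<alpha> / c"])
    show "0 \<le> nabla \<beta> (\<lambda>\<alpha>. f \<alpha> / c) \<gamma>" for \<beta> \<gamma> using pos c by (simp add: sc)
    show "f (\<lambda>_. 0) / c = 1" using False by (simp add: c_def)
  qed blast
  interpret \<mu>: prob_space \<mu> by fact
  show thesis
  proof (rule that[of "density \<mu> (\<lambda>_. ennreal c)"])
    show "finite_measure (density \<mu> (\<lambda>_. ennreal c))"
      by (intro finite_measureI) (simp add: emeasure_density nn_integral_cmult ennreal_mult_eq_top_iff)
    show "AE x in density \<mu> (\<lambda>_. ennreal c). x \<in> cube" using \<mu>(3) by (simp add: AE_density)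
    show "integral\<^sup>L (density \<mu> (\<lambda>_. ennreal c)) (monom_fun \<alpha>) = f \<alpha>" for \<alpha>
      using c \<mu>(4)[of \<alpha>] by (subst integral_density) (auto simp: measurable_cong_sets[OF \<mu>(2) refl])
  qed (simp add: \<mu>(2))
qed

section \<open>Polynomials and determinacy of moments\<close>

text \<open>Products are generated one coordinate factor at a time: the induction in
  \<open>moment_determinate\<close> then only has to raise one exponent. Closure under
  multiplication, for Stone-Weierstrass, is derived.\<close>

inductive poly_fun :: "(('d \<Rightarrow> real) \<Rightarrow> real) \<Rightarrow> bool" where
  const: "poly_fun (\<lambda>_. c)"
| add: "poly_fun p \<Longrightarrow> poly_fun q \<Longrightarrow> poly_fun (\<lambda>x. p x + q x)"
| coord: "poly_fun p \<Longrightarrow> poly_fun (\<lambda>x. x i * p x)"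

lemma poly_fun_scale: "poly_fun p \<Longrightarrow> poly_fun (\<lambda>x. c * p x)"
proof (induction rule: poly_fun.induct)
  case (const d)
  show ?case by (rule poly_fun.const)
next
  case (add p q)
  then show ?case using poly_fun.add[of "\<lambda>x. c * p x" "\<lambda>x. c * q x"] by (simp add: distrib_left)
next
  case (coord p i)
  then show ?case using poly_fun.coord[of "\<lambda>x. c * p x" i] by (simp add: mult.left_commute)
qed

lemma poly_fun_mult: "poly_fun p \<Longrightarrow> poly_fun q \<Longrightarrow> poly_fun (\<lambda>x. p x * q x)"
proof (induction rule: poly_fun.induct)
  case (const c)
  then show ?case by (rule poly_fun_scale)
next
  case (add p p')
  then show ?case using poly_fun.add[of "\<lambda>x. p x * q x" "\<lambda>x. p' x * q x"] by (simp add: distrib_right)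
next
  case (coord p i)
  then show ?case using poly_fun.coord[of "\<lambda>x. p x * q x" i] by (simp add: mult.assoc)
qed

lemma poly_fun_continuous: "poly_fun p \<Longrightarrow> continuous_on S p"
  by (induction rule: poly_fun.induct) (auto intro!: continuous_intros continuous_on_coordinate)

lemma compact_cube: "compact (cube :: ('d::finite \<Rightarrow> real) set)"
proof -
  have "compactin (product_topology (\<lambda>_. euclidean) UNIV) (PiE (UNIV :: 'd set) (\<lambda>_. {0..1::real}))"
    by (subst compactin_PiE) simp
  moreover have "PiE (UNIV :: 'd set) (\<lambda>_. {0..1::real}) = cube" by (auto simp: cube_def PiE_def Pi_def)
  ultimately show ?thesis by (simp add: euclidean_product_topology)
qed

lemma poly_fun_dense:
  fixes f :: "('d::finite \<Rightarrow> real) \<Rightarrow> real"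
  assumes "continuous_on cube f" "e > 0"
  obtains p where "poly_fun p" "\<And>x. x \<in> cube \<Longrightarrow> \<bar>f x - p x\<bar> < e"
proof -
  have "\<exists>g. poly_fun g \<and> (\<forall>x\<in>cube. \<bar>f x - g x\<bar> < e)"
  proof (rule Stone_Weierstrass_HOL[where P = poly_fun])
    show "\<And>x y :: 'd \<Rightarrow> real. x \<in> cube \<and> y \<in> cube \<and> x \<noteq> y \<Longrightarrow> \<exists>f. poly_fun f \<and> f x \<noteq> f y"
    proof -
      fix x y :: "'d \<Rightarrow> real" assume "x \<in> cube \<and> y \<in> cube \<and> x \<noteq> y"
      then obtain i where "x i \<noteq> y i" by (auto simp: fun_eq_iff)
      moreover have "poly_fun (\<lambda>x :: 'd \<Rightarrow> real. x i)" using poly_fun.coord[OF poly_fun.const[of 1], of i] by simp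
      ultimately show "\<exists>f. poly_fun f \<and> f x \<noteq> f y" by blast
    qed
  qed (use assms compact_cube in \<open>auto intro: poly_fun.intros poly_fun_mult poly_fun_continuous\<close>)
  then show thesis using that by blast
qed

text \<open>The cutoffs \<open>max 0 (1 - real n * infdist x X)\<close> converge to the indicator of
  a nonempty closed set, and closed sets form an intersection-stable generator.\<close>

lemma finite_measure_eqI_continuous:
  fixes M N :: "'a::metric_space measure"
  assumes fin: "finite_measure M" "finite_measure N" and sets: "sets M = sets borel" "sets N = sets borel"
    and eq: "\<And>f :: 'a \<Rightarrow> real. continuous_on UNIV f \<Longrightarrow> (\<And>x. 0 \<le> f x \<and> f x \<le> 1) \<Longrightarrow> integral\<^sup>L M f = integral\<^sup>L N f"
  shows "M = N"
proof (rule measure_eqI_generator_eq[where \<Omega> = UNIV and E = "Collect closed" and A = "\<lambda>_. UNIV"])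
  interpret M: finite_measure M by fact
  interpret N: finite_measure N by fact
  have [simp]: "space M = UNIV" "space N = UNIV" using sets_eq_imp_space_eq[OF sets(1)] sets_eq_imp_space_eq[OF sets(2)] by auto
  show "sets M = sigma_sets UNIV (Collect closed)" "sets N = sigma_sets UNIV (Collect closed)"
    using sets by (simp_all add: borel_eq_closed)
  show "Int_stable (Collect closed :: 'a set set)" by (auto simp: Int_stable_def)
  show "emeasure M UNIV \<noteq> \<infinity>" for i :: nat using M.emeasure_finite[of UNIV] by simp
  fix X :: "'a set" assume "X \<in> Collect closed"
  then have X: "closed X" by simp
  show "emeasure M X = emeasure N X"
  \<comment> \<open>The distance to the empty set is 0 by convention, which would make every cutoff
    constantly 1.\<close>
  proof (cases "X = {}")
    case False
    define f where "f n x = max 0 (1 - real n * infdist x X)" for n x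
    have cont: "continuous_on UNIV (f n)" for n unfolding f_def by (intro continuous_intros)
    have bd: "0 \<le> f n x \<and> f n x \<le> 1" for n x by (auto simp: f_def infdist_nonneg)
    have lim: "(\<lambda>n. f n x) \<longlonglongrightarrow> indicator X x" for x
    proof (cases "x \<in> X")
      case True
      then show ?thesis by (simp add: f_def)
    next
      case nX: False
      then have d: "infdist x X > 0" using X False infdist_pos_not_in_closed by blast
      have "\<forall>\<^sub>F n in sequentially. f n x = 0"
      proof -
        obtain N :: nat where N: "1 / infdist x X < real N" using reals_Archimedean2 by blast
        have "f n x = 0" if "n \<ge> N" for n
        proof -
          have "1 / infdist x X \<le> real n" using N that by linarith
          then show ?thesis using d by (simp add: f_def field_simps)
        qed
        then show ?thesis by (auto simp: eventually_sequentially)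
      qed
      then have "(\<lambda>n. f n x) \<longlonglongrightarrow> 0" by (rule tendsto_eventually)
      with nX show ?thesis by simp
    qed
    have conv: "(\<lambda>n. integral\<^sup>L L (f n)) \<longlonglongrightarrow> measure L X" if L: "finite_measure L" "sets L = sets borel" for L
    proof -
      interpret L: finite_measure L by fact
      have Xs: "X \<in> sets L" using X L by simp
      have "(\<lambda>n. integral\<^sup>L L (f n)) \<longlonglongrightarrow> integral\<^sup>L L (indicator X)"
      proof (rule integral_dominated_convergence[where w = "\<lambda>_. 1"])
        show "f n \<in> borel_measurable L" for n
          using borel_measurable_continuous_onI[OF cont[of n]] by (simp add: measurable_cong_sets[OF L(2) refl])
        show "AE x in L. norm (f n x) \<le> 1" for n using bd by simp
      qed (use lim Xs in auto)
      also have "integral\<^sup>L L (indicator X) = measure L X" using Xs by (simp add: sets.Int_space_eq2)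
      finally show ?thesis .
    qed
    have "measure M X = measure N X"
      using conv[OF fin(1) sets(1)] conv[OF fin(2) sets(2)] eq[OF cont bd] LIMSEQ_unique by simp
    then show ?thesis by (simp add: M.emeasure_eq_measure N.emeasure_eq_measure)
  qed simp
qed auto

lemma monom_fun_add_unit: "monom_fun (\<lambda>j. \<alpha> j + unit_index i j) x = monom_fun \<alpha> x * x i"
proof -
  have "(\<Prod>j\<in>UNIV. x j ^ unit_index i j) = (\<Prod>j\<in>UNIV. if j = i then x i else 1)"
    by (rule prod.cong) (auto simp: unit_index_def)
  then show ?thesis by (simp add: monom_fun_def power_add prod.distrib)
qed

lemma integrable_cube_continuous:
  fixes f :: "('d::finite \<Rightarrow> real) \<Rightarrow> real"
  assumes "finite_measure M" "sets M = sets borel" "AE x in M. x \<in> cube" and cont: "continuous_on UNIV f"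
  shows "integrable M f"
proof -
  interpret finite_measure M by fact
  have "bounded (f ` cube)"
    by (intro compact_imp_bounded compact_continuous_image compact_cube continuous_on_subset[OF cont]) auto
  then obtain B where B: "\<And>x. x \<in> cube \<Longrightarrow> norm (f x) \<le> B" by (auto simp: bounded_iff)
  show ?thesis
  proof (rule integrable_const_bound[of _ B])
    show "AE x in M. norm (f x) \<le> B" using assms(3) B by auto
    show "f \<in> borel_measurable M"
      using borel_measurable_continuous_onI[OF cont] by (simp add: measurable_cong_sets[OF assms(2) refl])
  qed
qed

lemma continuous_monom_fun: "continuous_on S (monom_fun \<alpha>)"
  unfolding monom_fun_def by (intro continuous_intros continuous_on_coordinate)

text \<open>Equal moments give equal integrals of polynomials; Stone-Weierstrass on the compact
  cube, which carries both measures, extends this to continuous functions.\<close>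

lemma moment_determinate:
  fixes M N :: "('d::finite \<Rightarrow> real) measure"
  assumes M: "finite_measure M" "sets M = sets borel" "AE x in M. x \<in> cube"
    and N: "finite_measure N" "sets N = sets borel" "AE x in N. x \<in> cube"
    and eq: "\<And>\<alpha>. integral\<^sup>L M (monom_fun \<alpha>) = integral\<^sup>L N (monom_fun \<alpha>)"
  shows "M = N"
proof (rule finite_measure_eqI_continuous[OF M(1) N(1) M(2) N(2)])
  interpret M: finite_measure M by fact
  interpret N: finite_measure N by fact
  \<comment> \<open>An arbitrary monomial factor is carried along: multiplication by a coordinate
    then only changes the exponent in the induction hypothesis.\<close>
  have poly: "integral\<^sup>L M (\<lambda>x. monom_fun \<alpha> x * p x) = integral\<^sup>L N (\<lambda>x. monom_fun \<alpha> x * p x)"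
    if "poly_fun p" for \<alpha> p
    using that
  proof (induction arbitrary: \<alpha> rule: poly_fun.induct)
    case (const c)
    then show ?case by (simp add: eq)
  next
    case (add p q)
    have "integrable L (\<lambda>x. monom_fun \<alpha> x * r x)" if "poly_fun r" "L = M \<or> L = N" for r L
    proof -
      have "continuous_on UNIV (\<lambda>x. monom_fun \<alpha> x * r x)"
        by (intro continuous_on_mult continuous_monom_fun poly_fun_continuous that)
      then show ?thesis using that(2) integrable_cube_continuous M N by blast
    qed
    with add show ?case by (simp add: distrib_left)
  next
    case (coord p i)
    from coord.IH[of "\<lambda>j. \<alpha> j + unit_index i j"] show ?case
      by (simp add: monom_fun_add_unit mult.assoc)
  qed
  fix f :: "('d \<Rightarrow> real) \<Rightarrow> real" assume f: "continuous_on UNIV f"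
  define C where "C = measure M (space M) + measure N (space N)"
  have C: "C \<ge> 0" by (simp add: C_def)
  show "integral\<^sup>L M f = integral\<^sup>L N f"
  proof (rule ccontr)
    assume ne: "integral\<^sup>L M f \<noteq> integral\<^sup>L N f"
    \<comment> \<open>Approximation costs at most C * e in total. Dividing by C + 1 keeps this below
      the assumed gap and is safe for null measures.\<close>
    define e where "e = \<bar>integral\<^sup>L M f - integral\<^sup>L N f\<bar> / (C + 1)"
    have e: "e > 0" using ne C by (simp add: e_def)
    obtain p where p: "poly_fun p" "\<And>x. x \<in> cube \<Longrightarrow> \<bar>f x - p x\<bar> < e"
      using poly_fun_dense[OF continuous_on_subset[OF f] e] by blast
    have "integral\<^sup>L M p = integral\<^sup>L N p" using poly[OF p(1), of "\<lambda>_. 0"] by (simp add: monom_fun_def)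
    moreover have "\<bar>integral\<^sup>L L f - integral\<^sup>L L p\<bar> \<le> measure L (space L) * e"
      if L: "finite_measure L" "sets L = sets borel" "AE x in L. x \<in> cube" for L
    proof -
      interpret L: finite_measure L by fact
      have if_: "integrable L f" and ip: "integrable L p"
        using integrable_cube_continuous[OF L] f p(1) poly_fun_continuous by blast+
      have "\<bar>integral\<^sup>L L f - integral\<^sup>L L p\<bar> = \<bar>integral\<^sup>L L (\<lambda>x. f x - p x)\<bar>" using if_ ip by simp
      also have "\<dots> \<le> integral\<^sup>L L (\<lambda>x. \<bar>f x - p x\<bar>)" by (rule integral_abs_bound)
      also have "\<dots> \<le> integral\<^sup>L L (\<lambda>x. e)"
      proof (rule integral_mono_AE)
        show "AE x in L. \<bar>f x - p x\<bar> \<le> e" using L(3) p(2) by (auto intro: less_imp_le)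
      qed (use if_ ip in auto)
      finally show ?thesis by simp
    qed
    from this[OF M] this[OF N] have "\<bar>integral\<^sup>L M f - integral\<^sup>L M p\<bar> + \<bar>integral\<^sup>L N f - integral\<^sup>L N p\<bar> \<le> C * e"
      by (simp add: C_def distrib_right)
    ultimately have "\<bar>integral\<^sup>L M f - integral\<^sup>L N f\<bar> \<le> C * e" by linarith
    also have "\<dots> < (C + 1) * e" using e by simp
    also have "\<dots> = \<bar>integral\<^sup>L M f - integral\<^sup>L N f\<bar>" using C by (simp add: e_def)
    finally show False by simp
  qed
qed

section \<open>Levy-Khinchin representation\<close>

text \<open>On the cube, the l1 distance to the corner (1,...,1). Being a polynomial, it turns
  monomials into combinations of monomials, so weighted moments remain computable.\<close>

definition corner_distance :: "('d::finite \<Rightarrow> real) \<Rightarrow> real" where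
  "corner_distance x = (\<Sum>i\<in>UNIV. 1 - x i)"

lemma corner_distance_nonneg: "x \<in> cube \<Longrightarrow> 0 \<le> corner_distance x"
  unfolding corner_distance_def by (rule sum_nonneg) (simp add: cube_def)

lemma punctured_cube_eq: "punctured_cube = cube - {\<lambda>_. 1}"
  by (auto simp: punctured_cube_def cube_def)

lemma corner_distance_pos:
  assumes "x \<in> punctured_cube"
  shows "0 < corner_distance x"
proof -
  have x: "0 \<le> 1 - x i" for i using assms by (simp add: punctured_cube_def)
  obtain i where "x i \<noteq> 1" using assms by (auto simp: punctured_cube_def)
  with x[of i] have "0 < 1 - x i" by simp
  then show ?thesis unfolding corner_distance_def by (intro sum_pos2[of _ i]) (use x in auto)
qed

lemma continuous_corner_distance: "continuous_on S corner_distance"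
  unfolding corner_distance_def by (intro continuous_intros continuous_on_coordinate)

lemma measurable_corner_distance [measurable]: "corner_distance \<in> borel_measurable borel"
  unfolding corner_distance_def by measurable

lemma punctured_cube_borel [measurable]: "(punctured_cube :: ('d::finite \<Rightarrow> real) set) \<in> sets borel"
  unfolding punctured_cube_eq by (intro sets.Diff cube_borel borel_closed closed_singleton)

lemma sets_restrict_punctured_cube:
  "A \<in> sets (restrict_space borel punctured_cube) \<longleftrightarrow> A \<in> sets borel \<and> A \<subseteq> (punctured_cube :: ('d::finite \<Rightarrow> real) set)"
  by (subst sets_restrict_space_iff) auto

lemma space_eq_punctured_cube:
  "sets \<nu> = sets (restrict_space borel punctured_cube) \<Longrightarrow> space \<nu> = (punctured_cube :: ('d::finite \<Rightarrow> real) set)"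
  by (drule sets_eq_imp_space_eq) (simp add: space_restrict_space)

lemma measurable_punctured_cube:
  fixes f :: "('d::finite \<Rightarrow> real) \<Rightarrow> 'b"
  assumes "sets \<nu> = sets (restrict_space borel punctured_cube)" "f \<in> measurable borel N"
  shows "f \<in> measurable \<nu> N"
  using measurable_restrict_space1[OF assms(2)] by (simp add: measurable_cong_sets[OF assms(1) refl])

lemma borel_measurable_sets_eq_borel:
  "f \<in> borel_measurable borel \<Longrightarrow> sets L = sets borel \<Longrightarrow> f \<in> borel_measurable L"
  using measurable_cong_sets[of L borel borel borel] by simp

lemma measurable_inclusion_punctured_cube:
  "sets \<nu> = sets (restrict_space borel punctured_cube) \<Longrightarrow>
    (\<lambda>x. x) \<in> measurable \<nu> (borel :: ('d::finite \<Rightarrow> real) measure)"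
  by (rule measurable_punctured_cube[OF _ measurable_ident[unfolded id_def]])

section \<open>Radon regularity from one integrable weight\<close>

text \<open>Markov's inequality bounds every set on which the weight stays above a positive
  constant. Compact subsets are such sets because the weight attains a positive minimum; the sets
  \<open>E n\<close> are too and exhaust the punctured cube, which reduces inner regularity to
  finite measures.\<close>

lemma radon_measure_on_punctured_cube:
  fixes \<nu> :: "('d::finite \<Rightarrow> real) measure"
  assumes sets: "sets \<nu> = sets (restrict_space borel punctured_cube)"
    and int: "integrable \<nu> corner_distance"
  shows "radon_measure_on punctured_cube \<nu>"
proof -
  have sp: "space \<nu> = punctured_cube" by (rule space_eq_punctured_cube[OF sets])
  have sets_iff: "A \<in> sets \<nu> \<longleftrightarrow> A \<in> sets borel \<and> A \<subseteq> punctured_cube" for A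
    unfolding sets by (rule sets_restrict_punctured_cube)
  have fin: "emeasure \<nu> A < \<infinity>" if A: "A \<in> sets \<nu>" and c: "c > 0" "\<And>x. x \<in> A \<Longrightarrow> c \<le> corner_distance x" for A c
  proof -
    have "ennreal c * emeasure \<nu> A = (\<integral>\<^sup>+x. ennreal c * indicator A x \<partial>\<nu>)"
      using A by (simp add: nn_integral_cmult_indicator)
    also have "\<dots> \<le> (\<integral>\<^sup>+x. ennreal (corner_distance x) \<partial>\<nu>)"
      by (rule nn_integral_mono) (auto split: split_indicator intro!: ennreal_leI c)
    also have "\<dots> \<le> (\<integral>\<^sup>+x. ennreal (norm (corner_distance x)) \<partial>\<nu>)"
      by (rule nn_integral_mono) (auto intro!: ennreal_leI)
    also have "\<dots> < \<infinity>" using int by (simp add: integrable_iff_bounded)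
    finally show ?thesis using c(1) by (auto simp: ennreal_mult_less_top less_top)
  qed
  have compact_fin: "emeasure \<nu> K < \<infinity>" if K: "compact K" "K \<subseteq> punctured_cube" for K
  proof (cases "K = {}")
    case False
    obtain x where x: "x \<in> K" "\<And>y. y \<in> K \<Longrightarrow> corner_distance x \<le> corner_distance y"
      using continuous_attains_inf[OF K(1) False continuous_corner_distance] by blast
    show ?thesis
      by (rule fin[of K "corner_distance x"])
        (use x K corner_distance_pos in \<open>auto simp: sets_iff compact_imp_closed\<close>)
  qed simp
  have regular: "emeasure \<nu> B = (SUP K\<in>{K. compact K \<and> K \<subseteq> B}. emeasure \<nu> K)" if B: "B \<in> sets \<nu>" for B
  proof (rule antisym)
    show "(SUP K\<in>{K. compact K \<and> K \<subseteq> B}. emeasure \<nu> K) \<le> emeasure \<nu> B"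
      by (rule SUP_least) (use B in \<open>auto intro: emeasure_mono\<close>)
    define E :: "nat \<Rightarrow> ('d \<Rightarrow> real) set" where "E n = {x \<in> punctured_cube. 1 / Suc n \<le> corner_distance x}" for n
    have E: "E n \<in> sets \<nu>" for n
    proof -
      have "{x \<in> space borel. x \<in> punctured_cube \<and> 1 / Suc n \<le> corner_distance (x :: 'd \<Rightarrow> real)} \<in> sets borel"
        by measurable
      then show ?thesis by (auto simp: sets_iff E_def)
    qed
    have Efin: "emeasure \<nu> (E n) < \<infinity>" for n by (rule fin[OF E, of "1 / Suc n"]) (auto simp: E_def)
    have Un: "(\<Union>n. B \<inter> E n) = B"
    proof -
      have "\<exists>n. x \<in> E n" if "x \<in> B" for x
      proof -
        have x: "x \<in> punctured_cube" using that B by (auto simp: sets_iff)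
        obtain n where "1 / real (Suc n) < corner_distance x"
          using nat_approx_posE[OF corner_distance_pos[OF x]] by blast
        with x have "x \<in> E n" by (simp add: E_def)
        then show ?thesis ..
      qed
      then show ?thesis by auto
    qed
    have inc: "incseq (\<lambda>n. B \<inter> E n)"
    proof (rule incseq_SucI)
      fix n
      have "1 / real (Suc (Suc n)) \<le> 1 / real (Suc n)" by (simp add: frac_le)
      then show "B \<inter> E n \<subseteq> B \<inter> E (Suc n)" by (auto simp: E_def intro: order_trans)
    qed
    have "emeasure \<nu> B = (SUP n. emeasure \<nu> (B \<inter> E n))"
    proof -
      have "range (\<lambda>n. B \<inter> E n) \<subseteq> sets \<nu>" using B E by auto
      from SUP_emeasure_incseq[OF this inc] show ?thesis by (simp only: Un)
    qed
    also have "\<dots> \<le> (SUP K\<in>{K. compact K \<and> K \<subseteq> B}. emeasure \<nu> K)"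
    proof (rule SUP_least)
      fix n
      \<comment> \<open>The part of \<nu> on \<open>E n\<close>, transported to all Borel sets: a
        finite measure to which \<open>inner_regular\<close> applies.\<close>
      define L where "L = distr (density \<nu> (indicator (E n))) borel (\<lambda>x. x)"
      have id: "(\<lambda>x. x) \<in> measurable (density \<nu> (indicator (E n))) borel"
        by (rule measurable_inclusion_punctured_cube) (simp add: sets)
      have L: "emeasure L A = emeasure \<nu> (A \<inter> E n)" if "A \<in> sets borel" for A
      proof -
        have "A \<inter> punctured_cube \<in> sets \<nu>" using that by (auto simp: sets_iff)
        moreover have "A \<inter> punctured_cube \<inter> E n = A \<inter> E n" by (auto simp: E_def)
        moreover from calculation have "A \<inter> E n \<in> sets \<nu>" using E by (metis sets.Int)
        ultimately show ?thesis unfolding L_def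
          using that E[of n] by (simp add: emeasure_distr[OF id] sp emeasure_density_const emeasure_density
            indicator_inter_arith[symmetric] Int_commute Int_left_commute)
      qed
      have BE: "B \<inter> E n \<in> sets borel" using B E[of n] by (auto simp: sets_iff)
      have "emeasure L (space L) \<noteq> \<infinity>" using L[of UNIV] Efin[of n] by (simp add: L_def)
      from inner_regular[OF _ this BE]
      have "emeasure L (B \<inter> E n) = (SUP K\<in>{K. K \<subseteq> B \<inter> E n \<and> compact K}. emeasure L K)"
        by (simp add: L_def)
      also have "\<dots> \<le> (SUP K\<in>{K. compact K \<and> K \<subseteq> B}. emeasure \<nu> K)"
      proof (rule SUP_mono)
        fix K assume K: "K \<in> {K. K \<subseteq> B \<inter> E n \<and> compact K}"
        then have "emeasure L K = emeasure \<nu> K" using L[of K] by (simp add: compact_imp_closed Int_absorb2)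
        then show "\<exists>m\<in>{K. compact K \<and> K \<subseteq> B}. emeasure L K \<le> emeasure \<nu> m" using K by auto
      qed
      finally show "emeasure \<nu> (B \<inter> E n) \<le> (SUP K\<in>{K. compact K \<and> K \<subseteq> B}. emeasure \<nu> K)"
        using L[OF BE] by (simp add: Int_assoc)
    qed
    finally show "emeasure \<nu> B \<le> (SUP K\<in>{K. compact K \<and> K \<subseteq> B}. emeasure \<nu> K)" .
  qed
  show ?thesis unfolding radon_measure_on_def using sets compact_fin regular by blast
qed

section \<open>Levy representations of functions on multi-indices\<close>

text \<open>The formula for a bare function \<phi>. The additive map is encoded by its values at the
  unit indices, \<alpha> = 0 is included as a trivial instance, and the Radon property follows from
  the integrability clause by \<open>radon_measure_on_punctured_cube\<close>.\<close>

definition levy_representation ::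
    "(('d::finite \<Rightarrow> nat) \<Rightarrow> real) \<Rightarrow> ('d \<Rightarrow> real) measure \<Rightarrow> ('d \<Rightarrow> real) \<Rightarrow> bool" where
  "levy_representation \<phi> \<nu> b \<longleftrightarrow> sets \<nu> = sets (restrict_space borel punctured_cube) \<and> (\<forall>i. 0 \<le> b i) \<and>
     (\<forall>\<alpha>. integrable \<nu> (\<lambda>x. 1 - monom_fun \<alpha> x) \<and>
       \<phi> \<alpha> = \<phi> (\<lambda>_. 0) + (\<Sum>i\<in>UNIV. real (\<alpha> i) * b i) + (LINT x|\<nu>. 1 - monom_fun \<alpha> x))"

lemma monom_fun_0 [simp]: "monom_fun (\<lambda>_. 0) x = 1"
  by (simp add: monom_fun_def)

lemma monom_fun_unit: "monom_fun (unit_index i) x = x i"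
  using monom_fun_add_unit[of "\<lambda>_. 0" i x] by simp

lemma multi_index_induct [case_names zero add_unit]:
  fixes \<alpha> :: "'d::finite \<Rightarrow> nat"
  assumes "P (\<lambda>_. 0)" "\<And>\<alpha> j. P \<alpha> \<Longrightarrow> P (\<lambda>i. \<alpha> i + unit_index j i)"
  shows "P \<alpha>"
proof (induction "\<Sum>i\<in>UNIV. \<alpha> i" arbitrary: \<alpha>)
  case 0
  then have "\<alpha> = (\<lambda>_. 0)" by auto
  then show ?case using assms(1) by simp
next
  case (Suc n)
  obtain j where j: "\<alpha> j \<noteq> 0" using Suc.hyps(2) by (metis sum.neutral nat.distinct(1))
  define \<beta> where "\<beta> = (\<lambda>i. \<alpha> i - unit_index j i)"
  have \<alpha>: "\<alpha> = (\<lambda>i. \<beta> i + unit_index j i)" using j by (auto simp: \<beta>_def unit_index_def)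
  have "(\<Sum>i\<in>UNIV. \<alpha> i) = (\<Sum>i\<in>UNIV. \<beta> i) + (\<Sum>i\<in>UNIV. unit_index j i)"
    unfolding sum.distrib[symmetric] by (rule sum.cong[OF refl fun_cong[OF \<alpha>]])
  also have "(\<Sum>i\<in>UNIV. unit_index j i) = 1" by (simp add: unit_index_def)
  finally have "n = (\<Sum>i\<in>UNIV. \<beta> i)" using Suc.hyps(2) by linarith
  from Suc.hyps(1)[OF this] have "P \<beta>" .
  then show ?case by (subst \<alpha>) (rule assms(2))
qed

lemma levy_representation_corner_distance:
  assumes "levy_representation \<phi> \<nu> b"
  shows "integrable \<nu> corner_distance"
proof -
  have "integrable \<nu> (\<lambda>x. 1 - monom_fun (unit_index i) x)" for i
    using assms unfolding levy_representation_def by blast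
  then have "integrable \<nu> (\<lambda>x. \<Sum>i\<in>UNIV. 1 - x i)" unfolding monom_fun_unit by simp
  then show ?thesis by (simp add: corner_distance_def[abs_def])
qed

text \<open>The coefficients \<open>b\<close> cancel in second differences.\<close>
lemma levy_representation_moments:
  fixes \<phi> :: "('d::finite \<Rightarrow> nat) \<Rightarrow> real"
  assumes "levy_representation \<phi> \<nu> b"
  shows "has_bochner_integral \<nu> (\<lambda>x. monom_fun \<alpha> x * ((1 - x i) * (1 - x j)))
    (\<phi> (\<lambda>k. \<alpha> k + unit_index i k) + \<phi> (\<lambda>k. \<alpha> k + unit_index j k) - \<phi> \<alpha> -
      \<phi> (\<lambda>k. \<alpha> k + unit_index i k + unit_index j k))"
proof -
  have int: "integrable \<nu> (\<lambda>x. 1 - monom_fun \<alpha> x)" for \<alpha>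
    using assms unfolding levy_representation_def by blast
  have "\<phi> \<alpha> = \<phi> (\<lambda>_. 0) + (\<Sum>i\<in>UNIV. real (\<alpha> i) * b i) + (LINT x|\<nu>. 1 - monom_fun \<alpha> x)" for \<alpha>
    using assms unfolding levy_representation_def by blast
  then have val: "(LINT x|\<nu>. 1 - monom_fun \<alpha> x) = \<phi> \<alpha> - \<phi> (\<lambda>_. 0) - (\<Sum>i\<in>UNIV. real (\<alpha> i) * b i)" for \<alpha>
    by (metis add.commute add_diff_cancel_left' diff_diff_eq)
  have hb: "has_bochner_integral \<nu> (\<lambda>x. 1 - monom_fun \<alpha> x) (\<phi> \<alpha> - \<phi> (\<lambda>_. 0) - (\<Sum>i\<in>UNIV. real (\<alpha> i) * b i))" for \<alpha>
    unfolding val[symmetric] by (rule has_bochner_integral_integrable[OF int])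
  have eq: "monom_fun \<alpha> x * ((1 - x i) * (1 - x j)) =
      (1 - monom_fun (\<lambda>k. \<alpha> k + unit_index i k) x) + (1 - monom_fun (\<lambda>k. \<alpha> k + unit_index j k) x)
      - (1 - monom_fun \<alpha> x) - (1 - monom_fun (\<lambda>k. \<alpha> k + unit_index i k + unit_index j k) x)" for x
    unfolding monom_fun_add_unit by (simp add: algebra_simps)
  have "has_bochner_integral \<nu> (\<lambda>x. monom_fun \<alpha> x * ((1 - x i) * (1 - x j)))
      ((\<phi> (\<lambda>k. \<alpha> k + unit_index i k) - \<phi> (\<lambda>_. 0) - (\<Sum>k\<in>UNIV. real (\<alpha> k + unit_index i k) * b k))
      + (\<phi> (\<lambda>k. \<alpha> k + unit_index j k) - \<phi> (\<lambda>_. 0) - (\<Sum>k\<in>UNIV. real (\<alpha> k + unit_index j k) * b k))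
      - (\<phi> \<alpha> - \<phi> (\<lambda>_. 0) - (\<Sum>k\<in>UNIV. real (\<alpha> k) * b k))
      - (\<phi> (\<lambda>k. \<alpha> k + unit_index i k + unit_index j k) - \<phi> (\<lambda>_. 0) -
          (\<Sum>k\<in>UNIV. real (\<alpha> k + unit_index i k + unit_index j k) * b k)))"
    unfolding eq by (rule has_bochner_integral_diff[OF has_bochner_integral_diff[OF has_bochner_integral_add[OF hb hb] hb] hb])
  moreover have "((\<phi> (\<lambda>k. \<alpha> k + unit_index i k) - \<phi> (\<lambda>_. 0) - (\<Sum>k\<in>UNIV. real (\<alpha> k + unit_index i k) * b k))
      + (\<phi> (\<lambda>k. \<alpha> k + unit_index j k) - \<phi> (\<lambda>_. 0) - (\<Sum>k\<in>UNIV. real (\<alpha> k + unit_index j k) * b k))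
      - (\<phi> \<alpha> - \<phi> (\<lambda>_. 0) - (\<Sum>k\<in>UNIV. real (\<alpha> k) * b k))
      - (\<phi> (\<lambda>k. \<alpha> k + unit_index i k + unit_index j k) - \<phi> (\<lambda>_. 0) -
          (\<Sum>k\<in>UNIV. real (\<alpha> k + unit_index i k + unit_index j k) * b k))) =
      \<phi> (\<lambda>k. \<alpha> k + unit_index i k) + \<phi> (\<lambda>k. \<alpha> k + unit_index j k) - \<phi> \<alpha> -
      \<phi> (\<lambda>k. \<alpha> k + unit_index i k + unit_index j k)"
    by (simp add: distrib_right sum.distrib)
  ultimately show ?thesis by metis
qed

text \<open>The two additive parts may differ a priori, so second differences are compared: up to
  sign, their sums are the moments of the measure weighted by the squared corner distance. The
  weighted measure is finite, hence determined, and the weight can be divided out because it is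
  positive on the punctured cube.\<close>

lemma levy_representation_unique:
  fixes \<phi> :: "('d::finite \<Rightarrow> nat) \<Rightarrow> real"
  assumes "levy_representation \<phi> \<nu> b" "levy_representation \<phi> \<nu>' b'"
  shows "\<nu> = \<nu>'"
proof -
  \<comment> \<open>The weighted measure is moved to all Borel sets, where the determinacy theorem
    is stated.\<close>
  define V where "V L = distr (density L (\<lambda>x. ennreal ((corner_distance x)\<^sup>2))) borel (\<lambda>x. x)"
    for L :: "('d \<Rightarrow> real) measure"
  \<comment> \<open>The squared sum of the 1 - x_i expands into a double sum over i and j, each term
    of which integrates to a second difference up to sign.\<close>
  define \<psi> where "\<psi> \<alpha> = (\<Sum>i\<in>UNIV. \<Sum>j\<in>UNIV. \<phi> (\<lambda>k. \<alpha> k + unit_index i k) + \<phi> (\<lambda>k. \<alpha> k + unit_index j k) - \<phi> \<alpha> -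
      \<phi> (\<lambda>k. \<alpha> k + unit_index i k + unit_index j k))" for \<alpha>
  have main: "finite_measure (V L) \<and> (AE x in V L. x \<in> cube) \<and> (\<forall>\<alpha>. integral\<^sup>L (V L) (monom_fun \<alpha>) = \<psi> \<alpha>) \<and>
      sets L = sets (restrict_space borel punctured_cube) \<and>
      (\<forall>A\<in>sets L. emeasure (V L) A = emeasure (density L (\<lambda>x. ennreal ((corner_distance x)\<^sup>2))) A) \<and>
      L = density (density L (\<lambda>x. ennreal ((corner_distance x)\<^sup>2))) (\<lambda>x. ennreal (1 / (corner_distance x)\<^sup>2))"
    if L: "levy_representation \<phi> L c" for L c
  proof -
    have sets: "sets L = sets (restrict_space borel punctured_cube)" using L unfolding levy_representation_def by blast
    have sp: "space L = punctured_cube" by (rule space_eq_punctured_cube[OF sets])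
    have m: "f \<in> borel_measurable L" if "f \<in> borel_measurable borel" for f :: "('d \<Rightarrow> real) \<Rightarrow> real"
      by (rule measurable_punctured_cube[OF sets that])
    have id: "(\<lambda>x. x) \<in> measurable (density L g) borel" for g
      by (rule measurable_inclusion_punctured_cube) (simp add: sets)
    have cd: "(\<lambda>x. (corner_distance x)\<^sup>2) \<in> borel_measurable L" by (intro m) measurable
    have hb: "has_bochner_integral L (\<lambda>x. monom_fun \<alpha> x * (corner_distance x)\<^sup>2) (\<psi> \<alpha>)" for \<alpha>
    proof -
      have "has_bochner_integral L (\<lambda>x. \<Sum>i\<in>UNIV. \<Sum>j\<in>UNIV. monom_fun \<alpha> x * ((1 - x i) * (1 - x j))) (\<psi> \<alpha>)"
        unfolding \<psi>_def by (intro has_bochner_integral_sum levy_representation_moments[OF L])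
      moreover have "(\<Sum>i\<in>UNIV. \<Sum>j\<in>UNIV. monom_fun \<alpha> x * ((1 - x i) * (1 - x j))) = monom_fun \<alpha> x * (corner_distance x)\<^sup>2" for x

        unfolding corner_distance_def power2_eq_square sum_product by (simp only: sum_distrib_left)
      ultimately show ?thesis by simp
    qed
    have "integrable L (\<lambda>x. (corner_distance x)\<^sup>2)"
      using hb[of "\<lambda>_. 0"] by (simp add: has_bochner_integral_iff)
    then have fin: "(\<integral>\<^sup>+x. ennreal ((corner_distance x)\<^sup>2) \<partial>L) < \<infinity>"
      by (simp add: integrable_iff_bounded)
    have f: "finite_measure (V L)"
      using fin by (intro finite_measureI) (simp add: V_def emeasure_distr[OF id] emeasure_density cd cong: nn_integral_cong_simp)
    have ae: "AE x in V L. x \<in> cube"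
      unfolding V_def
      by (subst AE_distr_iff[OF id]) (use cube_borel in \<open>auto intro!: AE_I2 simp: sp punctured_cube_eq\<close>)
    have mo: "integral\<^sup>L (V L) (monom_fun \<alpha>) = \<psi> \<alpha>" for \<alpha>
    proof -
      have "integral\<^sup>L (V L) (monom_fun \<alpha>) = integral\<^sup>L (density L (\<lambda>x. ennreal ((corner_distance x)\<^sup>2))) (monom_fun \<alpha>)"
        unfolding V_def by (rule integral_distr[OF id measurable_monom_fun])
      also have "\<dots> = (LINT x|L. (corner_distance x)\<^sup>2 *\<^sub>R monom_fun \<alpha> x)"
        using cd by (intro integral_density m measurable_monom_fun) auto
      also have "\<dots> = \<psi> \<alpha>" using hb[of \<alpha>] by (simp add: has_bochner_integral_iff mult.commute)
      finally show ?thesis .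
    qed
    have em: "emeasure (V L) A = emeasure (density L (\<lambda>x. ennreal ((corner_distance x)\<^sup>2))) A" if "A \<in> sets L" for A
    proof -
      have "A \<in> sets borel" "A \<subseteq> punctured_cube" using that by (auto simp: sets sets_restrict_punctured_cube)
      then show ?thesis by (simp add: V_def emeasure_distr[OF id] sp Int_absorb2)
    qed
    have re: "L = density (density L (\<lambda>x. ennreal ((corner_distance x)\<^sup>2))) (\<lambda>x. ennreal (1 / (corner_distance x)\<^sup>2))"
    proof -
      have cd': "(\<lambda>x. 1 / (corner_distance x)\<^sup>2) \<in> borel_measurable L" by (intro m) measurable
      have "density (density L (\<lambda>x. ennreal ((corner_distance x)\<^sup>2))) (\<lambda>x. ennreal (1 / (corner_distance x)\<^sup>2)) =
          density L (\<lambda>x. ennreal ((corner_distance x)\<^sup>2) * ennreal (1 / (corner_distance x)\<^sup>2))"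
        using cd cd' by (intro density_density_eq) auto
      also have "\<dots> = density L (\<lambda>_. 1)"
      proof (rule density_cong)
        show "AE x in L. ennreal ((corner_distance x)\<^sup>2) * ennreal (1 / (corner_distance x)\<^sup>2) = 1"
        proof (rule AE_I2)
          fix x assume "x \<in> space L"
          then have "corner_distance x > 0" using corner_distance_pos by (simp add: sp)
          then show "ennreal ((corner_distance x)\<^sup>2) * ennreal (1 / (corner_distance x)\<^sup>2) = 1"
            by (simp add: ennreal_mult[symmetric])
        qed
      qed (use cd cd' in auto)
      finally show ?thesis by (simp add: density_1)
    qed
    show ?thesis by (intro conjI allI ballI f ae mo sets em re)
  qed
  have fin: "finite_measure (V L)" and cube: "AE x in V L. x \<in> cube"
    and mom: "integral\<^sup>L (V L) (monom_fun \<alpha>) = \<psi> \<alpha>"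
    and sets: "sets L = sets (restrict_space borel punctured_cube)"
    and em: "A \<in> sets L \<Longrightarrow> emeasure (density L (\<lambda>x. ennreal ((corner_distance x)\<^sup>2))) A = emeasure (V L) A"
    and rec: "L = density (density L (\<lambda>x. ennreal ((corner_distance x)\<^sup>2))) (\<lambda>x. ennreal (1 / (corner_distance x)\<^sup>2))"
    if "levy_representation \<phi> L c" for L c \<alpha> A
  proof -
    note m = main[OF that]
    show "finite_measure (V L)" using m by (rule conjunct1)
    show "AE x in V L. x \<in> cube" using m[THEN conjunct2] by (rule conjunct1)
    show "integral\<^sup>L (V L) (monom_fun \<alpha>) = \<psi> \<alpha>" by (rule m[THEN conjunct2, THEN conjunct2, THEN conjunct1, THEN spec])
    show "sets L = sets (restrict_space borel punctured_cube)"
      by (rule m[THEN conjunct2, THEN conjunct2, THEN conjunct2, THEN conjunct1])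
    show "emeasure (density L (\<lambda>x. ennreal ((corner_distance x)\<^sup>2))) A = emeasure (V L) A" if "A \<in> sets L"
      by (rule m[THEN conjunct2, THEN conjunct2, THEN conjunct2, THEN conjunct2, THEN conjunct1, THEN bspec, OF that, symmetric])
    show "L = density (density L (\<lambda>x. ennreal ((corner_distance x)\<^sup>2))) (\<lambda>x. ennreal (1 / (corner_distance x)\<^sup>2))"
      by (rule m[THEN conjunct2, THEN conjunct2, THEN conjunct2, THEN conjunct2, THEN conjunct2])
  qed
  have V: "V \<nu> = V \<nu>'"
    by (intro moment_determinate fin[OF assms(1)] fin[OF assms(2)] cube[OF assms(1)] cube[OF assms(2)])
      (simp_all add: V_def[THEN arg_cong[where f = sets]] mom[OF assms(1)] mom[OF assms(2)])
  have "density \<nu> (\<lambda>x. ennreal ((corner_distance x)\<^sup>2)) = density \<nu>' (\<lambda>x. ennreal ((corner_distance x)\<^sup>2))"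
  proof (rule measure_eqI)
    show "sets (density \<nu> (\<lambda>x. ennreal ((corner_distance x)\<^sup>2))) = sets (density \<nu>' (\<lambda>x. ennreal ((corner_distance x)\<^sup>2)))"
      by (simp add: sets[OF assms(1)] sets[OF assms(2)])
    fix A assume "A \<in> sets (density \<nu> (\<lambda>x. ennreal ((corner_distance x)\<^sup>2)))"
    then have "A \<in> sets \<nu>" "A \<in> sets \<nu>'" using sets[OF assms(1)] sets[OF assms(2)] by auto
    then show "emeasure (density \<nu> (\<lambda>x. ennreal ((corner_distance x)\<^sup>2))) A =
        emeasure (density \<nu>' (\<lambda>x. ennreal ((corner_distance x)\<^sup>2))) A"
      using em[OF assms(1)] em[OF assms(2)] V by simp
  qed
  then have "density (density \<nu> (\<lambda>x. ennreal ((corner_distance x)\<^sup>2))) (\<lambda>x. ennreal (1 / (corner_distance x)\<^sup>2)) =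
      density (density \<nu>' (\<lambda>x. ennreal ((corner_distance x)\<^sup>2))) (\<lambda>x. ennreal (1 / (corner_distance x)\<^sup>2))"
    by (simp only:)
  then show ?thesis unfolding rec[OF assms(1), symmetric] rec[OF assms(2), symmetric] .
qed

lemma sum_add_unit_index:
  "(\<Sum>i\<in>UNIV. real (\<alpha> i + unit_index j i) * b i) = (\<Sum>i\<in>UNIV. real (\<alpha> i) * b i) + b (j :: 'd::finite)"
proof -
  have "(\<Sum>i\<in>UNIV. real (unit_index j i) * b i) = (\<Sum>i\<in>UNIV. if i = j then b i else 0)"
    by (rule sum.cong) (auto simp: unit_index_def)
  then show ?thesis by (simp add: distrib_right sum.distrib)
qed

text \<open>
  The first differences of a completely alternating \<open>\<phi>\<close> are moments of finite measures \<open>\<mu>\<^sub>j\<close>.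
  Symmetry of the second differences gives \<open>corner_distance \<cdot> \<mu>\<^sub>j = (1 - x\<^sub>j) \<cdot> \<mu>\<close> for the sum \<open>\<mu>\<close> of
  the \<open>\<mu>\<^sub>j\<close>, so the density \<open>1 / corner_distance\<close> of the measure \<open>\<mu>\<close> works for all coordinates simultaneously.
\<close>
lemma levy_representation_exists:
  fixes \<phi> :: "('d::finite \<Rightarrow> nat) \<Rightarrow> real"
  assumes alt: "\<And>\<alpha> \<gamma>. \<alpha> \<noteq> (\<lambda>_. 0) \<Longrightarrow> nabla \<alpha> \<phi> \<gamma> \<le> 0"
  obtains \<nu> b where "levy_representation \<phi> \<nu> b"
proof -
  define \<psi> where "\<psi> j \<alpha> = \<phi> (\<lambda>i. \<alpha> i + unit_index j i) - \<phi> \<alpha>" for j \<alpha>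
  have pos: "0 \<le> nabla \<beta> (\<psi> j) \<gamma>" for \<beta> j \<gamma>
  proof -
    have "\<beta> j + unit_index j j \<noteq> 0" by (simp add: unit_index_def)
    then have "(\<lambda>i. \<beta> i + unit_index j i) \<noteq> (\<lambda>_. 0)" by metis
    from alt[OF this] show ?thesis
      unfolding \<psi>_def nabla_forward_difference by simp
  qed
  have "\<exists>\<mu>. finite_measure \<mu> \<and> sets \<mu> = sets borel \<and> (AE x in \<mu>. x \<in> cube) \<and>
      (\<forall>\<alpha>. integral\<^sup>L \<mu> (monom_fun \<alpha>) = \<psi> j \<alpha>)" for j
    using hausdorff_moment[of "\<psi> j", OF pos] by metis
  then obtain m where m: "\<And>j. finite_measure (m j)" "\<And>j. sets (m j) = sets borel"
    "\<And>j. AE x in m j. x \<in> cube" and mom: "\<And>j \<alpha>. integral\<^sup>L (m j) (monom_fun \<alpha>) = \<psi> j \<alpha>" by metis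
  \<comment> \<open>The moment problem is solved once more for the sum of all \<psi> j; this fixes
    the moments of \<mu> without adding measures.\<close>
  have "0 \<le> nabla \<beta> (\<lambda>\<alpha>. \<Sum>j\<in>UNIV. \<psi> j \<alpha>) \<gamma>" for \<beta> \<gamma>
    unfolding nabla_sum by (intro sum_nonneg pos)
  from hausdorff_moment[of "\<lambda>\<alpha>. \<Sum>j\<in>UNIV. \<psi> j \<alpha>", OF this]
  obtain \<mu> where \<mu>: "finite_measure \<mu>" "sets \<mu> = sets borel" "AE x in \<mu>. x \<in> cube"
    and mom\<mu>: "\<And>\<alpha>. integral\<^sup>L \<mu> (monom_fun \<alpha>) = (\<Sum>j\<in>UNIV. \<psi> j \<alpha>)" by blast
  note bm = borel_measurable_sets_eq_borel
  have key: "density (m j) (\<lambda>x. ennreal (corner_distance x)) = density \<mu> (\<lambda>x. ennreal (1 - x j))" for j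
  proof (rule moment_determinate)
    have fin: "finite_measure (density L (\<lambda>x. ennreal (f x)))" and ae: "AE x in density L (\<lambda>x. ennreal (f x)). x \<in> cube"
      and dint: "integral\<^sup>L (density L (\<lambda>x. ennreal (f x))) (monom_fun \<alpha>) = (LINT x|L. monom_fun \<alpha> x * f x)"
      if L: "finite_measure L" "sets L = sets borel" "AE x in L. x \<in> cube"
        and f: "continuous_on UNIV f" "\<And>x. x \<in> cube \<Longrightarrow> 0 \<le> f x" for L f \<alpha>
    proof -
      have fm: "f \<in> borel_measurable L" by (rule bm[OF borel_measurable_continuous_onI[OF f(1)] L(2)])
      have "integrable L f" by (rule integrable_cube_continuous[OF L f(1)])
      then have "(\<integral>\<^sup>+x. ennreal (norm (f x)) \<partial>L) < \<infinity>" by (simp add: integrable_iff_bounded)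
      moreover have "(\<integral>\<^sup>+x. ennreal (f x) \<partial>L) \<le> (\<integral>\<^sup>+x. ennreal (norm (f x)) \<partial>L)"
        by (intro nn_integral_mono ennreal_leI) simp
      ultimately have "(\<integral>\<^sup>+x. ennreal (f x) \<partial>L) < \<infinity>" by (rule le_less_trans[rotated])
      then show "finite_measure (density L (\<lambda>x. ennreal (f x)))"
        using fm by (intro finite_measureI) (simp add: emeasure_density cong: nn_integral_cong_simp)
      show "AE x in density L (\<lambda>x. ennreal (f x)). x \<in> cube"
        unfolding AE_density[OF measurable_compose[OF fm measurable_ennreal]] using L(3) by eventually_elim simp
      have "AE x in L. 0 \<le> f x" using L(3) f(2) by auto
      then show "integral\<^sup>L (density L (\<lambda>x. ennreal (f x))) (monom_fun \<alpha>) = (LINT x|L. monom_fun \<alpha> x * f x)"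
        using fm bm[OF measurable_monom_fun L(2)] by (subst integral_density) (auto simp: mult.commute)
    qed
    have cj: "continuous_on UNIV (\<lambda>x :: 'd \<Rightarrow> real. 1 - x j)" by (intro continuous_intros continuous_on_coordinate)
    have pj: "0 \<le> 1 - x j" if "x \<in> cube" for x :: "'d \<Rightarrow> real" using that by (simp add: cube_def)
    show "finite_measure (density (m j) (\<lambda>x. ennreal (corner_distance x)))"
      "AE x in density (m j) (\<lambda>x. ennreal (corner_distance x)). x \<in> cube"
      by (rule fin[OF m continuous_corner_distance corner_distance_nonneg]
          ae[OF m continuous_corner_distance corner_distance_nonneg], assumption?)+
    show "finite_measure (density \<mu> (\<lambda>x. ennreal (1 - x j)))" "AE x in density \<mu> (\<lambda>x. ennreal (1 - x j)). x \<in> cube"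
      by (rule fin[OF \<mu> cj], rule pj, assumption) (rule ae[OF \<mu> cj], rule pj, assumption)
    fix \<alpha>
    have im: "integrable \<mu> (monom_fun \<beta>)" "integrable (m i) (monom_fun \<beta>)" for \<beta> i
      by (rule integrable_cube_continuous[OF \<mu> continuous_monom_fun] integrable_cube_continuous[OF m continuous_monom_fun])+
    have ml: "monom_fun \<alpha> x * (1 - x i) = monom_fun \<alpha> x - monom_fun (\<lambda>k. \<alpha> k + unit_index i k) x"
      for x :: "'d \<Rightarrow> real" and i by (simp add: monom_fun_add_unit algebra_simps)
    have "(LINT x|m j. monom_fun \<alpha> x * corner_distance x) = (\<Sum>i\<in>UNIV. \<psi> j \<alpha> - \<psi> j (\<lambda>k. \<alpha> k + unit_index i k))"
      unfolding corner_distance_def sum_distrib_left ml by (simp add: im mom)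
    also have "\<dots> = (\<Sum>i\<in>UNIV. \<psi> i \<alpha> - \<psi> i (\<lambda>k. \<alpha> k + unit_index j k))"
      by (rule sum.cong[OF refl]) (simp add: \<psi>_def add.assoc add.commute[of "unit_index j _"])
    also have "\<dots> = (LINT x|\<mu>. monom_fun \<alpha> x * (1 - x j))"
      unfolding ml by (simp add: im mom\<mu> sum_subtractf)
    finally show "integral\<^sup>L (density (m j) (\<lambda>x. ennreal (corner_distance x))) (monom_fun \<alpha>) =
        integral\<^sup>L (density \<mu> (\<lambda>x. ennreal (1 - x j))) (monom_fun \<alpha>)"
      using dint[OF m continuous_corner_distance corner_distance_nonneg, of j \<alpha>] dint[OF \<mu> cj, of \<alpha>] pj by simp
  qed (simp_all add: m \<mu>)
  define \<nu> where "\<nu> = density (restrict_space \<mu> punctured_cube) (\<lambda>x. ennreal (1 / corner_distance x))"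
  \<comment> \<open>The corner is lost to \<nu>, but every monomial equals 1 there: its mass under
    \<open>m j\<close> contributes the same constant to each first difference in direction j, hence
    a linear term.\<close>
  define b where "b j = measure (m j) {\<lambda>_. 1}" for j
  have pc: "punctured_cube \<in> sets \<mu>" by (simp add: \<mu>(2))
  have sets\<nu>: "sets \<nu> = sets (restrict_space borel punctured_cube)"
    by (simp add: \<nu>_def sets_restrict_space \<mu>(2))
  have first_diff: "has_bochner_integral \<nu> (\<lambda>x. monom_fun \<alpha> x * (1 - x j)) (\<psi> j \<alpha> - b j)" for j \<alpha>
  proof -
    interpret mj: finite_measure "m j" by (rule m)
    \<comment> \<open>Everything but the factor 1 - x_j. In this shape \<open>key\<close> trades
      \<mu> weighted by 1 - x_j for \<open>m j\<close> weighted by \<open>corner_distance\<close>,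
      which cancels the density of \<nu>.\<close>
    define I where "I x = indicator punctured_cube x * ennreal (monom_fun \<alpha> x) * ennreal (1 / corner_distance x)" for x
    have Im: "I \<in> borel_measurable borel" unfolding I_def by measurable
    have cdm: "(\<lambda>x. ennreal (corner_distance x)) \<in> borel_measurable borel"
      "(\<lambda>x :: 'd \<Rightarrow> real. ennreal (1 - x j)) \<in> borel_measurable borel" by measurable
    have ge: "0 \<le> monom_fun \<alpha> x * (1 - x j)" if "x \<in> punctured_cube" for x
      using that monom_fun_cube[of x \<alpha>] by (auto simp: punctured_cube_eq cube_def)
    have "(\<integral>\<^sup>+x. ennreal (monom_fun \<alpha> x * (1 - x j)) \<partial>\<nu>) =
       (\<integral>\<^sup>+x. ennreal (1 / corner_distance x) * ennreal (monom_fun \<alpha> x * (1 - x j)) \<partial>restrict_space \<mu> punctured_cube)"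
      unfolding \<nu>_def
      by (rule nn_integral_density; rule measurable_restrict_space1; rule bm[OF _ \<mu>(2)]) measurable
    also have "\<dots> = (\<integral>\<^sup>+x. ennreal (1 / corner_distance x) * ennreal (monom_fun \<alpha> x * (1 - x j)) * indicator punctured_cube x \<partial>\<mu>)"
      by (rule nn_integral_restrict_space) (simp add: pc)
    also have "\<dots> = (\<integral>\<^sup>+x. ennreal (1 - x j) * I x \<partial>\<mu>)"
    proof (rule nn_integral_cong)
      fix x
      show "ennreal (1 / corner_distance x) * ennreal (monom_fun \<alpha> x * (1 - x j)) * indicator punctured_cube x =
          ennreal (1 - x j) * I x"
        using monom_fun_cube(1)[of x \<alpha>]
        by (auto simp: I_def punctured_cube_eq cube_def ennreal_mult mult_ac split: split_indicator)
    qed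
    also have "\<dots> = (\<integral>\<^sup>+x. I x \<partial>density \<mu> (\<lambda>x. ennreal (1 - x j)))"
      by (rule nn_integral_density[symmetric]) (rule bm[OF _ \<mu>(2)], rule cdm Im)+
    also have "\<dots> = (\<integral>\<^sup>+x. ennreal (corner_distance x) * I x \<partial>m j)"
      unfolding key[symmetric] by (rule nn_integral_density) (rule bm[OF _ m(2)], rule cdm Im)+
    \<comment> \<open>Off the corner the weights cancel and leave the monomial; at the corner
      \<open>I\<close> vanishes and the indicator removes the value 1.\<close>
    also have "\<dots> = (\<integral>\<^sup>+x. ennreal (monom_fun \<alpha> x - indicator {\<lambda>_. 1} x) \<partial>m j)"
    proof (rule nn_integral_cong_AE, use m(3)[of j] in eventually_elim)
      case (elim x)
      show ?case
      proof (cases "x = (\<lambda>_. 1)")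
        case True
        then show ?thesis by (simp add: I_def punctured_cube_eq monom_fun_def)
      next
        case False
        with elim have "x \<in> punctured_cube" by (simp add: punctured_cube_eq)
        with corner_distance_pos[OF this] False monom_fun_cube(1)[OF elim, of \<alpha>] show ?thesis
          by (simp add: I_def ennreal_mult[symmetric])
      qed
    qed
    finally have nn: "(\<integral>\<^sup>+x. ennreal (monom_fun \<alpha> x * (1 - x j)) \<partial>\<nu>) =
        (\<integral>\<^sup>+x. ennreal (monom_fun \<alpha> x - indicator {\<lambda>_. 1} x) \<partial>m j)" .
    have val: "(\<integral>\<^sup>+x. ennreal (monom_fun \<alpha> x - indicator {\<lambda>_. 1} x) \<partial>m j) = ennreal (\<psi> j \<alpha> - b j)"
      and le: "b j \<le> \<psi> j \<alpha>"
    proof -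
      have sing: "{\<lambda>_. 1} \<in> sets (m j)" by (simp add: m(2) borel_closed)
      have i1: "integrable (m j) (monom_fun \<alpha>)"
        by (rule integrable_cube_continuous[OF m continuous_monom_fun])
      have i2: "integrable (m j) (indicator {\<lambda>_. 1} :: _ \<Rightarrow> real)"
        by (intro integrable_real_indicator sing) (simp add: mj.emeasure_eq_measure)
      have ae: "AE x in m j. 0 \<le> monom_fun \<alpha> x - indicator {\<lambda>_. 1} x"
        using m(3)[of j]
      proof eventually_elim
        case (elim x)
        then show ?case using monom_fun_cube(1)[OF elim, of \<alpha>]
          by (cases "x = (\<lambda>_. 1)") (auto simp: monom_fun_def)
      qed
      have val: "(LINT x|m j. monom_fun \<alpha> x - indicator {\<lambda>_. 1} x) = \<psi> j \<alpha> - b j"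
        using i1 i2 sing by (simp add: mom b_def)
      show "b j \<le> \<psi> j \<alpha>" using integral_nonneg_AE[OF ae] by (simp only: val)
      show "(\<integral>\<^sup>+x. ennreal (monom_fun \<alpha> x - indicator {\<lambda>_. 1} x) \<partial>m j) = ennreal (\<psi> j \<alpha> - b j)"
        unfolding val[symmetric] using i1 i2 ae by (intro nn_integral_eq_integral) auto
    qed
    show ?thesis
      using nn[unfolded val] ge le by (intro has_bochner_integral_nn_integral) (auto simp: space_eq_punctured_cube[OF sets\<nu>]
          intro!: measurable_punctured_cube[OF sets\<nu>])
  qed
  have "levy_representation \<phi> \<nu> b"
    unfolding levy_representation_def
  proof (intro conjI allI sets\<nu>)
    show "0 \<le> b i" for i by (simp add: b_def)
    fix \<alpha>
    have "has_bochner_integral \<nu> (\<lambda>x. 1 - monom_fun \<alpha> x) (\<phi> \<alpha> - \<phi> (\<lambda>_. 0) - (\<Sum>i\<in>UNIV. real (\<alpha> i) * b i))"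
    \<comment> \<open>First differences are added along unit steps from 0 to \<alpha>, each step in
      direction j contributing one b j.\<close>
    proof (induction \<alpha> rule: multi_index_induct)
      case zero
      show ?case by (simp add: has_bochner_integral_zero)
    next
      case (add_unit \<alpha> j)
      have "has_bochner_integral \<nu> (\<lambda>x. (1 - monom_fun \<alpha> x) + monom_fun \<alpha> x * (1 - x j))
         ((\<phi> \<alpha> - \<phi> (\<lambda>_. 0) - (\<Sum>i\<in>UNIV. real (\<alpha> i) * b i)) + (\<psi> j \<alpha> - b j))"
        by (rule has_bochner_integral_add[OF add_unit first_diff])
      moreover have "(1 - monom_fun \<alpha> x) + monom_fun \<alpha> x * (1 - x j) =
          1 - monom_fun (\<lambda>i. \<alpha> i + unit_index j i) x" for x
        unfolding monom_fun_add_unit by (simp add: algebra_simps)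
      moreover have "(\<phi> \<alpha> - \<phi> (\<lambda>_. 0) - (\<Sum>i\<in>UNIV. real (\<alpha> i) * b i)) + (\<psi> j \<alpha> - b j) =
          \<phi> (\<lambda>i. \<alpha> i + unit_index j i) - \<phi> (\<lambda>_. 0) - (\<Sum>i\<in>UNIV. real (\<alpha> i + unit_index j i) * b i)"
        unfolding sum_add_unit_index \<psi>_def by simp
      ultimately show ?case by (simp only:)
    qed
    then show "integrable \<nu> (\<lambda>x. 1 - monom_fun \<alpha> x)"
      "\<phi> \<alpha> = \<phi> (\<lambda>_. 0) + (\<Sum>i\<in>UNIV. real (\<alpha> i) * b i) + (LINT x|\<nu>. 1 - monom_fun \<alpha> x)"
      unfolding has_bochner_integral_iff by linarith+
  qed
  then show thesis by (rule that)
qed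

section \<open>Levy measures of operator tuples\<close>

text \<open>The operator inequality holds for the quadratic form at every vector; inserting
  \<open>tuple_power T \<gamma> h\<close> moves the base point of the difference to
  \<gamma>.\<close>

lemma completely_hyperexpansive_nabla_le_0:
  fixes T :: "'d::{finite,linorder} \<Rightarrow> 'h::chilbert_space \<Rightarrow> 'h"
  assumes T: "completely_hyperexpansive T" and "\<alpha> \<noteq> (\<lambda>_. 0)"
  shows "nabla \<alpha> (\<lambda>\<beta>. (norm (tuple_power T \<beta> h))\<^sup>2) \<gamma> \<le> 0"
proof -
  have c: "commuting_tuple T" using T by (simp add: completely_hyperexpansive_def)
  then have comm: "T i \<circ> T j = T j \<circ> T i" for i j by (simp add: commuting_tuple_def)
  define g where "g = tuple_power T \<gamma> h"
  have coeff: "(-1) ^ (\<Sum>i\<in>UNIV. \<beta> i) * real (\<Prod>i\<in>UNIV. \<alpha> i choose \<beta> i) = signed_binomial \<alpha> \<beta>" for \<beta>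
    by (simp add: signed_binomial_def power_sum prod.distrib)
  have "nonpositive_operator (\<lambda>h. \<Sum>\<beta>\<in>{..\<alpha>}. signed_binomial \<alpha> \<beta> *\<^sub>R
      tuple_power (\<lambda>i. cadjoint (T i)) \<beta> (tuple_power T \<beta> h))"
    using T assms(2) unfolding completely_hyperexpansive_def coeff[symmetric] by blast
  then have "(\<Sum>\<beta>\<in>{..\<alpha>}. signed_binomial \<alpha> \<beta> *\<^sub>R
      tuple_power (\<lambda>i. cadjoint (T i)) \<beta> (tuple_power T \<beta> g)) \<bullet> g \<le> 0"
    unfolding nonpositive_operator_def Re_cinner by blast
  then show ?thesis
    by (simp add: inner_sum_left tuple_power_cadjoint_inner[OF c] nabla_def tuple_power_add[OF comm]
        g_def power2_norm_eq_inner)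
qed

text \<open>An additive map on multi-indices is fixed by its values at the unit indices and vanishes
  at 0, which supplies the case \<alpha> = 0. Conversely, integrability of the corner distance gives
  the Radon property.\<close>

lemma is_levy_measure_iff:
  fixes T :: "'d::{finite,linorder} \<Rightarrow> 'h::chilbert_space \<Rightarrow> 'h"
  shows "is_levy_measure T h \<nu> \<longleftrightarrow> (\<exists>b. levy_representation (\<lambda>\<alpha>. (norm (tuple_power T \<alpha> h))\<^sup>2) \<nu> b)"
proof
  assume "is_levy_measure T h \<nu>"
  then obtain B where rad: "radon_measure_on punctured_cube \<nu>"
    and nonneg: "\<And>\<alpha>. 0 \<le> B \<alpha>" and add: "\<And>\<alpha> \<beta>. B (\<lambda>i. \<alpha> i + \<beta> i) = B \<alpha> + B \<beta>"
    and rep: "\<And>\<alpha>. \<alpha> \<noteq> (\<lambda>_. 0) \<Longrightarrow> integrable \<nu> (\<lambda>x. 1 - monom_fun \<alpha> x) \<and>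
      (norm (tuple_power T \<alpha> h))\<^sup>2 = (norm h)\<^sup>2 + B \<alpha> + (LINT x|\<nu>. 1 - monom_fun \<alpha> x)"
    unfolding is_levy_measure_def monom_fun_def by blast
  have B0: "B (\<lambda>_. 0) = 0" using add[of "\<lambda>_. 0" "\<lambda>_. 0"] by simp
  have B: "B \<alpha> = (\<Sum>i\<in>UNIV. real (\<alpha> i) * B (unit_index i))" for \<alpha>
  proof (induction \<alpha> rule: multi_index_induct)
    case (add_unit \<alpha> j)
    have "(\<Sum>i\<in>UNIV. real (\<alpha> i + unit_index j i) * B (unit_index i)) =
        (\<Sum>i\<in>UNIV. real (\<alpha> i) * B (unit_index i)) + B (unit_index j)"
      by (rule sum_add_unit_index)
    then show ?case by (simp add: add add_unit)
  qed (simp add: B0)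
  have "integrable \<nu> (\<lambda>x. 1 - monom_fun \<alpha> x) \<and>
      (norm (tuple_power T \<alpha> h))\<^sup>2 = (norm h)\<^sup>2 + B \<alpha> + (LINT x|\<nu>. 1 - monom_fun \<alpha> x)" for \<alpha>
    by (cases "\<alpha> = (\<lambda>_. 0)") (use rep in \<open>auto simp: B0\<close>)
  then have "levy_representation (\<lambda>\<alpha>. (norm (tuple_power T \<alpha> h))\<^sup>2) \<nu> (\<lambda>i. B (unit_index i))"
    unfolding levy_representation_def using rad nonneg by (simp add: radon_measure_on_def B[symmetric])
  then show "\<exists>b. levy_representation (\<lambda>\<alpha>. (norm (tuple_power T \<alpha> h))\<^sup>2) \<nu> b"
    by (rule exI[where x = "\<lambda>i. B (unit_index i)"])
next
  assume "\<exists>b. levy_representation (\<lambda>\<alpha>. (norm (tuple_power T \<alpha> h))\<^sup>2) \<nu> b"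
  then obtain b where b: "levy_representation (\<lambda>\<alpha>. (norm (tuple_power T \<alpha> h))\<^sup>2) \<nu> b" ..
  have "radon_measure_on punctured_cube \<nu>"
    by (rule radon_measure_on_punctured_cube[OF _ levy_representation_corner_distance[OF b]])
      (use b in \<open>unfold levy_representation_def, blast\<close>)
  moreover have "0 \<le> (\<Sum>i\<in>UNIV. real (\<alpha> i) * b i)" for \<alpha>
    using b unfolding levy_representation_def by (intro sum_nonneg mult_nonneg_nonneg) auto
  moreover have "(\<Sum>i\<in>UNIV. real (\<alpha> i + \<beta> i) * b i) = (\<Sum>i\<in>UNIV. real (\<alpha> i) * b i) + (\<Sum>i\<in>UNIV. real (\<beta> i) * b i)" for \<alpha> \<beta>
    by (simp add: distrib_right sum.distrib)
  moreover have "integrable \<nu> (\<lambda>x. 1 - monom_fun \<alpha> x)"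
    "(norm (tuple_power T \<alpha> h))\<^sup>2 = (norm h)\<^sup>2 + (\<Sum>i\<in>UNIV. real (\<alpha> i) * b i) + (LINT x|\<nu>. 1 - monom_fun \<alpha> x)" for \<alpha>
    using b unfolding levy_representation_def tuple_power_0 by blast+
  ultimately show "is_levy_measure T h \<nu>"
    unfolding is_levy_measure_def monom_fun_def[symmetric]
    by (intro conjI exI[of _ "\<lambda>\<alpha>. \<Sum>i\<in>UNIV. real (\<alpha> i) * b i"] allI impI)
qed

text \<open>Evaluates the definite description: any representation found by whatever means is the
  Levy measure, by uniqueness.\<close>

lemma levy_measure_representation:
  fixes T :: "'d::{finite,linorder} \<Rightarrow> 'h::chilbert_space \<Rightarrow> 'h"
  assumes "levy_representation (\<lambda>\<alpha>. (norm (tuple_power T \<alpha> h))\<^sup>2) \<nu> b"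
  shows "levy_measure T h = \<nu>"
  unfolding levy_measure_def is_levy_measure_iff
  by (rule the_equality) (use assms levy_representation_unique in blast)+

section \<open>Marginals and coordinate edges\<close>

text \<open>On the i-th axis the integrand depends on x_i alone, so \<nu> is pushed forward under
  that coordinate. Points with x_i = 1 would land on the removed corner; they are dropped without
  loss, because 1 - x_i^n vanishes there.\<close>

lemma marginal_levy_representation:
  fixes \<phi> :: "('d::finite \<Rightarrow> nat) \<Rightarrow> real"
  assumes rep: "levy_representation \<phi> \<nu> b"
  obtains \<nu>' b' where "levy_representation (\<lambda>\<alpha> :: unit \<Rightarrow> nat. \<phi> (\<lambda>j. if j = i then \<alpha> () else 0)) \<nu>' b'"
proof -
  have sets: "sets \<nu> = sets (restrict_space borel punctured_cube)"
    and int: "integrable \<nu> (\<lambda>x. 1 - monom_fun \<alpha> x)"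
    and val: "\<phi> \<alpha> = \<phi> (\<lambda>_. 0) + (\<Sum>i\<in>UNIV. real (\<alpha> i) * b i) + (LINT x|\<nu>. 1 - monom_fun \<alpha> x)" for \<alpha>
    using rep unfolding levy_representation_def by blast+
  have b: "0 \<le> b i" for i using rep unfolding levy_representation_def by blast
  have sp: "space \<nu> = punctured_cube" by (rule space_eq_punctured_cube[OF sets])
  define R where "R = restrict_space \<nu> {x. x i \<noteq> 1}"
  define e where "e = (\<lambda>(x :: 'd \<Rightarrow> real) (_::unit). x i)"
  define \<nu>' where "\<nu>' = distr R (restrict_space borel punctured_cube) e"
  have E: "{x. x i \<noteq> 1} \<inter> space \<nu> \<in> sets \<nu>"
  proof -
    have "{x \<in> space \<nu>. x i \<noteq> 1} \<in> sets \<nu>"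
      using measurable_punctured_cube[OF sets measurable_coordinate[of i]] by measurable
    also have "{x \<in> space \<nu>. x i \<noteq> 1} = {x. x i \<noteq> 1} \<inter> space \<nu>" by auto
    finally show ?thesis .
  qed
  have e: "e \<in> measurable R (restrict_space borel punctured_cube)"
  proof (rule measurable_restrict_space2)
    show "e \<in> space R \<rightarrow> punctured_cube"
      by (auto simp: R_def space_restrict_space sp e_def punctured_cube_def fun_eq_iff)
    have "e \<in> borel_measurable \<nu>"
      unfolding e_def by (intro measurable_borel_fun measurable_punctured_cube[OF sets measurable_coordinate])
    then show "e \<in> borel_measurable R" unfolding R_def by (rule measurable_restrict_space1)
  qed
  have mon: "monom_fun (\<lambda>j. if j = i then n else 0) x = x i ^ n" for x :: "'d \<Rightarrow> real" and n
  proof -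
    have "(\<Prod>j\<in>UNIV. x j ^ (if j = i then n else 0)) = (\<Prod>j\<in>UNIV. if j = i then x i ^ n else 1)"
      by (rule prod.cong) auto
    then show ?thesis by (simp add: monom_fun_def)
  qed
  have hb: "has_bochner_integral \<nu>' (\<lambda>x. 1 - monom_fun \<alpha> x)
      (LINT x|\<nu>. 1 - monom_fun (\<lambda>j. if j = i then \<alpha> () else 0) x)" for \<alpha>
  proof -
    have m: "(\<lambda>x. 1 - monom_fun \<alpha> x) \<in> borel_measurable (restrict_space borel punctured_cube)"
      by (rule measurable_restrict_space1) measurable
    have "integrable \<nu>' (\<lambda>x. 1 - monom_fun \<alpha> x) \<and>
        (LINT x|\<nu>'. 1 - monom_fun \<alpha> x) = (LINT x|R. 1 - monom_fun \<alpha> (e x))"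
      if "integrable R (\<lambda>x. 1 - monom_fun \<alpha> (e x))"
      unfolding \<nu>'_def using that by (simp add: integrable_distr_eq[OF e m] integral_distr[OF e m])
    moreover have eq: "indicator {x. x i \<noteq> 1} x *\<^sub>R (1 - monom_fun \<alpha> (e x)) =
        1 - monom_fun (\<lambda>j. if j = i then \<alpha> () else 0) x" for x :: "'d \<Rightarrow> real"
      unfolding mon by (auto simp: monom_fun_def e_def UNIV_unit split: split_indicator)
    moreover have "integrable R (\<lambda>x. 1 - monom_fun \<alpha> (e x))"
      unfolding R_def by (subst integrable_restrict_space[OF E]) (simp only: eq int)
    moreover have "(LINT x|R. 1 - monom_fun \<alpha> (e x)) = (LINT x|\<nu>. 1 - monom_fun (\<lambda>j. if j = i then \<alpha> () else 0) x)"
      unfolding R_def by (subst integral_restrict_space[OF E]) (simp only: eq)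
    ultimately show ?thesis by (simp add: has_bochner_integral_iff)
  qed
  have "levy_representation (\<lambda>\<alpha> :: unit \<Rightarrow> nat. \<phi> (\<lambda>j. if j = i then \<alpha> () else 0)) \<nu>' (\<lambda>_. b i)"
    unfolding levy_representation_def
  proof (intro conjI allI b)
    show "sets \<nu>' = sets (restrict_space borel punctured_cube)" by (simp add: \<nu>'_def)
    fix \<alpha> :: "unit \<Rightarrow> nat"
    show "integrable \<nu>' (\<lambda>x. 1 - monom_fun \<alpha> x)" using hb[of \<alpha>] by (simp add: has_bochner_integral_iff)
    have "(\<Sum>j\<in>UNIV. real (if j = i then \<alpha> () else 0) * b j) = (\<Sum>j\<in>UNIV. if j = i then real (\<alpha> ()) * b i else 0)"
      by (rule sum.cong) auto
    then have s: "(\<Sum>j\<in>UNIV. real (if j = i then \<alpha> () else 0) * b j) = (\<Sum>u\<in>UNIV. real (\<alpha> u) * b i)"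
      by (simp add: UNIV_unit)
    have v: "(LINT x|\<nu>'. 1 - monom_fun \<alpha> x) = (LINT x|\<nu>. 1 - monom_fun (\<lambda>j. if j = i then \<alpha> () else 0) x)"
      using hb[of \<alpha>] by (simp add: has_bochner_integral_iff)
    show "\<phi> (\<lambda>j. if j = i then \<alpha> () else 0) = \<phi> (\<lambda>j. if j = i then 0 else 0) +
        (\<Sum>u\<in>UNIV. real (\<alpha> u) * b i) + (LINT x|\<nu>'. 1 - monom_fun \<alpha> x)"
      unfolding v s[symmetric] if_cancel by (rule val)
  qed
  then show thesis by (rule that)
qed

lemma punctured_cube_unit_less_1: "x \<in> punctured_cube \<Longrightarrow> x () < (1::real)"
  using corner_distance_pos[of x] by (simp add: corner_distance_def UNIV_unit)

lemma measurable_unit_coordinate: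
  assumes "sets \<nu> = sets (restrict_space borel punctured_cube)"
  shows "(\<lambda>x. x ()) \<in> measurable \<nu> (restrict_space borel {0..<1::real})"
proof (rule measurable_restrict_space2)
  show "(\<lambda>x. x ()) \<in> borel_measurable \<nu>"
    by (rule measurable_punctured_cube[OF assms measurable_coordinate])
  show "(\<lambda>x. x ()) \<in> space \<nu> \<rightarrow> {0..<1}"
    using punctured_cube_unit_less_1 by (auto simp: space_eq_punctured_cube[OF assms] punctured_cube_def)
qed

text \<open>Parametrizes the i-th edge at the corner (1,...,1). The argument is a function on the
  one-element type because the Levy measure of a single operator lives on such functions.\<close>

definition axis_embedding :: "'d \<Rightarrow> (unit \<Rightarrow> real) \<Rightarrow> 'd \<Rightarrow> real" where
  "axis_embedding i x = (\<lambda>j. if j = i then x () else 1)"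

lemma axis_embedding_in_punctured_cube:
  "x \<in> punctured_cube \<Longrightarrow> axis_embedding i x \<in> punctured_cube"
  by (auto simp: punctured_cube_def axis_embedding_def fun_eq_iff)

lemma measurable_axis_embedding:
  "axis_embedding (i :: 'd::finite) \<in> measurable (restrict_space borel punctured_cube) (restrict_space borel punctured_cube)"
proof (rule measurable_restrict_space2)
  have "(\<lambda>x. axis_embedding i x j) \<in> borel_measurable (borel :: (unit \<Rightarrow> real) measure)" for j
    unfolding axis_embedding_def by measurable
  then have "axis_embedding i \<in> borel_measurable (borel :: (unit \<Rightarrow> real) measure)"
    by (rule measurable_borel_fun)
  then show "axis_embedding i \<in> borel_measurable (restrict_space borel punctured_cube)"
    by (rule measurable_restrict_space1)
qed (use axis_embedding_in_punctured_cube in \<open>auto simp: space_restrict_space\<close>)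

text \<open>The product measure calls for sigma-finite factors, while this one may be infinite near
  1. The intervals [0, 1 - 1/(n+1)] have finite mass, as 1 - x is integrable and at least 1/(n+1) on
  them.\<close>

lemma sigma_finite_levy_measure1:
  assumes sets: "sets (levy_measure (\<lambda>_::unit. A) h) = sets (restrict_space borel punctured_cube)"
    and int: "integrable (levy_measure (\<lambda>_::unit. A) h) corner_distance"
  shows "sigma_finite_measure (levy_measure1 A h)"
proof
  define \<nu> where "\<nu> = levy_measure (\<lambda>_::unit. A) h"
  have sp: "space \<nu> = punctured_cube" unfolding \<nu>_def by (rule space_eq_punctured_cube[OF sets])
  have coord: "(\<lambda>x. x ()) \<in> measurable \<nu> (restrict_space borel {0..<1})"
    unfolding \<nu>_def by (rule measurable_unit_coordinate[OF sets])
  define E where "E n = {0..1 - 1 / real (Suc n)}" for n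
  have Esub: "E n \<subseteq> {0..<1}" for n
  proof -
    have "1 - 1 / real (Suc n) < 1" by simp
    then show ?thesis unfolding E_def by (meson atLeastAtMost_iff atLeastLessThan_iff le_less_trans subsetI)
  qed
  then have E: "E n \<in> sets (restrict_space borel {0..<1})" for n
    by (subst sets_restrict_space_iff) (auto simp: E_def)
  have fin: "emeasure (levy_measure1 A h) (E n) \<noteq> \<infinity>" for n
  proof -
    define F where "F = (\<lambda>x :: unit \<Rightarrow> real. x ()) -` E n \<inter> space \<nu>"
    have F: "F \<in> sets \<nu>" unfolding F_def by (rule measurable_sets[OF coord E])
    have "emeasure (levy_measure1 A h) (E n) = emeasure \<nu> F"
      unfolding levy_measure1_def \<nu>_def[symmetric] F_def by (rule emeasure_distr[OF coord E])
    moreover have "ennreal (1 / real (Suc n)) * emeasure \<nu> F = (\<integral>\<^sup>+x. ennreal (1 / real (Suc n)) * indicator F x \<partial>\<nu>)"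
      using F by (simp add: nn_integral_cmult_indicator)
    moreover have "\<dots> \<le> (\<integral>\<^sup>+x. ennreal (norm (corner_distance x)) \<partial>\<nu>)"
      by (rule nn_integral_mono)
        (auto simp: F_def E_def corner_distance_def UNIV_unit split: split_indicator intro!: ennreal_leI)
    moreover have "\<dots> < \<infinity>" using int unfolding \<nu>_def by (simp add: integrable_iff_bounded)
    ultimately have "ennreal (1 / real (Suc n)) * emeasure (levy_measure1 A h) (E n) < \<infinity>"
      by (metis le_less_trans)
    then show ?thesis by (auto simp: ennreal_mult_less_top)
  qed
  have Un: "(\<Union>n. E n) = {0..<1}"
  proof
    show "(\<Union>n. E n) \<subseteq> {0..<1}" using Esub by blast
    show "{0..<1} \<subseteq> (\<Union>n. E n)"
    proof
      fix t :: real assume t: "t \<in> {0..<1}"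
      then obtain n where "1 / real (Suc n) < 1 - t" using nat_approx_posE[of "1 - t"] by auto
      with t have "t \<in> E n" by (simp add: E_def)
      then show "t \<in> (\<Union>n. E n)" by blast
    qed
  qed
  show "\<exists>A'. countable A' \<and> A' \<subseteq> sets (levy_measure1 A h) \<and> \<Union> A' = space (levy_measure1 A h) \<and>
      (\<forall>a\<in>A'. emeasure (levy_measure1 A h) a \<noteq> \<infinity>)"
  proof (intro exI[of _ "range E"] conjI)
    show "range E \<subseteq> sets (levy_measure1 A h)" using E by (auto simp: levy_measure1_def)
    show "\<Union> (range E) = space (levy_measure1 A h)" by (simp add: Un levy_measure1_def space_restrict_space)
    show "\<forall>a\<in>range E. emeasure (levy_measure1 A h) a \<noteq> \<infinity>" using fin by blast
  qed simp
qed

text \<open>All other factors are point masses at 1, so the product is the image of its i-th factor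
  under the edge embedding; extension by zero then only changes the ambient space.\<close>

lemma zero_extension_levy_factor_product:
  fixes T :: "'d::{finite,linorder} \<Rightarrow> 'h::chilbert_space \<Rightarrow> 'h"
  assumes sets: "sets (levy_measure (\<lambda>_::unit. T i) h) = sets (restrict_space borel punctured_cube)"
    and int: "integrable (levy_measure (\<lambda>_::unit. T i) h) corner_distance"
  shows "zero_extension (restrict_space borel punctured_cube) (levy_factor_product T h i) =
    distr (levy_measure (\<lambda>_::unit. T i) h) (restrict_space borel punctured_cube) (axis_embedding i)"
proof -
  define \<nu> where "\<nu> = levy_measure (\<lambda>_::unit. T i) h"
  define M where "M j = (if j = i then levy_measure1 (T i) h else return (restrict_space borel {0..1}) 1)" for j
  have sp: "space \<nu> = punctured_cube" unfolding \<nu>_def by (rule space_eq_punctured_cube[OF sets])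
  have coord: "(\<lambda>x. x ()) \<in> measurable \<nu> (restrict_space borel {0..<1})"
    unfolding \<nu>_def by (rule measurable_unit_coordinate[OF sets])
  have one: "(1::real) \<in> space (restrict_space borel {0..1})" by (simp add: space_restrict_space)
  have setsM: "sets (M j) = (if j = i then sets (restrict_space borel {0..<1}) else sets (restrict_space borel {0..1}))" for j
    by (simp add: M_def levy_measure1_def)
  have spM: "space (M j) = (if j = i then {0..<1} else {0..1})" for j
    by (simp add: M_def levy_measure1_def space_restrict_space)
  have emb: "axis_embedding i \<in> measurable \<nu> (PiM UNIV M)"
    unfolding axis_embedding_def
  proof (rule measurable_PiM_single')
    fix j
    show "(\<lambda>x. if j = i then x () else 1) \<in> measurable \<nu> (M j)"
    proof (cases "j = i")
      case True
      have "measurable \<nu> (M i) = measurable \<nu> (restrict_space borel {0..<1})"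
        by (rule measurable_cong_sets) (simp_all add: setsM)
      then show ?thesis using coord True by simp
    next
      case False
      then show ?thesis using one by (simp add: M_def)
    qed
  next
    show "(\<lambda>x j. if j = i then x () else 1) \<in> space \<nu> \<rightarrow> (\<Pi>\<^sub>E j\<in>UNIV. space (M j))"
      using punctured_cube_unit_less_1 by (auto simp: spM sp punctured_cube_def)
  qed
  interpret product_sigma_finite M
  proof (rule product_sigma_finite.intro)
    fix j
    show "sigma_finite_measure (M j)"
    proof (cases "j = i")
      case True
      then show ?thesis using sigma_finite_levy_measure1[OF sets int] by (simp add: M_def)
    next
      case False
      interpret prob_space "return (restrict_space borel {0..1}) (1::real)" by (rule prob_space_return[OF one])
      show ?thesis using False by (simp add: M_def sigma_finite_measure_axioms)
    qed
  qed
  \<comment> \<open>A finite product of sigma-finite measures is determined by its values on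
    boxes.\<close>
  have prod: "distr \<nu> (PiM UNIV M) (axis_embedding i) = PiM UNIV M"
  proof (rule PiM_eqI)
    fix A assume A: "\<And>j. j \<in> UNIV \<Longrightarrow> A j \<in> sets (M j)"
    have "emeasure (distr \<nu> (PiM UNIV M) (axis_embedding i)) (PiE UNIV A) =
        emeasure \<nu> (axis_embedding i -` PiE UNIV A \<inter> space \<nu>)"
      using A by (intro emeasure_distr[OF emb] sets_PiM_I_finite) auto
    \<comment> \<open>The edge can meet the box only if 1 lies in every side other than the
      i-th.\<close>
    also have "axis_embedding i -` PiE UNIV A \<inter> space \<nu> =
        (if \<forall>j\<in>UNIV - {i}. 1 \<in> A j then (\<lambda>x. x ()) -` A i \<inter> space \<nu> else {})"
      by (auto simp: axis_embedding_def PiE_def Pi_def split: if_splits)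
    also have "emeasure \<nu> \<dots> = emeasure (M i) (A i) * (\<Prod>j\<in>UNIV - {i}. indicator (A j) 1)"
    proof -
      have "A i \<in> sets (restrict_space borel {0..<1})" using A[of i] by (simp add: setsM)
      then have "emeasure (M i) (A i) = emeasure \<nu> ((\<lambda>x. x ()) -` A i \<inter> space \<nu>)"
        by (simp add: M_def levy_measure1_def emeasure_distr[OF coord] flip: \<nu>_def)
      moreover have "(\<Prod>j\<in>UNIV - {i}. indicator (A j) (1::real)) = (if \<forall>j\<in>UNIV - {i}. 1 \<in> A j then 1 else 0 :: ennreal)"
      proof (cases "\<forall>j\<in>UNIV - {i}. 1 \<in> A j")
        case False
        then obtain j where "j \<in> UNIV - {i}" "1 \<notin> A j" by blast
        then have "(\<Prod>j\<in>UNIV - {i}. indicator (A j) (1::real)) = (0 :: ennreal)"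
          by (intro prod_zero finite bexI[of _ j]) (simp_all add: indicator_def)
        with False show ?thesis by simp
      qed simp
      ultimately show ?thesis by simp
    qed
    also have "\<dots> = emeasure (M i) (A i) * (\<Prod>j\<in>UNIV - {i}. emeasure (M j) (A j))"
    proof -
      have "emeasure (M j) (A j) = indicator (A j) 1" if "j \<noteq> i" for j
        using A[of j] that by (simp add: M_def setsM)
      then show ?thesis by simp
    qed
    also have "\<dots> = (\<Prod>j\<in>UNIV. emeasure (M j) (A j))"
      by (rule prod.remove[symmetric]) auto
    finally show "emeasure (distr \<nu> (PiM UNIV M) (axis_embedding i)) (PiE UNIV A) = (\<Prod>j\<in>UNIV. emeasure (M j) (A j))" .
  qed simp_all
  have incl: "(\<lambda>x. x) \<in> measurable (PiM UNIV M) (restrict_space borel punctured_cube)"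
  proof (rule measurable_restrict_space2)
    show "(\<lambda>x. x) \<in> space (PiM UNIV M) \<rightarrow> punctured_cube"
    proof
      fix x assume "x \<in> space (PiM UNIV M)"
      then have x: "x j \<in> space (M j)" for j by (auto simp: space_PiM)
      have "x i < 1" using x[of i] by (simp add: spM)
      then have "x \<noteq> (\<lambda>_. 1)" by auto
      moreover have "x j \<in> {0..1}" for j using x[of j] by (auto simp: spM split: if_splits)
      ultimately show "x \<in> punctured_cube" by (simp add: punctured_cube_def)
    qed
    show "(\<lambda>x. x) \<in> borel_measurable (PiM UNIV M)"
    proof (rule measurable_borel_fun)
      fix j
      have "(\<lambda>x. x) \<in> borel_measurable (M j)"
      proof -
        have "measurable (M j) borel = measurable (restrict_space borel (if j = i then {0..<1} else {0..1})) (borel :: real measure)"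
          by (rule measurable_cong_sets) (simp_all add: setsM)
        moreover have "(\<lambda>x. x) \<in> measurable (restrict_space borel (if j = i then {0..<1} else {0..1})) (borel :: real measure)"
          by (rule measurable_restrict_space1) simp
        ultimately show ?thesis by (simp only:)
      qed
      from measurable_compose[OF measurable_component_singleton[of j UNIV M] this]
      show "(\<lambda>x. x j) \<in> borel_measurable (PiM UNIV M)" by simp
    qed
  qed
  have "zero_extension (restrict_space borel punctured_cube) (levy_factor_product T h i) =
      distr (distr \<nu> (PiM UNIV M) (axis_embedding i)) (restrict_space borel punctured_cube) (\<lambda>x. x)"
    unfolding prod by (simp add: zero_extension_def levy_factor_product_def M_def[abs_def])
  also have "\<dots> = distr \<nu> (restrict_space borel punctured_cube) (axis_embedding i)"
    by (subst distr_distr[OF incl emb]) (simp add: comp_def)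
  finally show ?thesis by (simp add: \<nu>_def)
qed

section \<open>Finite sums of measures\<close>

lemma sets_sum_of_measures: "sets (sum_of_measures N I M) = sets N"
  by (simp add: sum_of_measures_def)

text \<open>\<open>measure_of\<close> falls back to the zero measure unless the set function is
  countably additive, which here is the exchange of a series with a finite sum.\<close>

lemma emeasure_sum_of_measures:
  fixes N :: "'a measure"
  assumes fin: "finite I" and sets: "\<And>i. i \<in> I \<Longrightarrow> sets (M i) = sets N" and A: "A \<in> sets N"
  shows "emeasure (sum_of_measures N I M) A = (\<Sum>i\<in>I. emeasure (M i) A)"
proof (rule emeasure_measure_of[OF sum_of_measures_def])
  show "sets N \<subseteq> Pow (space N)" by (rule sets.space_closed)
  show "A \<in> sets (sum_of_measures N I M)" using A by (simp add: sum_of_measures_def)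
  show "positive (sets (sum_of_measures N I M)) (\<lambda>A. \<Sum>i\<in>I. emeasure (M i) A)"
    by (simp add: positive_def)
  show "countably_additive (sets (sum_of_measures N I M)) (\<lambda>A. \<Sum>i\<in>I. emeasure (M i) A)"
  proof (rule countably_additiveI)
    fix F :: "nat \<Rightarrow> 'a set" assume F: "range F \<subseteq> sets (sum_of_measures N I M)" "disjoint_family F"
    then have "range F \<subseteq> sets (M i)" if "i \<in> I" for i using sets[OF that] by (simp add: sum_of_measures_def)
    then have "(\<Sum>n. emeasure (M i) (F n)) = emeasure (M i) (\<Union> (range F))" if "i \<in> I" for i
      using that F(2) by (intro suminf_emeasure) auto
    then show "(\<Sum>n. \<Sum>i\<in>I. emeasure (M i) (F n)) = (\<Sum>i\<in>I. emeasure (M i) (\<Union> (range F)))"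
      by (subst suminf_sum) auto
  qed
qed

lemma nn_integral_sum_of_measures:
  fixes N :: "'a measure"
  assumes fin: "finite I" and sets: "\<And>i. i \<in> I \<Longrightarrow> sets (M i) = sets N" and f: "f \<in> borel_measurable N"
  shows "(\<integral>\<^sup>+x. f x \<partial>sum_of_measures N I M) = (\<Sum>i\<in>I. \<integral>\<^sup>+x. f x \<partial>M i)"
proof -
  define S where "S = sum_of_measures N I M"
  have setsS: "sets S = sets N" by (simp add: S_def sum_of_measures_def)
  have m: "g \<in> borel_measurable L" if "g \<in> borel_measurable N" "sets L = sets N" for g :: "'a \<Rightarrow> ennreal" and L
    using that(1) by (subst measurable_cong_sets[OF that(2) refl])
  have "(\<integral>\<^sup>+x. f x \<partial>S) = (\<Sum>i\<in>I. \<integral>\<^sup>+x. f x \<partial>M i)"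
    using f
  proof (induction rule: borel_measurable_induct)
    case (cong f g)
    have "(\<integral>\<^sup>+x. f x \<partial>L) = (\<integral>\<^sup>+x. g x \<partial>L)" if "sets L = sets N" for L
      using cong(3) sets_eq_imp_space_eq[OF that] by (intro nn_integral_cong) auto
    note eq = this
    have "(\<Sum>i\<in>I. \<integral>\<^sup>+x. f x \<partial>M i) = (\<Sum>i\<in>I. \<integral>\<^sup>+x. g x \<partial>M i)" by (intro sum.cong refl eq sets)
    then show ?case using eq[OF setsS] cong(4) by (simp only:)
  next
    case (set A)
    have "(\<Sum>i\<in>I. \<integral>\<^sup>+x. indicator A x \<partial>M i) = (\<Sum>i\<in>I. emeasure (M i) A)"
      by (intro sum.cong refl nn_integral_indicator) (simp add: sets set)
    then show ?case using setsS set emeasure_sum_of_measures[OF fin sets set] by (simp add: S_def)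
  next
    case (mult u c)
    have eq: "(\<integral>\<^sup>+x. c * u x \<partial>L) = c * (\<integral>\<^sup>+x. u x \<partial>L)" if "sets L = sets N" for L
      by (rule nn_integral_cmult[OF m[OF mult(2) that]])
    have "(\<Sum>i\<in>I. \<integral>\<^sup>+x. c * u x \<partial>M i) = (\<Sum>i\<in>I. c * (\<integral>\<^sup>+x. u x \<partial>M i))"
      by (intro sum.cong refl eq sets)
    then show ?case using mult.IH eq[OF setsS] by (simp only: sum_distrib_left)
  next
    case (add u v)
    have eq: "(\<integral>\<^sup>+x. v x + u x \<partial>L) = (\<integral>\<^sup>+x. v x \<partial>L) + (\<integral>\<^sup>+x. u x \<partial>L)" if "sets L = sets N" for L
      by (rule nn_integral_add; rule m[OF _ that]; rule add)
    have "(\<Sum>i\<in>I. \<integral>\<^sup>+x. v x + u x \<partial>M i) = (\<Sum>i\<in>I. (\<integral>\<^sup>+x. v x \<partial>M i) + (\<integral>\<^sup>+x. u x \<partial>M i))"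
      by (intro sum.cong refl eq sets)
    then show ?case using add.IH eq[OF setsS] by (simp only: sum.distrib)
  next
    case (seq U)
    have eq: "(\<integral>\<^sup>+x. (SUP n. U n) x \<partial>L) = (SUP n. \<integral>\<^sup>+x. U n x \<partial>L)" if "sets L = sets N" for L
      unfolding SUP_apply by (rule nn_integral_monotone_convergence_SUP[OF \<open>incseq U\<close> m[OF seq(1) that]])
    \<comment> \<open>Monotonicity lets the supremum pass through the finite sum of
      integrals.\<close>
    have inc: "incseq (\<lambda>n. \<integral>\<^sup>+x. U n x \<partial>L)" for L
      by (rule incseq_SucI, rule nn_integral_mono) (use incseq_SucD[OF \<open>incseq U\<close>] in \<open>simp add: le_fun_def\<close>)
    have "(\<Sum>i\<in>I. \<integral>\<^sup>+x. (SUP n. U n) x \<partial>M i) = (\<Sum>i\<in>I. SUP n. \<integral>\<^sup>+x. U n x \<partial>M i)"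
      by (intro sum.cong refl eq sets)
    also have "\<dots> = (SUP n. \<Sum>i\<in>I. \<integral>\<^sup>+x. U n x \<partial>M i)"
      by (rule ennreal_SUP_sum[symmetric]) (rule inc)
    also have "\<dots> = (\<integral>\<^sup>+x. (SUP n. U n) x \<partial>S)"
      by (simp only: eq[OF setsS] seq.IH)
    finally show ?case by (rule sym)
  qed
  then show ?thesis by (simp add: S_def)
qed

section \<open>Separation of variables and the equivalence\<close>

text \<open>Vanishing mixed differences say that an increment in direction j is unaffected by steps
  in other directions. It can thus be evaluated on the j-th axis, and the increments add up to
  \<phi>.\<close>

lemma axis_decomposition:
  fixes \<phi> :: "('d::finite \<Rightarrow> nat) \<Rightarrow> real"
  assumes mixed: "\<And>\<alpha> i j. i \<noteq> j \<Longrightarrow> \<phi> (\<lambda>k. \<alpha> k + unit_index i k) + \<phi> (\<lambda>k. \<alpha> k + unit_index j k) - \<phi> \<alpha> -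
      \<phi> (\<lambda>k. \<alpha> k + unit_index i k + unit_index j k) = 0"
  shows "\<phi> \<alpha> = \<phi> (\<lambda>_. 0) + (\<Sum>i\<in>UNIV. \<phi> (\<lambda>k. if k = i then \<alpha> i else 0) - \<phi> (\<lambda>_. 0))"
proof (induction \<alpha> rule: multi_index_induct)
  case (add_unit \<alpha> j)
  \<comment> \<open>Here \<beta> consists of steps in directions other than j, which are taken one
    at a time.\<close>
  have indep: "\<phi> (\<lambda>k. \<gamma> k + \<beta> k + unit_index j k) - \<phi> (\<lambda>k. \<gamma> k + \<beta> k) = \<phi> (\<lambda>k. \<gamma> k + unit_index j k) - \<phi> \<gamma>"
    if "\<beta> j = 0" for \<beta> \<gamma>
    using that
  proof (induction \<beta> rule: multi_index_induct)
    case (add_unit \<beta> i)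
    then have "i \<noteq> j" "\<beta> j = 0" by (auto simp: unit_index_def split: if_splits)
    with mixed[of i j "\<lambda>k. \<gamma> k + \<beta> k"] add_unit.IH show ?case by (simp add: add.assoc)
  qed simp
  define \<gamma> where "\<gamma> = (\<lambda>k. if k = j then \<alpha> j else 0)"
  have \<gamma>: "(\<lambda>k. \<gamma> k + unit_index j k) = (\<lambda>k. if k = j then \<alpha> j + unit_index j j else 0)"
    by (auto simp: \<gamma>_def unit_index_def)
  have \<alpha>: "(\<lambda>k. \<gamma> k + (if k = j then 0 else \<alpha> k)) = \<alpha>" by (auto simp: \<gamma>_def)
  have "\<phi> (\<lambda>k. \<alpha> k + unit_index j k) - \<phi> \<alpha> = \<phi> (\<lambda>k. if k = j then \<alpha> j + unit_index j j else 0) - \<phi> \<gamma>"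
    using indep[of "\<lambda>k. if k = j then 0 else \<alpha> k" \<gamma>] unfolding \<gamma> \<alpha>[THEN fun_cong] by simp
  moreover have "(\<Sum>i\<in>UNIV. \<phi> (\<lambda>k. if k = i then \<alpha> i + unit_index j i else 0) - \<phi> (\<lambda>_. 0)) =
      (\<phi> (\<lambda>k. if k = j then \<alpha> j + unit_index j j else 0) - \<phi> (\<lambda>_. 0)) +
      (\<Sum>i\<in>UNIV - {j}. \<phi> (\<lambda>k. if k = i then \<alpha> i else 0) - \<phi> (\<lambda>_. 0))"
  proof -
    have "(\<lambda>k. if k = i then \<alpha> i + unit_index j i else 0) = (\<lambda>k. if k = i then \<alpha> i else 0)" if "i \<noteq> j" for i
      using that by (auto simp: unit_index_def)
    then show ?thesis by (subst sum.remove[of UNIV j]) simp_all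
  qed
  moreover have "(\<Sum>i\<in>UNIV. \<phi> (\<lambda>k. if k = i then \<alpha> i else 0) - \<phi> (\<lambda>_. 0)) =
      (\<phi> \<gamma> - \<phi> (\<lambda>_. 0)) + (\<Sum>i\<in>UNIV - {j}. \<phi> (\<lambda>k. if k = i then \<alpha> i else 0) - \<phi> (\<lambda>_. 0))"
    by (subst sum.remove[of UNIV j]) (auto simp: \<gamma>_def)
  ultimately show ?case using add_unit by linarith
qed simp

lemma monom_fun_axis_embedding: "monom_fun \<alpha> (axis_embedding i x) = x () ^ \<alpha> i"
proof -
  have "(\<Prod>j\<in>UNIV. axis_embedding i x j ^ \<alpha> j) = (\<Prod>j\<in>UNIV. if j = i then x () ^ \<alpha> i else 1)"
    by (rule prod.cong) (auto simp: axis_embedding_def)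
  then show ?thesis by (simp add: monom_fun_def)
qed

theorem theorem2p4:
  fixes T :: "'d::{finite,linorder} \<Rightarrow> 'h::chilbert_space \<Rightarrow> 'h"
  assumes "completely_hyperexpansive T"
  shows "(\<forall>i j. i \<noteq> j \<longrightarrow> pair_defect (T i) (T j) = (\<lambda>_. 0)) \<longleftrightarrow>
    (\<forall>h. levy_measure T h =
       sum_of_measures (restrict_space borel punctured_cube) UNIV
         (\<lambda>i. zero_extension (restrict_space borel punctured_cube) (levy_factor_product T h i)))"
proof -
  have bc: "bounded_clinear (T i)" and comm: "T i \<circ> T j = T j \<circ> T i" for i j
    using assms by (simp_all add: completely_hyperexpansive_def commuting_tuple_def)
  define \<phi> where "\<phi> h \<alpha> = (norm (tuple_power T \<alpha> h))\<^sup>2" for h \<alpha>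
  have \<phi>0: "\<phi> h (\<lambda>_. 0) = (norm h)\<^sup>2" for h by (simp add: \<phi>_def)
  have T_unit: "tuple_power T (\<lambda>k. \<alpha> k + unit_index i k) h = T i (tuple_power T \<alpha> h)" for \<alpha> i h
  proof -
    have "tuple_power T (unit_index i) g = T i g" for g
      using tuple_power_single[of T i 1] by (simp add: unit_index_def[abs_def])
    then show ?thesis using tuple_power_add[OF comm, where \<alpha> = "unit_index i" and \<beta> = \<alpha> and h = h] by (simp add: add.commute)
  qed
  \<comment> \<open>Mixed differences at \<alpha> for h are those at 0 for the vector
    \<open>tuple_power T \<alpha> h\<close>, so quantifying over \<alpha> as well as h gives the
    same condition.\<close>
  have defect: "pair_defect (T i) (T j) = (\<lambda>_. 0) \<longleftrightarrow> (\<forall>h \<alpha>. \<phi> h (\<lambda>k. \<alpha> k + unit_index i k) +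
      \<phi> h (\<lambda>k. \<alpha> k + unit_index j k) - \<phi> h \<alpha> - \<phi> h (\<lambda>k. \<alpha> k + unit_index i k + unit_index j k) = 0)" for i j
  proof -
    have comm_pt: "T j (T i g) = T i (T j g)" for g using comm by (metis comp_apply)
    have eq: "\<phi> h (\<lambda>k. \<alpha> k + unit_index i k) + \<phi> h (\<lambda>k. \<alpha> k + unit_index j k) - \<phi> h \<alpha> -
        \<phi> h (\<lambda>k. \<alpha> k + unit_index i k + unit_index j k) = - ((norm (T i (T j (tuple_power T \<alpha> h))))\<^sup>2 -
        (norm (T i (tuple_power T \<alpha> h)))\<^sup>2 - (norm (T j (tuple_power T \<alpha> h)))\<^sup>2 + (norm (tuple_power T \<alpha> h))\<^sup>2)" for h \<alpha>
      unfolding \<phi>_def T_unit comm_pt by simp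
    show ?thesis
      unfolding pair_defect_eq_0_iff[OF bc bc comm] eq neg_equal_0_iff_equal
    proof (intro iffI allI)
      fix h
      assume "\<forall>h \<alpha>. (norm (T i (T j (tuple_power T \<alpha> h))))\<^sup>2 - (norm (T i (tuple_power T \<alpha> h)))\<^sup>2 -
        (norm (T j (tuple_power T \<alpha> h)))\<^sup>2 + (norm (tuple_power T \<alpha> h))\<^sup>2 = 0"
      from this[THEN spec, of h, THEN spec, of "\<lambda>_. 0"]
      show "(norm (T i (T j h)))\<^sup>2 - (norm (T i h))\<^sup>2 - (norm (T j h))\<^sup>2 + (norm h)\<^sup>2 = 0"
        unfolding tuple_power_0 .
    qed (erule spec)
  qed
  have unique: "levy_measure T h = \<mu>" if "levy_representation (\<phi> h) \<mu> c" for h \<mu> c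
    using that unfolding \<phi>_def[abs_def] by (rule levy_measure_representation)
  have rep: "\<exists>b. levy_representation (\<phi> h) (levy_measure T h) b" for h
  proof -
    have "nabla \<alpha> (\<phi> h) \<gamma> \<le> 0" if "\<alpha> \<noteq> (\<lambda>_. 0)" for \<alpha> \<gamma>
      unfolding \<phi>_def[abs_def] by (rule completely_hyperexpansive_nabla_le_0[OF assms that])
    from levy_representation_exists[of "\<phi> h", OF this] obtain \<mu> c where c: "levy_representation (\<phi> h) \<mu> c" by blast
    then show ?thesis unfolding unique[OF c] by blast
  qed
  define \<nu> where "\<nu> i h = levy_measure (\<lambda>_::unit. T i) h" for i h
  have axis: "\<phi> h (\<lambda>k. if k = i then \<alpha> () else 0) = (norm (tuple_power (\<lambda>_::unit. T i) \<alpha> h))\<^sup>2" for h i and \<alpha> :: "unit \<Rightarrow> nat"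
    by (simp add: \<phi>_def tuple_power_single tuple_power_unit)
  \<comment> \<open>Restricting \<phi> to the i-th axis yields the powers of \<open>T i\<close>, so
    the measure of the single operator exists as a marginal of the joint one.\<close>
  have "\<exists>b. levy_representation (\<lambda>\<alpha>. \<phi> h (\<lambda>k. if k = i then \<alpha> () else 0)) (\<nu> i h) b" for i h
  proof -
    obtain c where "levy_representation (\<phi> h) (levy_measure T h) c" using rep by blast
    from marginal_levy_representation[OF this, of i] obtain \<mu> c'
      where c': "levy_representation (\<lambda>\<alpha> :: unit \<Rightarrow> nat. \<phi> h (\<lambda>k. if k = i then \<alpha> () else 0)) \<mu> c'" by blast
    have "\<nu> i h = \<mu>" unfolding \<nu>_def by (rule levy_measure_representation) (rule c'[unfolded axis])
    with c' show ?thesis by blast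
  qed
  note ex = this
  define b where "b i h = (SOME c. levy_representation (\<lambda>\<alpha>. \<phi> h (\<lambda>k. if k = i then \<alpha> () else 0)) (\<nu> i h) c)" for i h
  have \<nu>: "levy_representation (\<lambda>\<alpha>. \<phi> h (\<lambda>k. if k = i then \<alpha> () else 0)) (\<nu> i h) (b i h)" for i h
    unfolding b_def by (rule someI_ex[OF ex])
  have sets\<nu>: "sets (\<nu> i h) = sets (restrict_space borel punctured_cube)" and bpos: "0 \<le> b i h u"
    and int\<nu>: "integrable (\<nu> i h) (\<lambda>x. 1 - monom_fun \<alpha> x)"
    and val\<nu>: "\<phi> h (\<lambda>k. if k = i then \<alpha> () else 0) = \<phi> h (\<lambda>k. if k = i then 0 else 0) +
        (\<Sum>u\<in>UNIV. real (\<alpha> u) * b i h u) + (LINT x|\<nu> i h. 1 - monom_fun \<alpha> x)" for i h u and \<alpha> :: "unit \<Rightarrow> nat"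
    using \<nu>[where h = h and i = i] unfolding levy_representation_def by blast+
  \<comment> \<open>The right-hand side of the equivalence, with each product replaced by the image
    of a one-variable measure on its edge.\<close>
  define S where "S h = sum_of_measures (restrict_space borel punctured_cube) UNIV
      (\<lambda>i. distr (\<nu> i h) (restrict_space borel punctured_cube) (axis_embedding i))" for h
  have axis_factor: "zero_extension (restrict_space borel punctured_cube) (levy_factor_product T h i) =
      distr (\<nu> i h) (restrict_space borel punctured_cube) (axis_embedding i)" for i h
    unfolding \<nu>_def
    by (rule zero_extension_levy_factor_product; fold \<nu>_def)
      (rule sets\<nu>, rule levy_representation_corner_distance[OF \<nu>])
  have S: "sum_of_measures (restrict_space borel punctured_cube) UNIV
      (\<lambda>i. zero_extension (restrict_space borel punctured_cube) (levy_factor_product T h i)) = S h" for h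
    unfolding S_def axis_factor ..
  have setsS: "sets (S h) = sets (restrict_space borel punctured_cube)" for h
    unfolding S_def by (rule sets_sum_of_measures)
  have emb: "axis_embedding i \<in> measurable (\<nu> i h) (restrict_space borel punctured_cube)" for i h
    using measurable_axis_embedding by (simp add: measurable_cong_sets[OF sets\<nu> refl])
  have nnS: "(\<integral>\<^sup>+x. f x \<partial>S h) = (\<Sum>i\<in>UNIV. \<integral>\<^sup>+x. f (axis_embedding i x) \<partial>\<nu> i h)"
    if "f \<in> borel_measurable borel" for f h
    unfolding S_def
    by (subst nn_integral_sum_of_measures) (auto intro!: sum.cong nn_integral_distr emb measurable_restrict_space1 that)
  show ?thesis
    unfolding S
  proof
    assume D: "\<forall>i j. i \<noteq> j \<longrightarrow> pair_defect (T i) (T j) = (\<lambda>_. 0)"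
    show "\<forall>h. levy_measure T h = S h"
    proof
      fix h
      have decomp: "\<phi> h \<alpha> = \<phi> h (\<lambda>_. 0) + (\<Sum>i\<in>UNIV. \<phi> h (\<lambda>k. if k = i then \<alpha> i else 0) - \<phi> h (\<lambda>_. 0))" for \<alpha>
        by (rule axis_decomposition) (use D defect in blast)
      \<comment> \<open>The one-variable formulas are added: the coefficient in direction i is that
        of \<open>T i\<close>, and integrals over \<open>S h\<close> split edge by edge.\<close>
      have "levy_representation (\<phi> h) (S h) (\<lambda>i. b i h ())"
        unfolding levy_representation_def
      proof (intro conjI allI setsS bpos)
        fix \<alpha> :: "'d \<Rightarrow> nat"
        define V where "V i = (LINT x|\<nu> i h. 1 - monom_fun (\<lambda>_. \<alpha> i) x)" for i
        have mon: "monom_fun (\<lambda>_. n) x = x () ^ n" for x :: "unit \<Rightarrow> real" and n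
          by (simp add: monom_fun_def UNIV_unit)
        have cube: "0 \<le> 1 - x () ^ n" if "x \<in> space (\<nu> i h)" for x n i
        proof -
          have "0 \<le> x ()" "x () \<le> 1"
            using that space_eq_punctured_cube[OF sets\<nu>[of i h]] by (auto simp: punctured_cube_def)
          then show ?thesis by (simp add: power_le_one)
        qed
        have V0: "0 \<le> V i" for i
          unfolding V_def mon by (rule Bochner_Integration.integral_nonneg) (rule cube)
        \<comment> \<open>On the i-th edge the monomial collapses to a power of one coordinate.
          Nonnegative integrals deliver integrability together with the value.\<close>
        have "(\<integral>\<^sup>+x. ennreal (1 - monom_fun \<alpha> x) \<partial>S h) = (\<Sum>i\<in>UNIV. \<integral>\<^sup>+x. ennreal (1 - x () ^ \<alpha> i) \<partial>\<nu> i h)"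
          by (subst nnS) (simp_all add: monom_fun_axis_embedding)
        also have "\<dots> = (\<Sum>i\<in>UNIV. ennreal (V i))"
        proof (rule sum.cong[OF refl])
          fix i
          show "(\<integral>\<^sup>+x. ennreal (1 - x () ^ \<alpha> i) \<partial>\<nu> i h) = ennreal (V i)"
            unfolding V_def mon using int\<nu>[of i h "\<lambda>_. \<alpha> i"] cube
            by (intro nn_integral_eq_integral AE_I2) (simp_all only: mon)
        qed
        also have "\<dots> = ennreal (\<Sum>i\<in>UNIV. V i)" using V0 by (simp add: sum_ennreal)
        finally have nn: "(\<integral>\<^sup>+x. ennreal (1 - monom_fun \<alpha> x) \<partial>S h) = ennreal (\<Sum>i\<in>UNIV. V i)" .
        have "has_bochner_integral (S h) (\<lambda>x. 1 - monom_fun \<alpha> x) (\<Sum>i\<in>UNIV. V i)"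
        proof (rule has_bochner_integral_nn_integral[OF _ _ _ nn])
          show "(\<lambda>x. 1 - monom_fun \<alpha> x) \<in> borel_measurable (S h)"
            by (rule measurable_punctured_cube[OF setsS]) measurable
          show "AE x in S h. 0 \<le> 1 - monom_fun \<alpha> x"
            using monom_fun_cube(2)[of _ \<alpha>] by (intro AE_I2) (simp add: space_eq_punctured_cube[OF setsS] punctured_cube_eq)
          show "0 \<le> (\<Sum>i\<in>UNIV. V i)" by (rule sum_nonneg) (rule V0)
        qed
        moreover have "\<phi> h \<alpha> = \<phi> h (\<lambda>_. 0) + (\<Sum>i\<in>UNIV. real (\<alpha> i) * b i h ()) + (\<Sum>i\<in>UNIV. V i)"
        proof -
          have "\<phi> h (\<lambda>k. if k = i then \<alpha> i else 0) - \<phi> h (\<lambda>_. 0) = real (\<alpha> i) * b i h () + V i" for i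
            using val\<nu>[of h i "\<lambda>_. \<alpha> i"] by (simp add: V_def UNIV_unit)
          then show ?thesis using decomp[of \<alpha>] by (simp add: sum.distrib)
        qed
        ultimately show "integrable (S h) (\<lambda>x. 1 - monom_fun \<alpha> x)"
          "\<phi> h \<alpha> = \<phi> h (\<lambda>_. 0) + (\<Sum>i\<in>UNIV. real (\<alpha> i) * b i h ()) + (LINT x|S h. 1 - monom_fun \<alpha> x)"
          unfolding has_bochner_integral_iff by simp_all
      qed
      then show "levy_measure T h = S h" unfolding \<phi>_def[abs_def] by (rule levy_measure_representation)
    qed
  next
    assume eq: "\<forall>h. levy_measure T h = S h"
    have "\<phi> h (\<lambda>k. \<alpha> k + unit_index i k) + \<phi> h (\<lambda>k. \<alpha> k + unit_index j k) - \<phi> h \<alpha> -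
        \<phi> h (\<lambda>k. \<alpha> k + unit_index i k + unit_index j k) = 0" if ij: "i \<noteq> j" for i j h \<alpha>
    proof -
      obtain c where c: "levy_representation (\<phi> h) (S h) c" using rep[of h] eq by metis
      have "(\<integral>\<^sup>+x. ennreal (monom_fun \<alpha> x * ((1 - x i) * (1 - x j))) \<partial>S h) = 0"
      proof (subst nnS)
        \<comment> \<open>On the k-th edge all coordinates but the k-th are 1, and i and j cannot
          both be k.\<close>
        have "(1 - axis_embedding k x i) * (1 - axis_embedding k x j) = 0" for k x
          using ij by (auto simp: axis_embedding_def)
        note vanish = this
        show "(\<Sum>k\<in>UNIV. \<integral>\<^sup>+x. ennreal (monom_fun \<alpha> (axis_embedding k x) *
            ((1 - axis_embedding k x i) * (1 - axis_embedding k x j))) \<partial>\<nu> k h) = 0"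
          unfolding vanish by simp
      qed measurable
      then have "has_bochner_integral (S h) (\<lambda>x. monom_fun \<alpha> x * ((1 - x i) * (1 - x j))) 0"
      proof (intro has_bochner_integral_nn_integral)
        show "(\<lambda>x. monom_fun \<alpha> x * ((1 - x i) * (1 - x j))) \<in> borel_measurable (S h)"
          by (rule measurable_punctured_cube[OF setsS]) measurable
        show "AE x in S h. 0 \<le> monom_fun \<alpha> x * ((1 - x i) * (1 - x j))"
        proof (rule AE_I2)
          fix x assume "x \<in> space (S h)"
          then have "x \<in> cube" by (simp add: space_eq_punctured_cube[OF setsS] punctured_cube_eq)
          with monom_fun_cube(1)[OF this, of \<alpha>] show "0 \<le> monom_fun \<alpha> x * ((1 - x i) * (1 - x j))"
            by (simp add: cube_def)
        qed
      qed simp_all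
      \<comment> \<open>The Levy-Khinchin formula gives this same integral as minus the mixed
        difference, so the two values coincide.\<close>
      from has_bochner_integral_eq[OF levy_representation_moments[OF c] this] show ?thesis .
    qed
    then show "\<forall>i j. i \<noteq> j \<longrightarrow> pair_defect (T i) (T j) = (\<lambda>_. 0)" unfolding defect by blast
  qed
qed

end
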